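(* Let $G$ be a connected graph with at least three edges and let $n\ge 2$ be an integer. Then the $n$-iterated line graph $L^n(G)$ is traceable if and only if $EUP_n(G)\neq\emptyset$.
   Context: Graphs are finite, undirected and loopless (multiple edges are allowed). A graph is traceable if it has a hamiltonian path. The line graph $L(G)$ of $G$ has vertex set $E(G)$, two vertices of $L(G)$ being adjacent if and only if they are adjacent as edges in $G$ (i.e. share an endpoint). The iterated line graph is $L^1(G)=L(G)$ and $L^n(G)=L(L^{n-1}(G))$, where $L^{n-1}(G)$ is assumed to have a nonempty edge set. For a graph $H$: $V_i(H)=\{v\in V(H): d_H(v)=i\}$ (degree counts edges with multiplicity), $W(H)=V(H)\setminus V_2(H)$, and $O(H)$ is the set of vertices of odd degree of $H$. $\Delta(G)$ is the maximum degree of $G$. A branch in $G$ is a nontrivial path of $G$ whose ends lie in $W(G)$ and whose internal vertices, if any, have degree 2 in $G$. $B(G)$ is the set of branches of $G$, and $B_1(G)=\{b\in B(G): V(b)\cap V_1(G)\neq\emptyset\}$. For subgraphs $H_1,H_2$ of $G$, $d_G(H_1,H_2)=\min\{d_G(v_1,v_2): v_1\in V(H_1), v_2\in V(H_2)\}$. For a positive integer $k$, $EUP_k(G)$ is the set of subgraphs $H$ of $G$ satisfying all of the following: - $|O(H)|\le 2$; - $V_0(H)\subseteq \bigcup_{i=3}^{\Delta(G)}V_i(G)\subseteq V(H)$; - $d_G(H_1,H-H_1)\le k-1$ for every subgraph $H_1$ of $H$ that is the union of a nonempty, proper subcollection of the components of $H$ (so that $H-H_1$ is the union of the remaining components); -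 $|E(b)|\le k+1$ for every branch $b\in B(G)$ with $E(b)\cap E(H)=\emptyset$; - $|E(b)|\le k$ for every branch $b\in B_1(G)$ with $E(b)\cap E(H)=\emptyset$. *)

theory Defs
  imports Main "HOL-Library.Extended_Nat" "HOL-Library.Uprod"
begin

text \<open>Finite undirected loopless multigraphs: parallel edges are distinct edges
  with the same set of endpoints.\<close>

record ('v, 'e) multigraph =
  verts :: "'v set"
  edges :: "'e set"
  ends :: "'e \<Rightarrow> 'v set"

definition fin_graph :: "('v, 'e) multigraph \<Rightarrow> bool" where
  "fin_graph G \<longleftrightarrow> finite (verts G) \<and> finite (edges G) \<and>
     (\<forall>e\<in>edges G. ends G e \<subseteq> verts G \<and> card (ends G e) = 2)"

text \<open>Requiring the whole function \<open>ends\<close> to agree makes a subgraph determined by its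
  vertex set and its edge set.\<close>

definition subgraph :: "('v, 'e) multigraph \<Rightarrow> ('v, 'e) multigraph \<Rightarrow> bool" where
  "subgraph H G \<longleftrightarrow> fin_graph H \<and> verts H \<subseteq> verts G \<and> edges H \<subseteq> edges G \<and> ends H = ends G"

definition walk :: "('v, 'e) multigraph \<Rightarrow> 'v list \<Rightarrow> 'e list \<Rightarrow> bool" where
  "walk G vs es \<longleftrightarrow> length vs = Suc (length es) \<and> set vs \<subseteq> verts G \<and> set es \<subseteq> edges G \<and>
     (\<forall>i<length es. ends G (es ! i) = {vs ! i, vs ! Suc i})"

definition path :: "('v, 'e) multigraph \<Rightarrow> 'v list \<Rightarrow> 'e list \<Rightarrow> bool" where
  "path G vs es \<longleftrightarrow> walk G vs es \<and> distinct vs"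

definition traceable :: "('v, 'e) multigraph \<Rightarrow> bool" where
  "traceable G \<longleftrightarrow> (\<exists>vs es. path G vs es \<and> set vs = verts G)"

definition connected_graph :: "('v, 'e) multigraph \<Rightarrow> bool" where
  "connected_graph G \<longleftrightarrow> verts G \<noteq> {} \<and>
     (\<forall>u\<in>verts G. \<forall>v\<in>verts G. \<exists>vs es. walk G vs es \<and> hd vs = u \<and> last vs = v)"

definition components :: "('v, 'e) multigraph \<Rightarrow> ('v, 'e) multigraph set" where
  "components H = {C. subgraph C H \<and> connected_graph C \<and>
     (\<forall>D. subgraph D H \<and> connected_graph D \<and> subgraph C D \<longrightarrow> D = C)}"

definition degree :: "('v, 'e) multigraph \<Rightarrow> 'v \<Rightarrow> nat" where
  "degree G v = card {e \<in> edges G. v \<in> ends G e}"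

definition max_degree :: "('v, 'e) multigraph \<Rightarrow> nat" where
  "max_degree G = Max (degree G ` verts G)"

definition deg_verts :: "nat \<Rightarrow> ('v, 'e) multigraph \<Rightarrow> 'v set" where
  "deg_verts i G = {v \<in> verts G. degree G v = i}"

definition W_verts :: "('v, 'e) multigraph \<Rightarrow> 'v set" where
  "W_verts G = verts G - deg_verts 2 G"

definition odd_verts :: "('v, 'e) multigraph \<Rightarrow> 'v set" where
  "odd_verts G = {v \<in> verts G. odd (degree G v)}"

text \<open>Distances are infinite when there is no connecting walk; the infimum of a nonempty
  set of extended naturals is its minimum.\<close>

definition vdist :: "('v, 'e) multigraph \<Rightarrow> 'v \<Rightarrow> 'v \<Rightarrow> enat" where
  "vdist G u v = Inf {enat (length es) | vs es. walk G vs es \<and> hd vs = u \<and> last vs = v}"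

definition sub_dist ::
  "('v, 'e) multigraph \<Rightarrow> ('v, 'e) multigraph \<Rightarrow> ('v, 'e) multigraph \<Rightarrow> enat" where
  "sub_dist G A B = Inf {vdist G u v | u v. u \<in> verts A \<and> v \<in> verts B}"

text \<open>A branch is given as a vertex sequence together with an edge sequence (so each branch
  occurs once for either direction); its ends are distinct, since it is a path.\<close>

definition branches :: "('v, 'e) multigraph \<Rightarrow> ('v list \<times> 'e list) set" where
  "branches G = {(vs, es). path G vs es \<and> es \<noteq> [] \<and> hd vs \<in> W_verts G \<and> last vs \<in> W_verts G \<and>
     (\<forall>v\<in>set (butlast (tl vs)). degree G v = 2)}"

definition branch_verts :: "'v list \<times> 'e list \<Rightarrow> 'v set" where
  "branch_verts b = set (fst b)"

definition branch_edges :: "'v list \<times> 'e list \<Rightarrow> 'e set" where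
  "branch_edges b = set (snd b)"

definition end_branches :: "('v, 'e) multigraph \<Rightarrow> ('v list \<times> 'e list) set" where
  "end_branches G = {b \<in> branches G. branch_verts b \<inter> deg_verts 1 G \<noteq> {}}"

definition union_of :: "('v, 'e) multigraph \<Rightarrow> ('v, 'e) multigraph set \<Rightarrow> ('v, 'e) multigraph" where
  "union_of H \<C> = \<lparr>verts = (\<Union>C\<in>\<C>. verts C), edges = (\<Union>C\<in>\<C>. edges C), ends = ends H\<rparr>"

definition EUP :: "nat \<Rightarrow> ('v, 'e) multigraph \<Rightarrow> ('v, 'e) multigraph set" where
  "EUP k G = {H. subgraph H G \<and>
     card (odd_verts H) \<le> 2 \<and>
     deg_verts 0 H \<subseteq> (\<Union>i\<in>{3..max_degree G}. deg_verts i G) \<and>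
     (\<Union>i\<in>{3..max_degree G}. deg_verts i G) \<subseteq> verts H \<and>
     (\<forall>\<C>. \<C> \<noteq> {} \<and> \<C> \<subset> components H \<longrightarrow>
        sub_dist G (union_of H \<C>) (union_of H (components H - \<C>)) \<le> enat (k - 1)) \<and>
     (\<forall>b\<in>branches G. branch_edges b \<inter> edges H = {} \<longrightarrow> card (branch_edges b) \<le> k + 1) \<and>
     (\<forall>b\<in>end_branches G. branch_edges b \<inter> edges H = {} \<longrightarrow> card (branch_edges b) \<le> k)}"

text \<open>Vertices and edges of all iterated line graphs of a graph live in one type, so that
  the line graph operator can be iterated: \<open>Adj (Upair e f)\<close> is the edge of the line graph
  joining the adjacent edges \<open>e\<close> and \<open>f\<close>.  The line graph has no parallel edges.\<close>

datatype ('v, 'e) cell = Vert 'v | Edge 'e | Adj "('v, 'e) cell uprod"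

definition embed :: "('v, 'e) multigraph \<Rightarrow> (('v, 'e) cell, ('v, 'e) cell) multigraph" where
  "embed G = \<lparr>verts = Vert ` verts G, edges = Edge ` edges G,
     ends = (\<lambda>x. case x of Edge e \<Rightarrow> Vert ` ends G e | _ \<Rightarrow> {})\<rparr>"

definition line_graph ::
  "(('v, 'e) cell, ('v, 'e) cell) multigraph \<Rightarrow> (('v, 'e) cell, ('v, 'e) cell) multigraph" where
  "line_graph G = \<lparr>verts = edges G,
     edges = {Adj (Upair e f) | e f. e \<in> edges G \<and> f \<in> edges G \<and> e \<noteq> f \<and> ends G e \<inter> ends G f \<noteq> {}},
     ends = (\<lambda>x. case x of Adj p \<Rightarrow> set_uprod p | _ \<Rightarrow> {})\<rparr>"

definition iterated_line_graph ::
  "nat \<Rightarrow> ('v, 'e) multigraph \<Rightarrow> (('v, 'e) cell, ('v, 'e) cell) multigraph" where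
  "iterated_line_graph n G = (line_graph ^^ n) (embed G)"

lemma fin_graph_embed: "fin_graph G \<Longrightarrow> fin_graph (embed G)"
  by (auto simp: fin_graph_def embed_def card_image inj_on_def)

lemma fin_graph_line_graph:
  assumes "fin_graph G"
  shows "fin_graph (line_graph G)"
proof -
  have "edges (line_graph G) \<subseteq> (\<lambda>(e, f). Adj (Upair e f)) ` (edges G \<times> edges G)"
    by (auto simp: line_graph_def)
  then have "finite (edges (line_graph G))"
    by (rule finite_subset) (use assms in \<open>auto simp: fin_graph_def\<close>)
  then show ?thesis
    using assms by (auto simp: fin_graph_def line_graph_def)
qed

lemma fin_graph_iterated_line_graph: "fin_graph G \<Longrightarrow> fin_graph (iterated_line_graph n G)"
  by (induction n) (auto simp: iterated_line_graph_def fin_graph_embed fin_graph_line_graph)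

end

theory Submission
  imports Defs
begin

text \<open>Call a pair of an edge set \<open>A\<close> and a vertex set \<open>R\<close> a \<open>k\<close>-skeleton if \<open>A\<close> has at most two vertices of
  odd degree, \<open>R\<close> consists of the vertices covered by \<open>A\<close> and of some vertices of degree at least 3, \<open>R\<close>
  is connected by edges of \<open>A\<close> and by jumps of distance at most \<open>k - 1\<close>, and every path with \<open>k\<close> edges
  meets \<open>R\<close>.  A 1-skeleton is a dominating trail, so by the argument of Harary and Nash-Williams it
  exists in \<open>G\<close> iff \<open>L(G)\<close> is traceable.  A \<open>(k + 1)\<close>-skeleton of \<open>G\<close> exists iff \<open>L(G)\<close> has a
  \<open>k\<close>-skeleton: downwards one keeps the edges of \<open>G\<close> that are met with odd parity inside the clique
  of one of their ends; upwards one chooses an edge set with the prescribed parities in the clique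
  of each vertex and makes each clique connected by toggling triangles.  Hence \<open>L\<^sup>n(G)\<close> is traceable
  iff \<open>G\<close> has an \<open>n\<close>-skeleton, and for \<open>n \<ge> 2\<close> this means that \<open>EUP\<close> is not empty.\<close>

section \<open>Skeletons\<close>

text \<open>The \<open>EUP\<close> conditions speak of branches, hence of degrees, and do not pass
  to line graphs as they stand. The clauses of a skeleton are chosen so that each shifts by exactly
  one: a path with \<open>k + 1\<close> edges in G has an edge sequence that is a path with
  \<open>k\<close> edges in L(G), and a walk of \<open>k\<close> steps between distinct vertices
  becomes a walk of \<open>k - 1\<close> steps between edges at them. The number of odd vertices
  does not grow in either direction, so the bound 2 survives every step. Degree 3 is the threshold
  because a clique on at least three vertices contains triangles, which can be toggled to connect it
  without touching parities; so a hub may belong to \<open>R\<close> without being covered by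
  \<open>A\<close>. At a vertex of degree 2 the clique is a single edge and parity alone decides
  whether it is present. At \<open>k = 1\<close> the jumps vanish and \<open>R\<close> need not
  contain all hubs, but one descent adds them, and \<open>n \<ge> 2\<close> guarantees a descent.
  The three edges of G serve to rule out a pair of parallel edges forming a whole component.\<close>

definition links :: "('v, 'e) multigraph \<Rightarrow> 'e set \<Rightarrow> 'v rel" where
  "links G A = {(x, y). \<exists>e\<in>A. ends G e = {x, y}}"

abbreviation adj :: "('v, 'e) multigraph \<Rightarrow> 'v rel" where
  "adj G \<equiv> links G (edges G)"

text \<open>Distance at most \<open>m\<close>. The reflexive closure lets a walk pause, so shorter
  walks count as well; every pair \<open>(x, x)\<close> belongs to it, even outside the vertex
  set.\<close>

definition near :: "('v, 'e) multigraph \<Rightarrow> nat \<Rightarrow> 'v rel" where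
  "near G m = ((adj G)\<^sup>=) ^^ m"

definition incident :: "('v, 'e) multigraph \<Rightarrow> 'e set \<Rightarrow> 'v \<Rightarrow> 'e set" where
  "incident G A v = {e \<in> A. v \<in> ends G e}"

definition odd_set :: "('v, 'e) multigraph \<Rightarrow> 'e set \<Rightarrow> 'v set" where
  "odd_set G A = {v. odd (card (incident G A v))}"

definition cover :: "('v, 'e) multigraph \<Rightarrow> 'e set \<Rightarrow> 'v set" where
  "cover G A = (\<Union>e\<in>A. ends G e)"

definition hubs :: "('v, 'e) multigraph \<Rightarrow> 'v set" where
  "hubs G = {v \<in> verts G. 3 \<le> degree G v}"

text \<open>Only the two ends of a jump have to lie in \<open>R\<close>; the walk behind it may
  leave \<open>R\<close>. For \<open>m = 0\<close> the jumps are trivial and only the links of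
  \<open>A\<close> matter.\<close>

definition hops :: "nat \<Rightarrow> ('v, 'e) multigraph \<Rightarrow> 'e set \<Rightarrow> 'v set \<Rightarrow> 'v rel" where
  "hops m G A R = (links G A \<union> near G m) \<inter> R \<times> R"

text \<open>A path recorded by its vertices alone, so that the choice among parallel edges is
  irrelevant. From two vertices on, adjacency forces every entry to be an end of an edge.\<close>

definition chain :: "('v, 'e) multigraph \<Rightarrow> 'v list \<Rightarrow> bool" where
  "chain G xs \<longleftrightarrow> distinct xs \<and> successively (\<lambda>x y. (x, y) \<in> adj G) xs"

text \<open>For \<open>k = 1\<close> this is a dominating trail.  For larger \<open>k\<close> the links of \<open>A\<close> are redundant in
  \<open>hops\<close>, and the last clause, which only concerns paths through vertices of degree at most 2 once
  \<open>hubs G \<subseteq> R\<close>, replaces the two branch conditions of \<open>EUP\<close>.\<close>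

definition skeleton :: "nat \<Rightarrow> ('v, 'e) multigraph \<Rightarrow> 'e set \<Rightarrow> 'v set \<Rightarrow> bool" where
  "skeleton k G A R \<longleftrightarrow> A \<subseteq> edges G \<and> card (odd_set G A) \<le> 2 \<and>
     cover G A \<subseteq> R \<and> R \<subseteq> cover G A \<union> hubs G \<and> R \<noteq> {} \<and>
     R \<times> R \<subseteq> (hops (k - 1) G A R)\<^sup>* \<and>
     (\<forall>xs. chain G xs \<and> length xs = Suc k \<longrightarrow> set xs \<inter> R \<noteq> {})"

section \<open>Incidence and the parity of degrees\<close>

lemma degree_incident: "degree G v = card (incident G (edges G) v)"
  by (simp add: degree_def incident_def)

lemma finite_incident: "finite A \<Longrightarrow> finite (incident G A v)"
  by (simp add: incident_def)

lemma finite_edges: "fin_graph G \<Longrightarrow> finite (edges G)"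
  by (simp add: fin_graph_def)

lemma finite_subset_edges: "fin_graph G \<Longrightarrow> A \<subseteq> edges G \<Longrightarrow> finite A"
  using finite_edges finite_subset by blast

lemma ends_subset: "fin_graph G \<Longrightarrow> e \<in> edges G \<Longrightarrow> ends G e \<subseteq> verts G"
  by (auto simp: fin_graph_def)

lemma obtain_ends:
  assumes "fin_graph G" "e \<in> edges G"
  obtains x y where "ends G e = {x, y}" "x \<noteq> y"
  using assms by (auto simp: fin_graph_def card_2_iff)

lemma obtain_other_end:
  assumes "fin_graph G" "e \<in> edges G" "x \<in> ends G e"
  obtains y where "ends G e = {x, y}" "x \<noteq> y"
proof -
  obtain a b where ab: "ends G e = {a, b}" "a \<noteq> b" using obtain_ends[OF assms(1,2)] .
  show thesis
  proof (cases "x = a")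
    case True
    then show thesis using ab that[of b] by simp
  next
    case False
    then show thesis using ab assms(3) that[of a] by (simp add: insert_commute)
  qed
qed

lemma odd_set_subset_cover: "odd_set G A \<subseteq> cover G A"
proof
  fix v assume "v \<in> odd_set G A"
  then have "incident G A v \<noteq> {}" by (auto simp: odd_set_def)
  then show "v \<in> cover G A" by (auto simp: incident_def cover_def)
qed

lemma cover_subset_verts: "fin_graph G \<Longrightarrow> A \<subseteq> edges G \<Longrightarrow> cover G A \<subseteq> verts G"
  unfolding cover_def using ends_subset by fastforce

lemma finite_cover: "fin_graph G \<Longrightarrow> A \<subseteq> edges G \<Longrightarrow> finite (cover G A)"
  using cover_subset_verts finite_subset unfolding fin_graph_def by metis

lemma finite_odd_set: "fin_graph G \<Longrightarrow> A \<subseteq> edges G \<Longrightarrow> finite (odd_set G A)"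
  using finite_cover odd_set_subset_cover finite_subset by metis

lemma odd_card_sym_diff:
  assumes "finite A" "finite B"
  shows "odd (card (sym_diff A B)) \<longleftrightarrow> odd (card A) \<noteq> odd (card B)"
proof -
  have "card (sym_diff A B) + 2 * card (A \<inter> B) = card A + card B"
  proof -
    have "card (sym_diff A B) = card (A - B) + card (B - A)"
      using assms by (intro card_Un_disjoint) auto
    moreover have "card A = card (A - B) + card (A \<inter> B)"
      using card_Int_Diff[OF assms(1), of B] by simp
    moreover have "card B = card (B - A) + card (A \<inter> B)"
      using card_Int_Diff[OF assms(2), of A] by (simp add: Int_commute)
    ultimately show ?thesis by simp
  qed
  then show ?thesis by presburger
qed

lemma incident_sym_diff: "incident G (sym_diff A B) v = sym_diff (incident G A v) (incident G B v)"
  by (auto simp: incident_def)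

text \<open>\<open>odd_set\<close> is the boundary map over the field with two elements, where
  symmetric difference is addition. Adding an edge, toggling a triangle and removing a trail are all
  instances of this additivity.\<close>

lemma odd_set_sym_diff:
  assumes "finite A" "finite B"
  shows "odd_set G (sym_diff A B) = sym_diff (odd_set G A) (odd_set G B)"
proof -
  have "v \<in> odd_set G (sym_diff A B) \<longleftrightarrow> (v \<in> odd_set G A) \<noteq> (v \<in> odd_set G B)" for v
    unfolding odd_set_def incident_sym_diff
    using odd_card_sym_diff[OF finite_incident[OF assms(1)] finite_incident[OF assms(2)]]
    by (simp only: mem_Collect_eq)
  then show ?thesis by blast
qed

lemma odd_set_edge:
  assumes "fin_graph G" "e \<in> edges G"
  shows "odd_set G {e} = ends G e"
proof -
  have "incident G {e} v = (if v \<in> ends G e then {e} else {})" for v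
    by (auto simp: incident_def)
  then show ?thesis by (auto simp: odd_set_def)
qed

lemma odd_set_insert:
  assumes "fin_graph G" "A \<subseteq> edges G" "e \<in> edges G" "e \<notin> A"
  shows "odd_set G (insert e A) = sym_diff (odd_set G A) (ends G e)"
proof -
  have "insert e A = sym_diff A {e}" using assms(4) by blast
  then show ?thesis
    using odd_set_sym_diff[of A "{e}" G] odd_set_edge[OF assms(1,3)] finite_subset_edges[OF assms(1,2)]
    by simp
qed

section \<open>Links and bounded distance\<close>

lemma sym_links: "sym (links G A)"
  by (auto simp: links_def sym_def insert_commute)

lemma links_mono: "A \<subseteq> B \<Longrightarrow> links G A \<subseteq> links G B"
  by (auto simp: links_def)

lemma links_cover: "links G A \<subseteq> cover G A \<times> cover G A"
  by (auto simp: links_def cover_def)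

lemma sym_relpow: "sym r \<Longrightarrow> sym (r ^^ n)"
proof (induction n)
  case (Suc n)
  show ?case
    unfolding sym_def
  proof (intro allI impI)
    fix x y assume "(x, y) \<in> r ^^ Suc n"
    then obtain z where "(x, z) \<in> r" "(z, y) \<in> r ^^ n" by (metis relpow_Suc_D2)
    then have "(y, z) \<in> r ^^ n" "(z, x) \<in> r" using Suc by (auto dest: symD)
    then show "(y, x) \<in> r ^^ Suc n" by auto
  qed
qed (simp add: sym_Id)

lemma sym_near: "sym (near G m)"
  unfolding near_def by (intro sym_relpow) (simp add: sym_Un sym_Id sym_links)

lemma near_mono: "m \<le> n \<Longrightarrow> near G m \<subseteq> near G n"
proof (induction n arbitrary: m)
  case (Suc n)
  have "near G n \<subseteq> near G (Suc n)" unfolding near_def by auto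
  with Suc show ?case by (metis le_Suc_eq order_refl subset_trans)
qed simp

lemma near_refl: "(x, x) \<in> near G m"
proof -
  have "(x, x) \<in> near G 0" by (simp add: near_def)
  then show ?thesis using near_mono[of 0 m G] by blast
qed

lemma near_adj: "0 < m \<Longrightarrow> adj G \<subseteq> near G m"
  using near_mono[of 1 m G] by (auto simp: near_def)

lemma hops_near: "0 < m \<Longrightarrow> A \<subseteq> edges G \<Longrightarrow> hops m G A R = near G m \<inter> R \<times> R"
  unfolding hops_def using near_adj[of m G] links_mono[of A "edges G" G] by auto

lemma skeleton_verts: "fin_graph G \<Longrightarrow> skeleton k G A R \<Longrightarrow> R \<subseteq> verts G"
  unfolding skeleton_def hubs_def using cover_subset_verts by blast

section \<open>Line graphs\<close>

lemma verts_line_graph [simp]: "verts (line_graph G) = edges G"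
  by (simp add: line_graph_def)

lemma ends_line_graph [simp]: "ends (line_graph G) (Adj (Upair e f)) = {e, f}"
  by (simp add: line_graph_def)

lemma edges_line_graph_iff:
  "Adj (Upair e f) \<in> edges (line_graph G) \<longleftrightarrow>
     e \<in> edges G \<and> f \<in> edges G \<and> e \<noteq> f \<and> ends G e \<inter> ends G f \<noteq> {}"
  by (auto simp: line_graph_def)

lemma Adj_commute: "Adj (Upair f e) = Adj (Upair e f)"
  by simp

lemma obtain_line_edge:
  assumes "a \<in> edges (line_graph G)"
  obtains e f where "a = Adj (Upair e f)" "e \<in> edges G" "f \<in> edges G" "e \<noteq> f" "ends G e \<inter> ends G f \<noteq> {}"
  using assms by (auto simp: line_graph_def)

lemma line_edge_eqI:
  assumes "a \<in> edges (line_graph G)" "e \<in> ends (line_graph G) a" "f \<in> ends (line_graph G) a" "e \<noteq> f"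
  shows "a = Adj (Upair e f)"
  using assms by (elim obtain_line_edge) auto

lemma links_line_graph:
  assumes "A \<subseteq> edges (line_graph G)"
  shows "(e, f) \<in> links (line_graph G) A \<longleftrightarrow> e \<noteq> f \<and> Adj (Upair e f) \<in> A"
proof
  assume "(e, f) \<in> links (line_graph G) A"
  then obtain a where a: "a \<in> A" "ends (line_graph G) a = {e, f}" by (auto simp: links_def)
  then obtain e' f' where e': "a = Adj (Upair e' f')" "e' \<noteq> f'"
    using assms obtain_line_edge by blast
  then have "{e', f'} = {e, f}" using a by simp
  then show "e \<noteq> f \<and> Adj (Upair e f) \<in> A"
    using e' a by (metis Adj_commute doubleton_eq_iff)
next
  assume "e \<noteq> f \<and> Adj (Upair e f) \<in> A"
  then show "(e, f) \<in> links (line_graph G) A"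
    by (auto simp: links_def intro!: bexI[of _ "Adj (Upair e f)"])
qed

lemma adj_line_graph:
  "(e, f) \<in> adj (line_graph G) \<longleftrightarrow>
     e \<in> edges G \<and> f \<in> edges G \<and> e \<noteq> f \<and> ends G e \<inter> ends G f \<noteq> {}"
  by (auto simp: links_line_graph edges_line_graph_iff)

text \<open>A walk of \<open>j\<close> steps between distinct vertices has at least one edge, and
  consecutive edges are adjacent in the line graph, which leaves \<open>j - 1\<close> steps from the
  first edge to the last. For \<open>x = y\<close> there might be no edge at all.\<close>

lemma near_line_graph:
  assumes "(x, y) \<in> near G j" "x \<noteq> y" "fin_graph G"
  shows "\<exists>g\<in>edges G. \<exists>h\<in>edges G. x \<in> ends G g \<and> y \<in> ends G h \<and> (g, h) \<in> near (line_graph G) (j - 1)"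
  using assms
proof (induction j arbitrary: y)
  case (Suc j)
  from Suc.prems(1) obtain z where z: "(x, z) \<in> near G j" "(z, y) \<in> (adj G)\<^sup>="
    by (auto simp: near_def)
  show ?case
  proof (cases "z = y")
    case True
    then show ?thesis
      using Suc.IH[of y] z Suc.prems near_mono[of "j - 1" j "line_graph G"] by fastforce
  next
    case False
    then obtain h where h: "h \<in> edges G" "ends G h = {z, y}" using z by (auto simp: links_def)
    show ?thesis
    proof (cases "x = z")
      case True
      then show ?thesis using h near_refl[of h "line_graph G"] by (intro bexI[of _ h] conjI) auto
    next
      case F: False
      then have "j \<noteq> 0" using z by (cases j) (auto simp: near_def)
      from Suc.IH[OF z(1) F] Suc.prems obtain g g' where
        g: "g \<in> edges G" "g' \<in> edges G" "x \<in> ends G g" "z \<in> ends G g'" "(g, g') \<in> near (line_graph G) (j - 1)"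
        by blast
      have "(g', h) \<in> (adj (line_graph G))\<^sup>=" using g h by (auto simp: adj_line_graph)
      then have "(g, h) \<in> near (line_graph G) (Suc (j - 1))" using g unfolding near_def by auto
      then show ?thesis using g h \<open>j \<noteq> 0\<close> by auto
    qed
  qed
qed (simp add: near_def)

text \<open>A walk of \<open>j\<close> steps in the line graph visits \<open>j + 1\<close> edges of
  \<open>G\<close>; crossing each of them at most once leads from \<open>x\<close> to
  \<open>y\<close>.\<close>

lemma near_ends_line_graph:
  assumes "(e, f) \<in> near (line_graph G) j" "x \<in> ends G e" "y \<in> ends G f" "fin_graph G"
    "e \<in> edges G"
  shows "(x, y) \<in> near G (Suc j)"
  using assms
proof (induction j arbitrary: f y)
  case 0
  then have "f = e" by (simp add: near_def)
  obtain u v where "ends G e = {u, v}" using obtain_ends 0 by metis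
  then have "(x, y) \<in> (adj G)\<^sup>=" using 0 \<open>f = e\<close> by (auto simp: links_def insert_commute)
  then show ?case by (simp add: near_def)
next
  case (Suc j)
  from Suc.prems(1) obtain g where g: "(e, g) \<in> near (line_graph G) j" "(g, f) \<in> (adj (line_graph G))\<^sup>="
    by (auto simp: near_def)
  show ?case
  proof (cases "g = f")
    case True
    then show ?thesis using Suc.IH[of f y] g Suc.prems near_mono[of "Suc j" "Suc (Suc j)" G] by auto
  next
    case False
    then obtain z where z: "z \<in> ends G g" "z \<in> ends G f" "f \<in> edges G" using g by (auto simp: adj_line_graph)
    have "(x, z) \<in> near G (Suc j)" using Suc.IH[OF g(1) Suc.prems(2) z(1)] Suc.prems by simp
    moreover obtain u v where "ends G f = {u, v}" using obtain_ends Suc.prems z by metis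
    then have "(z, y) \<in> (adj G)\<^sup>=" using z Suc.prems by (auto simp: links_def insert_commute)
    ultimately show ?thesis unfolding near_def by auto
  qed
qed

text \<open>If both ends had degree at most 2, \<open>e\<close> would have at most one neighbouring
  edge at each end, hence degree at most 2 in the line graph.\<close>

lemma hub_in_line_hub:
  assumes "fin_graph G" "e \<in> hubs (line_graph G)"
  shows "ends G e \<inter> hubs G \<noteq> {}"
proof
  assume no: "ends G e \<inter> hubs G = {}"
  have e: "e \<in> edges G" "3 \<le> degree (line_graph G) e" using assms by (auto simp: hubs_def)
  obtain u v where uv: "ends G e = {u, v}" "u \<noteq> v" using obtain_ends[OF assms(1) e(1)] .
  have deg: "card (incident G (edges G) w) \<le> 2" if "w \<in> ends G e" for w
    using that no ends_subset[OF assms(1) e(1)] by (force simp: hubs_def degree_incident)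
  let ?I = "\<lambda>w. incident G (edges G) w"
  have fin: "finite (?I w)" for w using assms(1) by (simp add: finite_incident finite_edges)
  have inj: "incident (line_graph G) (edges (line_graph G)) e \<subseteq> (\<lambda>f. Adj (Upair e f)) ` ((?I u - {e}) \<union> (?I v - {e}))"
  proof
    fix a assume "a \<in> incident (line_graph G) (edges (line_graph G)) e"
    then have a: "a \<in> edges (line_graph G)" "e \<in> ends (line_graph G) a" by (auto simp: incident_def)
    then obtain f where f: "f \<in> ends (line_graph G) a" "f \<noteq> e"
      by (elim obtain_line_edge) auto
    then have "a = Adj (Upair e f)" using line_edge_eqI a by metis
    moreover have "f \<in> (?I u - {e}) \<union> (?I v - {e})"
      using a(1) f(2) uv unfolding \<open>a = _\<close> edges_line_graph_iff by (auto simp: incident_def)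
    ultimately show "a \<in> (\<lambda>f. Adj (Upair e f)) ` ((?I u - {e}) \<union> (?I v - {e}))" by blast
  qed
  have "card (incident (line_graph G) (edges (line_graph G)) e) \<le> card ((?I u - {e}) \<union> (?I v - {e}))"
    using surj_card_le[OF _ inj] fin by simp
  also have "\<dots> \<le> card (?I u - {e}) + card (?I v - {e})" by (rule card_Un_le)
  also have "\<dots> \<le> 2"
  proof -
    have "card (?I w - {e}) \<le> 1" if "w \<in> {u, v}" for w
    proof -
      have "e \<in> ?I w" using e uv that by (auto simp: incident_def)
      then have "card (?I w - {e}) = card (?I w) - 1" using fin by simp
      then show ?thesis using deg[of w] that uv by auto
    qed
    from this[of u] this[of v] show "card (?I u - {e}) + card (?I v - {e}) \<le> 2" by simp
  qed
  finally show False using e by (simp add: degree_incident)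
qed

section \<open>Shortest paths between two sets\<close>

lemma rtrancl_obtain_list:
  assumes "(a, b) \<in> r\<^sup>*"
  shows "\<exists>ys. ys \<noteq> [] \<and> hd ys = a \<and> last ys = b \<and> successively (\<lambda>x y. (x, y) \<in> r) ys"
  using assms
proof (induction rule: rtrancl_induct)
  case base
  then show ?case by (intro exI[of _ "[a]"]) simp
next
  case (step y z)
  then obtain ys where "ys \<noteq> []" "hd ys = a" "last ys = y" "successively (\<lambda>x y. (x, y) \<in> r) ys"
    by blast
  then show ?case using step(2)
    by (intro exI[of _ "ys @ [z]"]) (auto simp: successively_append_iff)
qed

text \<open>A shortest walk from \<open>P\<close> to \<open>Q\<close> works: a repetition, a later
  visit to \<open>P\<close> or an earlier visit to \<open>Q\<close> would allow a shortcut.\<close>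

lemma rtrancl_obtain_path_between:
  assumes "(a, b) \<in> r\<^sup>*" "a \<in> P" "b \<in> Q"
  obtains ys where "ys \<noteq> []" "hd ys \<in> P" "last ys \<in> Q" "successively (\<lambda>x y. (x, y) \<in> r) ys"
    "distinct ys" "set (tl ys) \<inter> P = {}" "set (butlast ys) \<inter> Q = {}"
proof -
  let ?W = "\<lambda>ys. ys \<noteq> [] \<and> hd ys \<in> P \<and> last ys \<in> Q \<and> successively (\<lambda>x y. (x, y) \<in> r) ys"
  obtain us where "?W us" using rtrancl_obtain_list[OF assms(1)] assms(2,3) by blast
  from ex_has_least_nat[of ?W, OF this, of length]
  obtain ys where ys: "?W ys" and min: "\<And>zs. ?W zs \<Longrightarrow> length ys \<le> length zs"
    by blast
  have "distinct ys"
  proof (rule ccontr)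
    assume "\<not> distinct ys"
    then obtain us y vs ws where eq: "ys = us @ [y] @ vs @ [y] @ ws" using not_distinct_decomp by blast
    have "?W (us @ [y] @ ws)"
      using ys unfolding eq by (cases us) (auto simp: successively_append_iff successively_Cons hd_append split: if_splits)
    then show False using min[of "us @ [y] @ ws"] eq by simp
  qed
  moreover have "set (tl ys) \<inter> P = {}"
  proof (rule ccontr)
    assume "set (tl ys) \<inter> P \<noteq> {}"
    then obtain z where z: "z \<in> set (tl ys)" "z \<in> P" by blast
    then obtain us vs where tl: "tl ys = us @ z # vs" by (meson split_list)
    then have eq: "ys = hd ys # us @ z # vs" using ys by (metis list.collapse)
    have "?W (z # vs)"
      using ys z by (subst (asm) (1 2 3 4) eq) (auto simp: successively_append_iff successively_Cons split: if_splits)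
    moreover have "length ys = Suc (length us + Suc (length vs))" by (subst eq) simp
    ultimately show False using min[of "z # vs"] by simp
  qed
  moreover have "set (butlast ys) \<inter> Q = {}"
  proof (rule ccontr)
    assume "set (butlast ys) \<inter> Q \<noteq> {}"
    then obtain z where z: "z \<in> set (butlast ys)" "z \<in> Q" by blast
    then obtain us vs where bl: "butlast ys = us @ z # vs" by (meson split_list)
    then have eq: "ys = us @ [z] @ vs @ [last ys]" using ys by (metis append.assoc append_Cons append_Nil append_butlast_last_id)
    have "successively (\<lambda>x y. (x, y) \<in> r) (us @ [z])"
      using ys eq successively_append_iff by (metis (no_types, lifting) append.assoc)
    moreover have "hd (us @ [z]) = hd ys" by (subst eq) (cases us; simp)
    ultimately have "?W (us @ [z])" using ys z by simp
    moreover have "length ys = length us + Suc (Suc (length vs))" by (subst eq) simp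
    ultimately show False using min[of "us @ [z]"] by simp
  qed
  ultimately show thesis using that ys by blast
qed

lemma near_successively:
  "successively (\<lambda>x y. (x, y) \<in> adj G) ys \<Longrightarrow> ys \<noteq> [] \<Longrightarrow> (hd ys, last ys) \<in> near G (length ys - 1)"
proof (induction ys rule: rev_induct)
  case (snoc y ys)
  show ?case
  proof (cases "ys = []")
    case False
    then have "(hd ys, last ys) \<in> near G (length ys - 1)" "(last ys, y) \<in> adj G"
      using snoc by (auto simp: successively_append_iff)
    then have "(hd ys, y) \<in> near G (Suc (length ys - 1))" unfolding near_def by auto
    then show ?thesis using False by simp
  qed (simp add: near_refl)
qed simp

text \<open>The handshake lemma: a new edge changes the parity at its two distinct ends.\<close>

lemma even_card_odd_set:
  assumes "fin_graph G" "A \<subseteq> edges G"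
  shows "even (card (odd_set G A))"
  using finite_subset_edges[OF assms] assms(2)
proof (induction rule: finite_induct)
  case empty
  then show ?case by (simp add: odd_set_def incident_def)
next
  case (insert e A)
  have "card (ends G e) = 2" "finite (ends G e)"
    using assms(1) insert.prems by (auto simp: fin_graph_def card_2_iff)
  then show ?case
    using insert odd_card_sym_diff[of "odd_set G A" "ends G e"] finite_odd_set[OF assms(1), of A]
      odd_set_insert[OF assms(1), of A e] by auto
qed

section \<open>From the line graph down to the graph\<close>

context
  fixes G :: "(('v, 'e) cell, ('v, 'e) cell) multigraph" and A :: "('v, 'e) cell set"
    and c :: "('v, 'e) cell \<Rightarrow> ('v, 'e) cell"
  assumes fin: "fin_graph G" and AL: "A \<subseteq> edges (line_graph G)"
    and common: "\<forall>a\<in>A. \<forall>e\<in>ends (line_graph G) a. c a \<in> ends G e"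
begin

lemma common_end: "a \<in> A \<Longrightarrow> e \<in> ends (line_graph G) a \<Longrightarrow> c a \<in> ends G e"
  using common by blast

text \<open>Each line graph edge \<open>a\<close> in \<open>A\<close> is located at one common endpoint \<open>c a\<close> of the two edges it
  joins; \<open>at_vertex v\<close> collects the edges met an odd number of times at \<open>v\<close>.  An edge that has
  even degree in \<open>A\<close> is met with the same parity at both of its ends, so \<open>descent\<close> differs from
  \<open>at_vertex v\<close> around \<open>v\<close> only in edges of odd degree in \<open>A\<close>.\<close>

definition at_vertex :: "('v, 'e) cell \<Rightarrow> ('v, 'e) cell set" where
  "at_vertex v = odd_set (line_graph G) {a \<in> A. c a = v}"

definition descent :: "('v, 'e) cell set" where
  "descent = {e \<in> edges G. \<exists>v\<in>ends G e. e \<in> at_vertex v}"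

lemma fin_line: "fin_graph (line_graph G)"
  using fin by (rule fin_graph_line_graph)

lemma ends_A: "a \<in> A \<Longrightarrow> ends (line_graph G) a \<subseteq> edges G"
  using AL ends_subset[OF fin_line] by auto

lemma at_vertex_subset: "at_vertex v \<subseteq> incident G descent v"
proof
  fix e assume e: "e \<in> at_vertex v"
  then have "e \<in> cover (line_graph G) {a \<in> A. c a = v}"
    unfolding at_vertex_def by (rule subsetD[OF odd_set_subset_cover])
  then obtain a where "a \<in> A" "c a = v" "e \<in> ends (line_graph G) a" by (auto simp: cover_def)
  then show "e \<in> incident G descent v"
    using common_end ends_A e by (auto simp: incident_def descent_def)
qed

text \<open>Every member of \<open>A\<close> at \<open>e\<close> is located at exactly one of the
  two ends of \<open>e\<close>, so the degree of \<open>e\<close> in \<open>A\<close> is the sum of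
  the two local degrees.\<close>

lemma odd_set_line_iff:
  assumes "e \<in> edges G" "ends G e = {u, v}" "u \<noteq> v"
  shows "e \<in> odd_set (line_graph G) A \<longleftrightarrow> (e \<in> at_vertex u) \<noteq> (e \<in> at_vertex v)"
proof -
  let ?I = "\<lambda>v. incident (line_graph G) {a \<in> A. c a = v} e"
  have "incident (line_graph G) A e = ?I u \<union> ?I v"
    using assms(2) common_end by (auto simp: incident_def)
  moreover have "?I u \<inter> ?I v = {}" using assms(3) by (auto simp: incident_def)
  moreover have "finite (?I u)" "finite (?I v)"
    using finite_subset_edges[OF fin_line AL] by (auto simp: incident_def)
  ultimately have "card (incident (line_graph G) A e) = card (?I u) + card (?I v)"
    by (simp add: card_Un_disjoint)
  then show ?thesis by (simp add: odd_set_def at_vertex_def)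
qed

lemma even_at_vertex: "even (card (at_vertex v))"
  unfolding at_vertex_def using AL by (intro even_card_odd_set[OF fin_line]) auto

text \<open>As \<open>at_vertex v\<close> is even, an odd vertex \<open>v\<close> has an edge
  \<open>e\<close> of \<open>descent\<close> that is not met oddly at \<open>v\<close>. Then
  \<open>e\<close> is met oddly at its other end, so \<open>e\<close> is odd in \<open>A\<close>,
  and \<open>v\<close> is recovered from \<open>e\<close> as its only end without an odd
  meeting.\<close>

lemma card_odd_set_descent: "card (odd_set G descent) \<le> card (odd_set (line_graph G) A)"
proof -
  let ?m = "\<lambda>e. SOME v. v \<in> ends G e \<and> e \<notin> at_vertex v"
  have "odd_set G descent \<subseteq> ?m ` odd_set (line_graph G) A"
  proof
    fix v assume "v \<in> odd_set G descent"
    then have "odd (card (incident G descent v))" by (simp add: odd_set_def)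
    then have "incident G descent v \<noteq> at_vertex v" using even_at_vertex by metis
    then obtain e where e: "e \<in> descent" "v \<in> ends G e" "e \<notin> at_vertex v" "e \<in> edges G"
      using at_vertex_subset[of v] by (auto simp: incident_def descent_def)
    obtain u where u: "ends G e = {v, u}" "v \<noteq> u" using obtain_other_end[OF fin e(4,2)] .
    have "e \<in> at_vertex u" using e u by (auto simp: descent_def)
    then have eo: "e \<in> odd_set (line_graph G) A" using odd_set_line_iff[OF e(4) u] e by simp
    have me: "?m e = v"
      using u e \<open>e \<in> at_vertex u\<close> by (intro some_equality) auto
    show "v \<in> ?m ` odd_set (line_graph G) A" using imageI[OF eo, of ?m] unfolding me .
  qed
  then show ?thesis by (rule surj_card_le[OF finite_odd_set[OF fin_line AL]])
qed

lemma descent_subset_cover: "descent \<subseteq> cover (line_graph G) A"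
proof
  fix e assume "e \<in> descent"
  then obtain v where "e \<in> at_vertex v" by (auto simp: descent_def)
  then have "e \<in> cover (line_graph G) {a \<in> A. c a = v}"
    unfolding at_vertex_def by (rule subsetD[OF odd_set_subset_cover])
  then show "e \<in> cover (line_graph G) A" by (auto simp: cover_def)
qed

text \<open>At a vertex outside \<open>hubs G\<close> there are no edges beyond the two that
  \<open>a\<close> joins. As the line graph has no parallel edges, \<open>a\<close> is the only
  member of \<open>A\<close> located there, so each of the two edges is met exactly once and enters
  \<open>descent\<close>.\<close>

lemma choice_in_cover:
  assumes a: "a \<in> A"
  shows "c a \<in> cover G descent \<union> hubs G"
proof (rule ccontr)
  assume no: "c a \<notin> cover G descent \<union> hubs G"
  obtain e f where ef: "a = Adj (Upair e f)" "e \<in> edges G" "f \<in> edges G" "e \<noteq> f"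
    using a AL obtain_line_edge by blast
  have ca: "c a \<in> ends G e" "c a \<in> ends G f" using common_end[OF a] ef by auto
  then have "c a \<in> verts G" using ends_subset[OF fin ef(2)] by auto
  with no have "card (incident G (edges G) (c a)) \<le> 2" by (auto simp: hubs_def degree_incident)
  moreover have "{e, f} \<subseteq> incident G (edges G) (c a)" using ca ef by (auto simp: incident_def)
  moreover have "finite (incident G (edges G) (c a))" by (rule finite_incident[OF finite_edges[OF fin]])
  ultimately have inc: "incident G (edges G) (c a) = {e, f}"
    using card_seteq[of "incident G (edges G) (c a)" "{e, f}"] ef(4) by auto
  have "incident (line_graph G) {b \<in> A. c b = c a} e = {a}"
  proof
    show "{a} \<subseteq> incident (line_graph G) {b \<in> A. c b = c a} e" using a ef by (auto simp: incident_def)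
    show "incident (line_graph G) {b \<in> A. c b = c a} e \<subseteq> {a}"
    proof
      fix b assume "b \<in> incident (line_graph G) {b \<in> A. c b = c a} e"
      then have b: "b \<in> A" "c b = c a" "e \<in> ends (line_graph G) b" by (auto simp: incident_def)
      then obtain g where "ends (line_graph G) b = {e, g}" "e \<noteq> g"
        using AL obtain_other_end[OF fin_line, of b e] by blast
      then have g: "g \<in> ends (line_graph G) b" "g \<noteq> e" by auto
      have "c a \<in> ends G g" using common_end[OF b(1) g(1)] b(2) by simp
      moreover have "g \<in> edges G" using ends_A[OF b(1)] g(1) by blast
      ultimately have "g \<in> incident G (edges G) (c a)" by (simp add: incident_def)
      then have "g = f" using inc g by simp
      then show "b \<in> {a}" using line_edge_eqI[of b G e f, OF _ b(3)] g b(1) AL ef(1,4) by blast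
    qed
  qed
  then have "e \<in> at_vertex (c a)" by (simp add: at_vertex_def odd_set_def)
  then have "c a \<in> cover G descent" using ca ef by (auto simp: cover_def descent_def)
  with no show False by simp
qed

end

text \<open>\<open>R\<close> consists of edges of \<open>G\<close>, and each has an end in
  \<open>S = cover G B \<union> hubs G\<close>: either the location of a member of \<open>A\<close>,
  or a hub supplied by \<open>hub_in_line_hub\<close>. Walking through such ends carries the
  connectedness of \<open>R\<close> over to \<open>S\<close>. The result contains all hubs whether
  or not \<open>R\<close> did.\<close>

lemma skeleton_descent:
  fixes G :: "(('v, 'e) cell, ('v, 'e) cell) multigraph"
  assumes fin: "fin_graph G"
    and conn: "\<And>e f. e \<in> edges G \<Longrightarrow> f \<in> edges G \<Longrightarrow> (e, f) \<in> (adj (line_graph G))\<^sup>*"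
    and sk: "skeleton k (line_graph G) A R" and k: "1 \<le> k"
  shows "\<exists>B. skeleton (Suc k) G B (cover G B \<union> hubs G)"
proof -
  have AL: "A \<subseteq> edges (line_graph G)" and odd2: "card (odd_set (line_graph G) A) \<le> 2"
    and cov: "cover (line_graph G) A \<subseteq> R" and R: "R \<subseteq> cover (line_graph G) A \<union> hubs (line_graph G)"
    and ne: "R \<noteq> {}" and RR: "R \<times> R \<subseteq> (hops (k - 1) (line_graph G) A R)\<^sup>*"
    and dom: "\<And>xs. chain (line_graph G) xs \<Longrightarrow> length xs = Suc k \<Longrightarrow> set xs \<inter> R \<noteq> {}"
    using sk by (auto simp: skeleton_def)
  have finL: "fin_graph (line_graph G)" using fin by (rule fin_graph_line_graph)
  have RE: "R \<subseteq> edges G" using skeleton_verts[OF finL sk] by simp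
  define c where "c a = (SOME v. \<forall>e\<in>ends (line_graph G) a. v \<in> ends G e)" for a
  have c: "c a \<in> ends G e" if aA: "a \<in> A" and "e \<in> ends (line_graph G) a" for a e
  proof -
    have "\<exists>v. \<forall>e\<in>ends (line_graph G) a. v \<in> ends G e"
    proof -
      obtain e f where "a = Adj (Upair e f)" "ends G e \<inter> ends G f \<noteq> {}"
        using obtain_line_edge[OF subsetD[OF AL aA]] by metis
      then show ?thesis by auto
    qed
    from someI_ex[OF this] show ?thesis using that(2) unfolding c_def by blast
  qed
  then have common: "\<forall>a\<in>A. \<forall>e\<in>ends (line_graph G) a. c a \<in> ends G e" by blast
  define B where "B = descent G A c"
  define S where "S = cover G B \<union> hubs G"
  have BE: "B \<subseteq> edges G" by (auto simp: B_def descent_def[OF fin AL common])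
  have oddB: "card (odd_set G B) \<le> 2"
    using card_odd_set_descent[OF fin AL common] odd2 unfolding B_def by linarith
  have B_R: "B \<subseteq> R" using descent_subset_cover[OF fin AL common] cov unfolding B_def by blast
  have c_S: "c a \<in> S" if "a \<in> A" for a
    using choice_in_cover[OF fin AL common that] unfolding S_def B_def by simp
  have meets: "\<exists>x\<in>ends G e. x \<in> S" if "e \<in> R" for e
  proof (cases "e \<in> cover (line_graph G) A")
    case True
    then obtain a where "a \<in> A" "e \<in> ends (line_graph G) a" by (auto simp: cover_def)
    then show ?thesis using c c_S by blast
  next
    case False
    then have "e \<in> hubs (line_graph G)" using R that by blast
    then show ?thesis using hub_in_line_hub[OF fin] by (auto simp: S_def)
  qed
  let ?H = "(near G k \<inter> S \<times> S)\<^sup>*"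
  have near1: "(x, y) \<in> ?H" if "x \<in> S" "y \<in> S" "x \<in> ends G e" "y \<in> ends G e" and eE: "e \<in> edges G" for x y e
  proof -
    obtain u v where "ends G e = {u, v}" using obtain_ends[OF fin eE] by metis
    then have "x = y \<or> (x, y) \<in> adj G" using that by (auto simp: links_def)
    then have "(x, y) \<in> near G k" using near_adj[of k G] near_refl k by auto
    then show ?thesis using that by auto
  qed
  \<comment> \<open>A jump over distance \<open>k - 1\<close> grows by one. For a link of
    \<open>A\<close>, both \<open>e\<close> and \<open>f\<close> contain its location
    \<open>c a\<close>, from which \<open>x\<close> and \<open>y\<close> are at distance at most 1
    each.\<close>
  have hop: "(x, y) \<in> ?H"
    if "(e, f) \<in> hops (k - 1) (line_graph G) A R" "x \<in> ends G e" "y \<in> ends G f" "x \<in> S" "y \<in> S" for e f x y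
  proof (cases "(e, f) \<in> near (line_graph G) (k - 1)")
    case True
    then have "(x, y) \<in> near G (Suc (k - 1))"
      using near_ends_line_graph[OF True that(2,3) fin] that(1) RE by (auto simp: hops_def)
    then show ?thesis using k that by auto
  next
    case False
    then have ef: "(e, f) \<in> links (line_graph G) A" "e \<in> edges G" "f \<in> edges G" using that RE by (auto simp: hops_def)
    then obtain a where a: "a \<in> A" "ends (line_graph G) a = {e, f}" by (auto simp: links_def)
    have "(x, c a) \<in> ?H" using near1[OF that(4) c_S[OF a(1)] that(2) c[OF a(1)]] a ef by simp
    moreover have "(c a, y) \<in> ?H" using near1[OF c_S[OF a(1)] that(5) c[OF a(1)] that(3)] a ef by simp
    ultimately show ?thesis by (rule rtrancl_trans)
  qed
  have hops: "(x, y) \<in> ?H"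
    if "(e, f) \<in> (hops (k - 1) (line_graph G) A R)\<^sup>*" "e \<in> R" "x \<in> ends G e" "x \<in> S" "y \<in> ends G f" "y \<in> S"
    for e f x y
    using that
  proof (induction arbitrary: y rule: rtrancl_induct)
    case base
    then show ?case using near1 RE by blast
  next
    case (step g h)
    then have "g \<in> R" by (auto simp: hops_def)
    then obtain z where z: "z \<in> ends G g" "z \<in> S" using meets by blast
    then have "(x, z) \<in> ?H" using step by blast
    moreover have "(z, y) \<in> ?H" using hop[OF step(2) z(1) _ z(2)] step by blast
    ultimately show ?case by (rule rtrancl_trans)
  qed
  \<comment> \<open>A hub touched by no edge of \<open>R\<close> is close to \<open>R\<close>: otherwise two of its edges, followed by a path
    towards \<open>R\<close>, form a long path of the line graph that avoids \<open>R\<close>.\<close>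
  have to_R: "\<exists>e\<in>R. \<exists>z\<in>ends G e. z \<in> S \<and> (x, z) \<in> ?H" if xS: "x \<in> S" for x
  proof (cases "\<exists>e\<in>R. x \<in> ends G e")
    case True
    then show ?thesis using xS by blast
  next
    case False
    then have "x \<notin> cover G B" using B_R by (auto simp: cover_def)
    then have hub: "x \<in> hubs G" using xS by (simp add: S_def)
    let ?I = "incident G (edges G) x"
    have "card ?I \<ge> 3" using hub by (simp add: hubs_def degree_incident)
    then obtain e0 where e0: "e0 \<in> ?I" by fastforce
    obtain r0 where r0: "r0 \<in> R" using ne by blast
    have "(e0, r0) \<in> (adj (line_graph G))\<^sup>*" using conn e0 r0 RE by (auto simp: incident_def)
    then obtain ys where ys: "ys \<noteq> []" "hd ys \<in> ?I" "last ys \<in> R"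
      "successively (\<lambda>x y. (x, y) \<in> adj (line_graph G)) ys"
      "distinct ys" "set (tl ys) \<inter> ?I = {}" "set (butlast ys) \<inter> R = {}"
      using rtrancl_obtain_path_between[OF _ e0 r0] by blast
    have "length ys \<le> k"
    proof (rule ccontr)
      assume long: "\<not> length ys \<le> k"
      have "?I - {hd ys} \<noteq> {}"
      proof
        assume "?I - {hd ys} = {}"
        then have "card ?I \<le> card {hd ys}" by (intro card_mono) auto
        then show False using \<open>card ?I \<ge> 3\<close> by simp
      qed
      then obtain f where f: "f \<in> ?I" "f \<noteq> hd ys" by blast
      \<comment> \<open>The dropped last entry lies in \<open>R\<close>, the new first entry
        \<open>f\<close> does not; the list keeps its length and avoids \<open>R\<close>.\<close>
      let ?zs = "f # butlast ys"
      have "f \<notin> set ys" using f ys by (cases ys) auto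
      have bl: "butlast ys \<noteq> []"
      proof
        assume "butlast ys = []"
        then have "hd ys = last ys" using ys(1) by (metis append_Nil append_butlast_last_id list.sel(1))
        then show False using False ys by (auto simp: incident_def)
      qed
      then have hd_bl: "hd (butlast ys) = hd ys" using ys(1) by (metis append_butlast_last_id hd_append2)
      have "successively (\<lambda>x y. (x, y) \<in> adj (line_graph G)) (butlast ys)"
        using ys(4) ys(1) by (metis append_butlast_last_id successively_append_iff)
      moreover have "(f, hd (butlast ys)) \<in> adj (line_graph G)"
        using f ys(2) unfolding hd_bl by (auto simp: adj_line_graph incident_def)
      ultimately have "successively (\<lambda>x y. (x, y) \<in> adj (line_graph G)) ?zs"
        using bl by (auto simp: successively_Cons)
      then have "successively (\<lambda>x y. (x, y) \<in> adj (line_graph G)) (take (Suc k) ?zs)"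
        by (metis append_take_drop_id successively_append_iff)
      moreover have "distinct ?zs" using ys(5) \<open>f \<notin> set ys\<close> by (auto simp: distinct_butlast dest: in_set_butlastD)
      ultimately have "chain (line_graph G) (take (Suc k) ?zs)" unfolding chain_def by (metis distinct_take)
      moreover have "length (take (Suc k) ?zs) = Suc k" using long by simp
      ultimately have "set (take (Suc k) ?zs) \<inter> R \<noteq> {}" using dom by blast
      moreover have "f \<notin> R" using False f by (auto simp: incident_def)
      ultimately show False using ys(7) set_take_subset[of "Suc k" ?zs] by auto
    qed
    then have "(hd ys, last ys) \<in> near (line_graph G) (k - 1)"
      using near_successively[OF ys(4,1)] near_mono[OF diff_le_mono, of _ _ "line_graph G" 1] by blast
    moreover obtain z where z: "z \<in> ends G (last ys)" "z \<in> S" using meets ys(3) by blast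
    ultimately have "(x, z) \<in> near G (Suc (k - 1))"
      using near_ends_line_graph[of "hd ys" "last ys" G "k - 1" x z] ys(2) fin by (auto simp: incident_def)
    then have "(x, z) \<in> ?H" using xS z k by auto
    then show ?thesis using z ys(3) by blast
  qed
  have symH: "sym ?H"
    by (intro sym_rtrancl sym_Int sym_near) (auto simp: sym_def)
  have conn_S: "(x, y) \<in> ?H" if xy: "x \<in> S" "y \<in> S" for x y
  proof -
    obtain e z where e: "e \<in> R" "z \<in> ends G e" "z \<in> S" "(x, z) \<in> ?H" using to_R[OF xy(1)] by blast
    obtain f w where f: "f \<in> R" "w \<in> ends G f" "w \<in> S" "(y, w) \<in> ?H" using to_R[OF xy(2)] by blast
    have "(e, f) \<in> (hops (k - 1) (line_graph G) A R)\<^sup>*" using RR e f by blast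
    then have "(z, w) \<in> ?H" using hops e f by blast
    moreover have "(w, y) \<in> ?H" using f(4) symH by (meson symD)
    ultimately show ?thesis using e(4) by (meson rtrancl_trans)
  qed
  have "skeleton (Suc k) G B S"
    unfolding skeleton_def
  proof (intro conjI allI impI)
    show "S \<noteq> {}" using ne meets by blast
    show "S \<times> S \<subseteq> (hops (Suc k - 1) G B S)\<^sup>*"
      using conn_S hops_near[of k B G S] k BE by auto
    \<comment> \<open>The \<open>k + 1\<close> edges of this path are distinct and form a path of
      the line graph. One of them is in \<open>R\<close>, and it has an end in \<open>S\<close>,
      which lies on the path.\<close>
    fix xs assume xs: "chain G xs \<and> length xs = Suc (Suc k)"
    then have adj: "(xs ! i, xs ! Suc i) \<in> adj G" if "i < Suc k" for i
      using that unfolding chain_def by (auto intro: successively_nth)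
    define g where "g i = (SOME e. e \<in> edges G \<and> ends G e = {xs ! i, xs ! Suc i})" for i
    have g: "g i \<in> edges G" "ends G (g i) = {xs ! i, xs ! Suc i}" if "i < Suc k" for i
    proof -
      have "\<exists>e. e \<in> edges G \<and> ends G e = {xs ! i, xs ! Suc i}" using adj[OF that] by (auto simp: links_def)
      from someI_ex[OF this] show "g i \<in> edges G" "ends G (g i) = {xs ! i, xs ! Suc i}" unfolding g_def by auto
    qed
    have nth_eq: "xs ! i = xs ! j \<longleftrightarrow> i = j" if "i < Suc (Suc k)" "j < Suc (Suc k)" for i j
      using xs that unfolding chain_def by (simp add: nth_eq_iff_index_eq)
    have inj: "i = j" if "g i = g j" "i < Suc k" "j < Suc k" for i j
    proof -
      have "{xs ! i, xs ! Suc i} = {xs ! j, xs ! Suc j}" using g that by metis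
      then show ?thesis using nth_eq that by (auto simp: doubleton_eq_iff)
    qed
    let ?es = "map g [0..<Suc k]"
    have "distinct ?es" using inj by (auto simp: distinct_map inj_on_def simp del: upt_Suc)
    moreover have "successively (\<lambda>x y. (x, y) \<in> adj (line_graph G)) ?es"
      unfolding successively_conv_nth
    proof (intro allI impI)
      fix i assume i: "Suc i < length ?es"
      then have "g i \<noteq> g (Suc i)" using inj[of i "Suc i"] by auto
      then show "(?es ! i, ?es ! Suc i) \<in> adj (line_graph G)"
        using g[of i] g[of "Suc i"] i by (auto simp: adj_line_graph simp del: upt_Suc)
    qed
    ultimately have "set ?es \<inter> R \<noteq> {}" using dom[of ?es] by (auto simp: chain_def simp del: upt_Suc)
    then obtain i where i: "i < Suc k" "g i \<in> R" by (auto simp del: upt_Suc)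
    then obtain x where "x \<in> ends G (g i)" "x \<in> S" using meets by blast
    moreover have "ends G (g i) \<subseteq> set xs" using g(2)[OF i(1)] xs i by simp
    ultimately show "set xs \<inter> S \<noteq> {}" by blast
  qed (use BE oddB in \<open>auto simp: S_def\<close>)
  then show ?thesis unfolding S_def by blast
qed

section \<open>From the graph up to the line graph\<close>

text \<open>Any two edges at \<open>v\<close> are adjacent, so the elements of the even set
  \<open>T\<close> can be paired off: \<open>J\<close> is a perfect matching of
  \<open>T\<close>.\<close>

lemma clique_join:
  assumes fin: "fin_graph G" and "T \<subseteq> incident G (edges G) v" "even (card T)"
  shows "\<exists>J\<subseteq>edges (line_graph G). odd_set (line_graph G) J = T \<and> cover (line_graph G) J \<subseteq> T"
  using assms(2,3)
proof (induction "card T" arbitrary: T rule: less_induct)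
  case less
  have finT: "finite T" using less.prems(1) finite_incident[OF finite_edges[OF fin]] finite_subset by metis
  show ?case
  proof (cases "T = {}")
    case True
    then show ?thesis by (intro exI[of _ "{}"]) (auto simp: odd_set_def cover_def incident_def)
  next
    case False
    then obtain e where e: "e \<in> T" by blast
    have "T \<noteq> {e}" using less.prems(2) by auto
    then obtain f where f: "f \<in> T" "f \<noteq> e" using e by blast
    define T' where "T' = T - {e, f}"
    have "card T' = card T - 2" unfolding T'_def using e f finT by (simp add: card_Diff_subset)
    moreover have "card T \<ge> 2" using e f finT card_le_Suc0_iff_eq[OF finT] by fastforce
    ultimately have "card T' < card T" "even (card T')" using less.prems(2) by auto
    then obtain J where J: "J \<subseteq> edges (line_graph G)" "odd_set (line_graph G) J = T'" "cover (line_graph G) J \<subseteq> T'"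
      using less.hyps[of T'] less.prems(1) unfolding T'_def by blast
    let ?a = "Adj (Upair e f)"
    have a: "?a \<in> edges (line_graph G)"
      using e f less.prems(1) by (auto simp: edges_line_graph_iff incident_def)
    have "?a \<notin> J"
    proof
      assume "?a \<in> J"
      then have "ends (line_graph G) ?a \<subseteq> cover (line_graph G) J" unfolding cover_def by blast
      then show False using J(3) by (auto simp: T'_def)
    qed
    then have "odd_set (line_graph G) (insert ?a J) = sym_diff T' {e, f}"
      using odd_set_insert[OF fin_graph_line_graph[OF fin] J(1) a] J(2) by simp
    also have "\<dots> = T" using e f by (auto simp: T'_def)
    finally have "odd_set (line_graph G) (insert ?a J) = T" .
    moreover have "cover (line_graph G) (insert ?a J) \<subseteq> T"
      using J(3) e f by (auto simp: cover_def T'_def)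
    ultimately show ?thesis using a J(1) by (intro exI[of _ "insert ?a J"]) auto
  qed
qed

lemma odd_card_family_insert:
  assumes "finite U" "w \<notin> U"
  shows "{a. odd (card {v \<in> insert w U. P a v})} = sym_diff {a. odd (card {v \<in> U. P a v})} {a. P a w}"
proof -
  have "card {v \<in> insert w U. P a v} = (if P a w then Suc (card {v \<in> U. P a v}) else card {v \<in> U. P a v})" for a
  proof (cases "P a w")
    case True
    then have "{v \<in> insert w U. P a v} = insert w {v \<in> U. P a v}" by auto
    then show ?thesis using True assms by simp
  next
    case False
    then have "{v \<in> insert w U. P a v} = {v \<in> U. P a v}" by auto
    then show ?thesis using False by simp
  qed
  then show ?thesis by auto
qed

text \<open>The elements lying in an odd number of the sets \<open>J v\<close> form their sum over
  the field with two elements; this is additivity of \<open>odd_set\<close> for finitely many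
  summands.\<close>

lemma odd_set_family:
  assumes fin: "fin_graph G" and "finite U" and "\<And>v. J v \<subseteq> edges G"
  shows "odd_set G {a. odd (card {v \<in> U. a \<in> J v})} = {e. odd (card {v \<in> U. e \<in> odd_set G (J v)})}"
  using assms(2)
proof (induction rule: finite_induct)
  case empty
  then show ?case by (simp add: odd_set_def incident_def)
next
  case (insert w U)
  have "{a. odd (card {v \<in> U. a \<in> J v})} \<subseteq> edges G"
  proof
    fix a assume "a \<in> {a. odd (card {v \<in> U. a \<in> J v})}"
    then have "{v \<in> U. a \<in> J v} \<noteq> {}" by (metis (mono_tags, lifting) card.empty even_zero mem_Collect_eq)
    then show "a \<in> edges G" using assms(3) by blast
  qed
  then have fins: "finite {a. odd (card {v \<in> U. a \<in> J v})}" "finite (J w)"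
    using finite_subset_edges[OF fin] assms(3) by auto
  show ?case
    using odd_set_sym_diff[OF fins, of G] insert.IH
      odd_card_family_insert[OF insert.hyps, of "\<lambda>a v. a \<in> J v"]
      odd_card_family_insert[OF insert.hyps, of "\<lambda>e v. e \<in> odd_set G (J v)"]
    by (simp only: Collect_mem_eq)
qed

text \<open>Toggling a triangle preserves parities.  If \<open>e\<close> and \<open>f\<close> are not connected in \<open>A\<close>, then at most one
  edge of the triangle lies in \<open>A\<close> and the other two replace it, so no connection is lost.\<close>

lemma toggle_triangle:
  assumes fin: "fin_graph G" and A: "A \<subseteq> edges G" and abc: "a \<in> edges G" "b \<in> edges G" "c \<in> edges G"
    and ends: "ends G a = {e, f}" "ends G b = {f, g}" "ends G c = {e, g}" and neq: "e \<noteq> f" "f \<noteq> g" "e \<noteq> g"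
  shows "\<exists>B\<subseteq>A \<union> {a, b, c}. odd_set G B = odd_set G A \<and> (links G A)\<^sup>* \<subseteq> (links G B)\<^sup>* \<and> (e, f) \<in> (links G B)\<^sup>*"
proof (cases "(e, f) \<in> (links G A)\<^sup>*")
  case True
  then show ?thesis by blast
next
  case False
  have dist: "a \<noteq> b" "a \<noteq> c" "b \<noteq> c" using ends neq by (auto simp: doubleton_eq_iff)
  let ?B = "sym_diff A {a, b, c}"
  have "odd_set G {c} = {e, g}" using odd_set_edge[OF fin abc(3)] ends by simp
  then have "odd_set G {b, c} = sym_diff {e, g} {f, g}"
    using odd_set_insert[OF fin _ abc(2), of "{c}"] abc dist ends by simp
  then have "odd_set G {a, b, c} = sym_diff (sym_diff {e, g} {f, g}) {e, f}"
    using odd_set_insert[OF fin _ abc(1), of "{b, c}"] abc dist ends by simp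
  also have "\<dots> = {}" using neq by auto
  finally have odd: "odd_set G ?B = odd_set G A"
    using odd_set_sym_diff[OF finite_subset_edges[OF fin A], of "{a, b, c}" G] by simp
  have in_links: "(x, y) \<in> links G C" if "h \<in> C" "ends G h = {x, y}" for C h x y
    using that by (auto simp: links_def)
  have sym: "sym ((links G ?B)\<^sup>*)" by (intro sym_rtrancl sym_links)
  have bridge: "\<not> (b \<in> A \<and> c \<in> A)" "a \<notin> A"
  proof -
    show "a \<notin> A" using False in_links[OF _ ends(1), of A] by auto
    show "\<not> (b \<in> A \<and> c \<in> A)"
    proof
      assume "b \<in> A \<and> c \<in> A"
      then have "(e, g) \<in> links G A" "(g, f) \<in> links G A"
        using in_links[OF _ ends(3)] in_links[of b A g f] ends(2) by (auto simp: insert_commute)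
      then have "(e, f) \<in> (links G A)\<^sup>*" by (rule rtrancl_into_rtrancl[OF r_into_rtrancl])
      then show False using False by contradiction
    qed
  qed
  have ef: "(e, f) \<in> links G ?B" by (rule in_links[OF _ ends(1)]) (use bridge(2) in simp)
  have eg: "(e, g) \<in> (links G ?B)\<^sup>*" if "b \<notin> A \<or> c \<notin> A"
  proof (cases "c \<in> A")
    case True
    then have "(f, g) \<in> links G ?B" by (intro in_links[OF _ ends(2)]) (use that in simp)
    with ef show ?thesis by (rule rtrancl_into_rtrancl[OF r_into_rtrancl])
  next
    case False
    then have "(e, g) \<in> links G ?B" by (intro in_links[OF _ ends(3)]) simp
    then show ?thesis by (rule r_into_rtrancl)
  qed
  then have eg: "(e, g) \<in> (links G ?B)\<^sup>*" using bridge by blast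
  then have fg: "(f, g) \<in> (links G ?B)\<^sup>*"
    by (rule converse_rtrancl_into_rtrancl[OF symD[OF sym_links ef]])
  have "links G A \<subseteq> (links G ?B)\<^sup>*"
  proof (rule subrelI)
    fix x y assume "(x, y) \<in> links G A"
    then obtain h where h: "h \<in> A" "ends G h = {x, y}" by (auto simp: links_def)
    show "(x, y) \<in> (links G ?B)\<^sup>*"
    proof (cases "h \<in> {b, c}")
      case True
      then have "h = b \<or> h = c" by simp
      then have "{x, y} = ends G b \<or> {x, y} = ends G c" using h(2) by metis
      then have "{x, y} = {f, g} \<or> {x, y} = {e, g}" unfolding ends .
      then have "(x, y) \<in> {(f, g), (g, f), (e, g), (g, e)}"
        unfolding doubleton_eq_iff by blast
      then show ?thesis using eg fg symD[OF sym eg] symD[OF sym fg] by blast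
    next
      case False
      then have "h \<in> ?B" using h bridge by auto
      then have "(x, y) \<in> links G ?B" using h(2) by (rule in_links)
      then show ?thesis by (rule r_into_rtrancl)
    qed
  qed
  then have "(links G A)\<^sup>* \<subseteq> (links G ?B)\<^sup>*" by (rule rtrancl_subset_rtrancl)
  then show ?thesis using odd ef by (intro exI[of _ ?B]) auto
qed

text \<open>A later toggle loses no connection, so the pairs of \<open>Q\<close> can be served one
  after another even when their triangles share edges. \<open>D\<close> bounds what may be brought
  in.\<close>

lemma toggle_triangles:
  assumes fin: "fin_graph G" and "finite Q" and A: "A \<subseteq> edges G" and D: "D \<subseteq> edges G"
    and tri: "\<And>e f. (e, f) \<in> Q \<Longrightarrow> \<exists>a\<in>D. \<exists>b\<in>D. \<exists>c\<in>D. \<exists>g. e \<noteq> f \<and> f \<noteq> g \<and> e \<noteq> g \<and>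
      ends G a = {e, f} \<and> ends G b = {f, g} \<and> ends G c = {e, g}"
  shows "\<exists>B\<subseteq>A \<union> D. odd_set G B = odd_set G A \<and> (links G A)\<^sup>* \<subseteq> (links G B)\<^sup>* \<and> Q \<subseteq> (links G B)\<^sup>*"
  using assms(2) tri
proof (induction rule: finite_induct)
  case empty
  then show ?case by blast
next
  case (insert q Q)
  obtain e f where q: "q = (e, f)" by fastforce
  obtain B where B: "B \<subseteq> A \<union> D" "odd_set G B = odd_set G A" "(links G A)\<^sup>* \<subseteq> (links G B)\<^sup>*" "Q \<subseteq> (links G B)\<^sup>*"
    using insert by auto
  obtain a b c g where abc: "a \<in> D" "b \<in> D" "c \<in> D" "e \<noteq> f" "f \<noteq> g" "e \<noteq> g"
      "ends G a = {e, f}" "ends G b = {f, g}" "ends G c = {e, g}"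
    using insert.prems[of e f] q by auto
  have "B \<subseteq> edges G" using B(1) A D by blast
  then obtain C where "C \<subseteq> B \<union> {a, b, c}" "odd_set G C = odd_set G B" "(links G B)\<^sup>* \<subseteq> (links G C)\<^sup>*" "(e, f) \<in> (links G C)\<^sup>*"
    using toggle_triangle[OF fin _ _ _ _ abc(7-9) abc(4-6), of B] abc(1-3) D by blast
  then show ?case using B abc(1-3) q by (intro exI[of _ C]) auto
qed

text \<open>Mostly used backwards: at a vertex outside \<open>hubs G\<close>, two known edges
  exclude a third.\<close>

lemma hubI3:
  assumes "fin_graph G" "e \<in> edges G" "f \<in> edges G" "g \<in> edges G" "e \<noteq> f" "f \<noteq> g" "e \<noteq> g"
    "w \<in> ends G e" "w \<in> ends G f" "w \<in> ends G g"
  shows "w \<in> hubs G"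
proof -
  have "{e, f, g} \<subseteq> incident G (edges G) w" using assms by (auto simp: incident_def)
  then have "card {e, f, g} \<le> degree G w"
    unfolding degree_incident using finite_incident[OF finite_edges[OF assms(1)]] by (intro card_mono)
  then show ?thesis using assms ends_subset[OF assms(1,2)] by (auto simp: hubs_def)
qed

text \<open>Without hubs, a path of the line graph comes from a path of the graph, unless it closes up to a
  cycle; such a cycle has no further edges at its vertices.\<close>

lemma line_path_avoiding_hubs:
  assumes fin: "fin_graph G" and k: "1 \<le> k" and es: "chain (line_graph G) es" "length es = Suc k"
    and nohub: "\<And>e. e \<in> set es \<Longrightarrow> ends G e \<inter> hubs G = {}"
  shows "(\<exists>xs. chain G xs \<and> length xs = Suc (Suc k) \<and> set xs \<subseteq> cover G (set es)) \<or>
    (\<forall>x\<in>cover G (set es). incident G (edges G) x \<subseteq> set es)"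
proof -
  have adjL: "(es ! i, es ! Suc i) \<in> adj (line_graph G)" if "i < k" for i
    using es that by (auto simp: chain_def intro: successively_nth)
  have esE: "es ! i \<in> edges G" if "i \<le> k" for i
    using adjL[of i] adjL[of "i - 1"] that k by (cases "i < k") (auto simp: adj_line_graph)
  have nth_eq: "es ! i = es ! j \<longleftrightarrow> i = j" if "i \<le> k" "j \<le> k" for i j
    using es that unfolding chain_def by (simp add: nth_eq_iff_index_eq)
  have no3: False if "w \<in> ends G (es ! i)" "w \<in> ends G g" "w \<in> ends G (es ! j)" "g \<noteq> es ! i" "g \<noteq> es ! j" "i \<noteq> j"
    "i \<le> k" "j \<le> k" "g \<in> edges G" for w i j g
  proof -
    have "w \<in> hubs G" using hubI3[OF fin esE esE that(9), of i j w] that nth_eq by auto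
    moreover have "es ! i \<in> set es" using that es by simp
    ultimately show False using nohub that by blast
  qed
  define c where "c i = (SOME x. x \<in> ends G (es ! i) \<and> x \<in> ends G (es ! Suc i))" for i
  have c: "c i \<in> ends G (es ! i)" "c i \<in> ends G (es ! Suc i)" if "i < k" for i
  proof -
    have "\<exists>x. x \<in> ends G (es ! i) \<and> x \<in> ends G (es ! Suc i)" using adjL[OF that] by (auto simp: adj_line_graph)
    from someI_ex[OF this] show "c i \<in> ends G (es ! i)" "c i \<in> ends G (es ! Suc i)" unfolding c_def by auto
  qed
  \<comment> \<open>Equal common ends would put the three edges at positions \<open>i\<close>,
    \<open>Suc i\<close> and \<open>Suc j\<close> through one vertex.\<close>
  have c_neq: "c i \<noteq> c j" if "i < j" "j < k" for i j
  proof
    assume eq: "c i = c j"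
    show False
      using no3[of "c i" i "es ! Suc i" "Suc j"] c[of i] c[of j] that eq nth_eq[of i "Suc i"] nth_eq[of "Suc i" "Suc j"] esE by auto
  qed
  have c_only: "\<not> c j \<in> ends G (es ! i)" if "j < k" "i \<le> k" "i \<noteq> j" "i \<noteq> Suc j" for i j
    using no3[of "c j" j "es ! i" "Suc j"] c[of j] that nth_eq esE by auto
  obtain x where x: "ends G (es ! 0) = {c 0, x}" "c 0 \<noteq> x"
    using obtain_other_end[OF fin esE c(1)[of 0]] k by auto
  obtain y where y: "ends G (es ! k) = {c (k - 1), y}" "c (k - 1) \<noteq> y"
    using obtain_other_end[OF fin esE, of k "c (k - 1)"] c(2)[of "k - 1"] k by auto
  have x_c: "x \<noteq> c j" if "j < k" for j
    using c_only[of j 0] x that by (cases "j = 0") auto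
  have y_c: "y \<noteq> c j" if "j < k" for j
    using c_only[of j k] y that k by (cases "Suc j = k") auto
  have mid: "ends G (es ! Suc i) = {c i, c (Suc i)}" if ik: "Suc i < k" for i
  proof -
    obtain u where "ends G (es ! Suc i) = {c i, u}" "c i \<noteq> u"
      using obtain_other_end[OF fin esE, of "Suc i" "c i"] c(2)[of i] ik by auto
    then show ?thesis using c(1)[of "Suc i"] c_neq[of i "Suc i"] that by auto
  qed
  show ?thesis
  proof (cases "x = y")
    case False
    define xs where "xs = x # map c [0..<k] @ [y]"
    have "inj_on c {..<k}" using c_neq by (intro linorder_inj_onI) auto
    then have "distinct xs"
      using x_c y_c False unfolding xs_def by (force simp: distinct_map lessThan_atLeast0)
    moreover have "successively (\<lambda>x y. (x, y) \<in> adj G) (map c [0..<k])"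
      unfolding successively_conv_nth using mid esE by (auto simp: links_def intro!: bexI)
    moreover have "(x, c 0) \<in> adj G" using x esE by (auto simp: links_def insert_commute)
    moreover have "(c (k - 1), y) \<in> adj G" using y esE by (auto simp: links_def)
    moreover have "hd (map c [0..<k]) = c 0" "last (map c [0..<k]) = c (k - 1)"
      using k by (simp_all add: hd_map last_map)
    ultimately have "chain G xs"
      using k unfolding chain_def xs_def by (auto simp: successively_Cons successively_append_iff)
    moreover have "length xs = Suc (Suc k)" by (simp add: xs_def)
    moreover have "set xs \<subseteq> cover G (set es)"
    proof
      fix z assume "z \<in> set xs"
      then have "\<exists>i\<le>k. z \<in> ends G (es ! i)" using x y c k unfolding xs_def by fastforce
      then show "z \<in> cover G (set es)" using es(2) by (auto simp: cover_def intro!: bexI)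
    qed
    ultimately show ?thesis by blast
  next
    case True
    have "incident G (edges G) z \<subseteq> set es" if z: "z \<in> cover G (set es)" for z
    proof -
      obtain i where i: "i \<le> k" "z \<in> ends G (es ! i)"
        using z es(2) by (auto simp: cover_def in_set_conv_nth less_Suc_eq_le)
      \<comment> \<open>For \<open>x = y\<close> the edges close up to a cycle, for
        \<open>k = 1\<close> a pair of parallel edges. Each of its vertices lies on two of them,
        which excludes a third edge.\<close>
      have "\<exists>i j. i \<le> k \<and> j \<le> k \<and> i \<noteq> j \<and> z \<in> ends G (es ! i) \<and> z \<in> ends G (es ! j)"
      proof (cases "\<exists>j<k. z = c j")
        case True
        then obtain j where "j < k" "z = c j" by blast
        then show ?thesis using c[of j] by (intro exI[of _ j] exI[of _ "Suc j"]) auto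
      next
        case no: False
        have "z = x"
        proof (cases i)
          case 0
          then show ?thesis using i x no k by auto
        next
          case (Suc j)
          show ?thesis
          proof (cases "i = k")
            case True
            then have "z = c (k - 1) \<or> z = y" using i y by auto
            then show ?thesis using no k \<open>x = y\<close> by auto
          next
            case False
            then show ?thesis using mid[of j] Suc i no by auto
          qed
        qed
        then show ?thesis using x y k \<open>x = y\<close> by (intro exI[of _ 0] exI[of _ k]) auto
      qed
      then obtain i j where ij: "i \<le> k" "j \<le> k" "i \<noteq> j" "z \<in> ends G (es ! i)" "z \<in> ends G (es ! j)" by blast
      show ?thesis
      proof
        fix g assume g: "g \<in> incident G (edges G) z"
        then have "g = es ! i \<or> g = es ! j" using no3[of z i g j] ij by (auto simp: incident_def)
        then show "g \<in> set es" using ij es(2) by auto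
      qed
    qed
    then show ?thesis by blast
  qed
qed

lemma rtrancl_closed:
  assumes "(x, y) \<in> r\<^sup>*" "x \<in> U" "\<And>u v. u \<in> U \<Longrightarrow> (u, v) \<in> r \<Longrightarrow> v \<in> U"
  shows "y \<in> U"
  using assms(1,2) by (induction rule: rtrancl_induct) (use assms(3) in auto)

text \<open>\<open>R\<close> is the set of all edges with an end in \<open>S\<close>. The hypothesis
  \<open>two\<close> excludes a lone edge, which would have no neighbour in the line graph. Two
  cliques share a line graph edge only if it joins parallel edges, and then \<open>par\<close> makes
  one of the two vertices a hub; this matters because shared contributions can cancel in
  \<open>A0\<close>.\<close>

lemma skeleton_ascent:
  fixes G :: "(('v, 'e) cell, ('v, 'e) cell) multigraph"
  assumes fin: "fin_graph G"
    and conn: "\<And>x y. x \<in> verts G \<Longrightarrow> y \<in> verts G \<Longrightarrow> (x, y) \<in> (adj G)\<^sup>*"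
    and two: "2 \<le> card (edges G)"
    and par: "\<And>e f. e \<in> edges G \<Longrightarrow> f \<in> edges G \<Longrightarrow> e \<noteq> f \<Longrightarrow> ends G e = ends G f \<Longrightarrow> ends G e \<inter> hubs G \<noteq> {}"
    and sk: "skeleton (Suc k) G B S" and hubS: "hubs G \<subseteq> S" and k: "1 \<le> k"
  shows "\<exists>A R. skeleton k (line_graph G) A R \<and> hubs (line_graph G) \<subseteq> R"
proof -
  let ?L = "line_graph G"
  have BE: "B \<subseteq> edges G" and odd2: "card (odd_set G B) \<le> 2"
    and cov: "cover G B \<subseteq> S" and S: "S \<subseteq> cover G B \<union> hubs G"
    and ne: "S \<noteq> {}" and SS: "S \<times> S \<subseteq> (near G k \<inter> S \<times> S)\<^sup>*"
    and dom: "\<And>xs. chain G xs \<Longrightarrow> length xs = Suc (Suc k) \<Longrightarrow> set xs \<inter> S \<noteq> {}"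
    using sk hops_near[of k B G S] k by (auto simp: skeleton_def)
  have finL: "fin_graph ?L" using fin by (rule fin_graph_line_graph)
  have SV: "S \<subseteq> verts G" using skeleton_verts[OF fin sk] .
  define I where "I v = incident G (edges G) v" for v
  define t where "t v = incident G B v" for v
  have finI: "finite (I v)" for v unfolding I_def by (rule finite_incident[OF finite_edges[OF fin]])
  have tI: "t v \<subseteq> I v" for v using BE by (auto simp: t_def I_def incident_def)
  then have fint: "finite (t v)" for v using finI finite_subset by blast
  \<comment> \<open>\<open>T v\<close> is the even set of edges that are to have odd degree in the clique at \<open>v\<close>: it is the set
    of edges of \<open>B\<close> at \<open>v\<close>, corrected by the single edge \<open>m v\<close> when that set is odd.  At a vertex of
    degree 2 the correction adds an edge, which keeps both edges there linked.\<close>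
  define m where "m v = (if card (I v) = 2 then SOME e. e \<in> I v - t v else SOME e. e \<in> t v)" for v
  define T where "T v = (if v \<in> odd_set G B then sym_diff (t v) {m v} else t v)" for v
  have odd_t: "v \<in> odd_set G B \<longleftrightarrow> odd (card (t v))" for v by (simp add: odd_set_def t_def)
  have t_cover: "t v \<noteq> {} \<longleftrightarrow> v \<in> cover G B" for v by (auto simp: t_def incident_def cover_def)
  have card1: "card (t v) = 1 \<and> m v \<in> I v - t v" if "v \<in> odd_set G B" "card (I v) = 2" for v
  proof -
    have c1: "card (t v) = 1"
      using that odd_t card_mono[OF finI tI, of v] by (cases "card (t v)" rule: nat.exhaust) (auto simp: le_Suc_eq numeral_2_eq_2)
    then have "I v - t v \<noteq> {}" using that(2) tI by (metis Diff_eq_empty_iff numeral_One numeral_eq_iff semiring_norm(85) subset_antisym)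
    then have "(SOME e. e \<in> I v - t v) \<in> I v - t v" using some_in_eq[of "I v - t v"] by blast
    then have "m v \<in> I v - t v" unfolding m_def if_P[OF that(2)] .
    with c1 show ?thesis by simp
  qed
  have m_I: "m v \<in> I v" if odd: "v \<in> odd_set G B" for v
  proof (cases "card (I v) = 2")
    case False
    have "t v \<noteq> {}" using odd odd_t by fastforce
    then have "m v \<in> t v" using False by (simp add: m_def some_in_eq)
    then show ?thesis using tI by blast
  qed (use card1 odd in blast)
  have TI: "T v \<subseteq> I v" for v using tI m_I unfolding T_def by auto
  have evenT: "even (card (T v))" for v
    unfolding T_def using odd_t odd_card_sym_diff[OF fint, of "{m v}" v] by auto
  have T_cover: "v \<in> cover G B" if "T v \<noteq> {}" for v
    using that odd_set_subset_cover[of G B] t_cover unfolding T_def by (auto split: if_splits)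
  \<comment> \<open>A covered vertex of degree 2 has one or two edges in \<open>B\<close>: a single
    one is odd and is completed by \<open>m v\<close>, two are already all of them.\<close>
  have T2: "T v = I v" if "v \<in> cover G B" "card (I v) = 2" for v
  proof (cases "v \<in> odd_set G B")
    case True
    then have T: "T v = insert (m v) (t v)" "m v \<notin> t v" "card (t v) = 1" using card1[OF True that(2)] by (auto simp: T_def)
    then have "card (T v) = card (I v)" using fint that by simp
    then show ?thesis using card_subset_eq[OF finI TI] by blast
  next
    case False
    then have "even (card (t v))" "card (t v) \<noteq> 0" "T v = t v" using odd_t that t_cover fint by (auto simp: T_def)
    moreover have "card (t v) \<le> 2" using card_mono[OF finI tI, of v] that by simp
    ultimately have "card (T v) = card (I v)" unfolding that(2) by presburger
    then show ?thesis using card_subset_eq[OF finI TI] by blast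
  qed
  have "\<forall>v. \<exists>J. J \<subseteq> edges ?L \<and> odd_set ?L J = T v \<and> cover ?L J \<subseteq> T v"
    using clique_join[OF fin TI[unfolded I_def] evenT] by (intro allI) (simp only: conj_assoc Bex_def)
  from choice[OF this] obtain J where "\<forall>v. J v \<subseteq> edges ?L \<and> odd_set ?L (J v) = T v \<and> cover ?L (J v) \<subseteq> T v"
    by (rule exE)
  then have J: "\<And>v. J v \<subseteq> edges ?L" "\<And>v. odd_set ?L (J v) = T v" "\<And>v. cover ?L (J v) \<subseteq> T v"
    by simp_all
  have finV: "finite (verts G)" using fin by (simp add: fin_graph_def)
  \<comment> \<open>The sum over the field with two elements of all local matchings. A plain union
    would miscount a line graph edge that occurs at both ends of two parallel edges.\<close>
  define A0 where "A0 = {a. odd (card {v \<in> verts G. a \<in> J v})}"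
  have A0_J: "\<exists>v\<in>verts G. a \<in> J v" if "a \<in> A0" for a
  proof -
    have "{v \<in> verts G. a \<in> J v} \<noteq> {}" using that unfolding A0_def by (metis (mono_tags, lifting) card.empty even_zero mem_Collect_eq)
    then show ?thesis by blast
  qed
  then have A0E: "A0 \<subseteq> edges ?L" using J(1) by blast
  have "odd_set ?L A0 = {e. odd (card {v \<in> verts G. e \<in> T v})}"
    unfolding A0_def using odd_set_family[OF finL finV J(1)] J(2) by simp
  \<comment> \<open>Without corrections an edge of \<open>B\<close> is wanted at both of its ends
    and any other edge at neither. So only the corrections create odd elements, at most one for each
    odd vertex of \<open>B\<close>.\<close>
  also have "\<dots> \<subseteq> m ` odd_set G B"
  proof
    fix e assume "e \<in> {e. odd (card {v \<in> verts G. e \<in> T v})}"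
    then have odd: "odd (card {v \<in> verts G. e \<in> T v})" by simp
    then have "{v \<in> verts G. e \<in> T v} \<noteq> {}" by (metis card.empty even_zero)
    then have eE: "e \<in> edges G" using TI by (auto simp: I_def incident_def)
    obtain u w where uw: "ends G e = {u, w}" "u \<noteq> w" using obtain_ends[OF fin eE] .
    show "e \<in> m ` odd_set G B"
    proof (rule ccontr)
      assume no: "e \<notin> m ` odd_set G B"
      have "e \<in> T v \<longleftrightarrow> e \<in> B \<and> v \<in> {u, w}" for v
        using no uw unfolding T_def t_def incident_def by auto
      then have "{v \<in> verts G. e \<in> T v} = (if e \<in> B then {u, w} else {})"
        using ends_subset[OF fin eE] uw by auto
      then show False using odd uw by (auto split: if_splits)
    qed
  qed
  finally have "card (odd_set ?L A0) \<le> card (odd_set G B)"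
    by (rule surj_card_le[OF finite_odd_set[OF fin BE]])
  then have odd0: "card (odd_set ?L A0) \<le> 2" using odd2 by simp
  define Q where "Q = {(e, f). \<exists>v\<in>hubs G. e \<in> I v \<and> f \<in> I v \<and> e \<noteq> f}"
  define D where "D = {Adj (Upair e f) | e f. (e, f) \<in> Q}"
  have Q_D: "Adj (Upair e f) \<in> D" if "(e, f) \<in> Q" for e f using that by (auto simp: D_def)
  have DE: "D \<subseteq> edges ?L" by (auto simp: D_def Q_def I_def incident_def edges_line_graph_iff)
  have "Q \<subseteq> edges G \<times> edges G" by (auto simp: Q_def I_def incident_def)
  then have finQ: "finite Q" using finite_edges[OF fin] finite_subset by blast
  have tri: "\<exists>a\<in>D. \<exists>b\<in>D. \<exists>c\<in>D. \<exists>g. e \<noteq> f \<and> f \<noteq> g \<and> e \<noteq> g \<and>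
      ends ?L a = {e, f} \<and> ends ?L b = {f, g} \<and> ends ?L c = {e, g}" if ef: "(e, f) \<in> Q" for e f
  proof -
    obtain v where v: "v \<in> hubs G" "e \<in> I v" "f \<in> I v" "e \<noteq> f" using ef by (auto simp: Q_def)
    have "\<not> I v \<subseteq> {e, f}"
    proof
      assume "I v \<subseteq> {e, f}"
      then have "card (I v) \<le> card {e, f}" by (intro card_mono) auto
      then show False using v by (simp add: hubs_def degree_incident I_def)
    qed
    then obtain g where g: "g \<in> I v" "g \<noteq> e" "g \<noteq> f" by blast
    then have "(f, g) \<in> Q" "(e, g) \<in> Q" using v by (auto simp: Q_def)
    then show ?thesis using Q_D that v g
      by (intro bexI[of _ "Adj (Upair e f)"] bexI[of _ "Adj (Upair f g)"] bexI[of _ "Adj (Upair e g)"] exI[of _ g]) auto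
  qed
  obtain A where A: "A \<subseteq> A0 \<union> D" "odd_set ?L A = odd_set ?L A0" "(links ?L A0)\<^sup>* \<subseteq> (links ?L A)\<^sup>*" "Q \<subseteq> (links ?L A)\<^sup>*"
    using toggle_triangles[OF finL finQ A0E DE tri] by blast
  define R where "R = {e \<in> edges G. ends G e \<inter> S \<noteq> {}}"
  have AE: "A \<subseteq> edges ?L" using A(1) A0E DE by blast
  \<comment> \<open>At a hub this is the outcome of the toggling. Any other vertex of
    \<open>S\<close> with two distinct edges has degree 2, and its clique is one line graph edge.
    That edge lies in \<open>J v\<close> and in no other matching, so it is in \<open>A0\<close>,
    and toggling keeps its ends connected.\<close>
  have clique: "(e, f) \<in> (links ?L A)\<^sup>*" if "v \<in> S" "e \<in> I v" "f \<in> I v" for v e f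
  proof (cases "e = f \<or> (e, f) \<in> Q")
    case True
    then show ?thesis using A(4) by auto
  next
    case False
    then have neq: "e \<noteq> f" by blast
    have vh: "v \<notin> hubs G" using False that by (auto simp: Q_def)
    then have "v \<in> cover G B" using S that by blast
    moreover have "card (I v) = 2"
    proof -
      have "card {e, f} \<le> card (I v)" using that finI by (intro card_mono) auto
      moreover have "card (I v) < 3" using vh that SV by (auto simp: hubs_def degree_incident I_def)
      ultimately show ?thesis using neq by simp
    qed
    ultimately have TIv: "T v = I v" using T2 by blast
    then have "e \<in> cover ?L (J v)" using odd_set_subset_cover[of ?L "J v"] J(2) that by blast
    then obtain a where a: "a \<in> J v" "e \<in> ends ?L a" by (auto simp: cover_def)
    then obtain f' where f': "ends ?L a = {e, f'}" "e \<noteq> f'"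
      using obtain_other_end[OF finL _ a(2)] J(1) by blast
    then have "f' \<in> I v" using a J(3)[of v] TIv by (auto simp: cover_def)
    moreover have "I v = {e, f}" using that neq finI[of v] \<open>card (I v) = 2\<close>
      by (intro card_subset_eq[symmetric]) auto
    ultimately have ends_a: "ends ?L a = {e, f}" using f' by auto
    have inter: "v' = v" if "v' \<in> ends G e" "v' \<in> ends G f" for v'
    proof (rule ccontr)
      assume "v' \<noteq> v"
      have ef: "e \<in> edges G" "f \<in> edges G" "v \<in> ends G e" "v \<in> ends G f"
        using \<open>I v = {e, f}\<close> by (auto simp: I_def incident_def)
      then have "ends G e = {v, v'}" "ends G f = {v, v'}"
        using that \<open>v' \<noteq> v\<close> obtain_other_end[OF fin ef(1,3)] obtain_other_end[OF fin ef(2,4)] by auto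
      then have "v' \<in> hubs G" using par[OF ef(1,2) neq] vh by auto
      then show False using False that ef neq by (auto simp: Q_def I_def incident_def)
    qed
    have "{w \<in> verts G. a \<in> J w} = {v}"
    proof -
      have "w = v" if "a \<in> J w" for w
      proof -
        have "ends ?L a \<subseteq> I w" using that J(3)[of w] TI[of w] by (auto simp: cover_def)
        then show ?thesis using inter[of w] ends_a by (auto simp: I_def incident_def)
      qed
      then have "{w \<in> verts G. a \<in> J w} \<subseteq> {v}" by blast
      moreover have "v \<in> verts G" using \<open>v \<in> S\<close> SV by blast
      then have "v \<in> {w \<in> verts G. a \<in> J w}" using a(1) by simp
      ultimately show ?thesis by blast
    qed
    then have "a \<in> A0" by (simp add: A0_def)
    then have "(e, f) \<in> links ?L A0" using ends_a by (auto simp: links_def)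
    then show ?thesis using A(3) by blast
  qed
  \<comment> \<open>Suppose all ends of \<open>e\<close> in \<open>S\<close> have degree 1. Such an
    end is no hub, so it is covered by \<open>B\<close>, whence \<open>e\<close> is in
    \<open>B\<close> and both ends are in \<open>S\<close>. Then \<open>e\<close> is a component by
    itself, although there is a second edge.\<close>
  have big: "\<exists>v\<in>S. e \<in> I v \<and> 2 \<le> card (I v)" if e: "e \<in> R" for e
  proof (rule ccontr)
    assume no: "\<not> ?thesis"
    obtain v where v: "v \<in> S" "v \<in> ends G e" "e \<in> edges G" using e by (auto simp: R_def)
    have only: "I u = {e}" if "u \<in> S" "u \<in> ends G e" for u
    proof -
      have "e \<in> I u" using that v by (auto simp: I_def incident_def)
      moreover have "card (I u) \<le> 1" using no that \<open>e \<in> I u\<close> by force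
      ultimately show ?thesis using finI[of u] by (auto simp: card_le_Suc0_iff_eq)
    qed
    have "v \<notin> hubs G" using only[OF v(1,2)] by (auto simp: hubs_def degree_incident I_def)
    then have "v \<in> cover G B" using S v by blast
    then have "e \<in> B" using t_cover tI[of v] only[OF v(1,2)] by (fastforce simp: t_def incident_def)
    then have endsS: "ends G e \<subseteq> S" using cov by (auto simp: cover_def)
    have "\<not> edges G \<subseteq> {e}"
    proof
      assume "edges G \<subseteq> {e}"
      then have "card (edges G) \<le> card {e}" by (intro card_mono) auto
      then show False using two by simp
    qed
    then obtain g where g: "g \<in> edges G" "g \<noteq> e" by blast
    obtain z where z: "z \<in> ends G g" using obtain_ends[OF fin g(1)] by blast
    have "(v, z) \<in> (adj G)\<^sup>*" using conn v SV z ends_subset[OF fin g(1)] by blast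
    then have "z \<in> ends G e"
    proof (rule rtrancl_closed[OF _ v(2)])
      fix p q assume p: "p \<in> ends G e" "(p, q) \<in> adj G"
      then obtain h where h: "h \<in> edges G" "ends G h = {p, q}" by (auto simp: links_def)
      then have "h \<in> I p" by (auto simp: I_def incident_def)
      then have "h = e" using only p endsS by blast
      then show "q \<in> ends G e" using h by auto
    qed
    then have "I z = {e}" using only endsS by blast
    then show False using g z by (auto simp: I_def incident_def)
  qed
  have R_cover: "R \<subseteq> cover ?L A"
  proof
    fix e assume "e \<in> R"
    then obtain v where v: "v \<in> S" "e \<in> I v" "2 \<le> card (I v)" using big by blast
    have "\<not> I v \<subseteq> {e}"
    proof
      assume "I v \<subseteq> {e}"
      then have "card (I v) \<le> card {e}" by (intro card_mono) auto
      then show False using v by simp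
    qed
    then obtain f where f: "f \<in> I v" "f \<noteq> e" by blast
    have "(e, f) \<in> (links ?L A)\<^sup>*" using clique v f by blast
    then obtain g where "(e, g) \<in> links ?L A" using f(2) by (metis converse_rtranclE)
    then show "e \<in> cover ?L A" using links_cover by blast
  qed
  have cover_R: "cover ?L A \<subseteq> R"
  proof
    fix e assume "e \<in> cover ?L A"
    then obtain a where a: "a \<in> A" "e \<in> ends ?L a" by (auto simp: cover_def)
    show "e \<in> R"
    proof (cases "a \<in> A0")
      case True
      then obtain v where v: "a \<in> J v" using A0_J by blast
      then have "e \<in> T v" using a J(3)[of v] by (auto simp: cover_def)
      then have "e \<in> I v" "v \<in> S" using TI T_cover cov by blast+
      then show ?thesis by (auto simp: R_def I_def incident_def)
    next
      case False
      then have "a \<in> D" using a(1) A(1) by blast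
      then obtain e' f' v where v: "a = Adj (Upair e' f')" "v \<in> hubs G" "e' \<in> I v" "f' \<in> I v"
        by (auto simp: D_def Q_def)
      then have "e \<in> I v" "v \<in> S" using a(2) hubS by auto
      then show ?thesis by (auto simp: R_def I_def incident_def)
    qed
  qed
  have R_I: "v \<in> S \<Longrightarrow> e \<in> I v \<Longrightarrow> e \<in> R" for v e by (auto simp: R_def I_def incident_def)
  let ?H = "(hops (k - 1) ?L A R)\<^sup>*"
  have "links ?L A \<subseteq> hops (k - 1) ?L A R"
    using links_cover[of ?L A] cover_R unfolding hops_def by blast
  then have A_H: "(links ?L A)\<^sup>* \<subseteq> ?H" by (rule rtrancl_mono)
  \<comment> \<open>By \<open>clique\<close>, any edge at a vertex of \<open>S\<close> can be
    exchanged for any other, so it suffices to jump between the two edges supplied by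
    \<open>near_line_graph\<close>.\<close>
  have step: "(e, f) \<in> ?H" if xy: "(x, y) \<in> near G k \<inter> S \<times> S" and "e \<in> I x" "f \<in> I y" for x y e f
  proof (cases "x = y")
    case True
    then show ?thesis using clique A_H that by blast
  next
    case False
    then obtain g h where gh: "g \<in> I x" "h \<in> I y" "(g, h) \<in> near ?L (k - 1)"
      using near_line_graph[OF _ False fin, of k] xy by (auto simp: I_def incident_def)
    then have "(g, h) \<in> ?H" using R_I that(1) by (auto simp: hops_def)
    moreover have "(e, g) \<in> ?H" "(h, f) \<in> ?H" using clique A_H that gh by blast+
    ultimately show ?thesis by (meson rtrancl_trans)
  qed
  have steps: "(e, f) \<in> ?H" if "(x, y) \<in> (near G k \<inter> S \<times> S)\<^sup>*" "e \<in> I x" "f \<in> I y" "x \<in> S" for x y e f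
    using that
  proof (induction arbitrary: f rule: rtrancl_induct)
    case base
    then show ?case using clique A_H by blast
  next
    case (step y z)
    have "y \<in> S" using step(2) by blast
    have "\<exists>g. g \<in> I y"
    proof (rule ccontr)
      assume empty: "\<nexists>g. g \<in> I y"
      then have "y \<notin> cover G B" "y \<notin> hubs G" using tI[of y] t_cover[of y] by (auto simp: hubs_def degree_incident I_def)
      then show False using \<open>y \<in> S\<close> S by blast
    qed
    then obtain g where g: "g \<in> I y" by blast
    then have "(e, g) \<in> ?H" using step by blast
    moreover have "(g, f) \<in> ?H" using \<open>\<And>x y e f. (x, y) \<in> near G k \<inter> S \<times> S \<Longrightarrow> e \<in> I x \<Longrightarrow> f \<in> I y \<Longrightarrow> (e, f) \<in> ?H\<close> g step by blast
    ultimately show ?case by (rule rtrancl_trans)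
  qed
  have conn_R: "(e, f) \<in> ?H" if ef: "e \<in> R" "f \<in> R" for e f
  proof -
    obtain x y where "x \<in> S" "e \<in> I x" "y \<in> S" "f \<in> I y" using ef by (auto simp: R_def I_def incident_def)
    then show ?thesis using steps SS by blast
  qed
  have domL: "set es \<inter> R \<noteq> {}" if es: "chain ?L es" "length es = Suc k" for es
  proof
    assume no: "set es \<inter> R = {}"
    have esE: "set es \<subseteq> edges G"
    proof
      fix e assume "e \<in> set es"
      then obtain i where i: "i < length es" "es ! i = e" by (auto simp: in_set_conv_nth)
      have "(es ! i, es ! Suc i) \<in> adj ?L" if "Suc i < length es" for i
        using es that by (auto simp: chain_def intro: successively_nth)
      from this[of i] this[of "i - 1"] show "e \<in> edges G" using i es(2) k
        by (cases "Suc i < length es") (auto simp: adj_line_graph)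
    qed
    then have avoid: "cover G (set es) \<inter> S = {}" using no by (auto simp: R_def cover_def)
    have nohub: "ends G e \<inter> hubs G = {}" if "e \<in> set es" for e
      using avoid hubS that by (auto simp: cover_def)
    from line_path_avoiding_hubs[OF fin k es nohub] show False
    proof
      assume "\<exists>xs. chain G xs \<and> length xs = Suc (Suc k) \<and> set xs \<subseteq> cover G (set es)"
      then show False using dom avoid by blast
    next
      \<comment> \<open>The edges of the list would exhaust a component; by connectedness it would
        contain \<open>S\<close>, which it avoids.\<close>
      assume closed: "\<forall>x\<in>cover G (set es). incident G (edges G) x \<subseteq> set es"
      have "es ! 0 \<in> set es" using es by simp
      then obtain x where x: "x \<in> cover G (set es)" "x \<in> verts G"
        using esE obtain_ends[OF fin] ends_subset[OF fin] unfolding cover_def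
        by (metis UN_I insertI1 subsetD)
      obtain s where s: "s \<in> S" using ne by blast
      have "(x, s) \<in> (adj G)\<^sup>*" using conn x s SV by blast
      then have "s \<in> cover G (set es)"
      proof (rule rtrancl_closed[OF _ x(1)])
        fix p q assume p: "p \<in> cover G (set es)" "(p, q) \<in> adj G"
        then obtain h where h: "h \<in> edges G" "ends G h = {p, q}" by (auto simp: links_def)
        then have "h \<in> set es" using closed p by (auto simp: incident_def)
        then show "q \<in> cover G (set es)" using h by (auto simp: cover_def)
      qed
      then show False using avoid s by blast
    qed
  qed
  have "R \<noteq> {}"
  proof -
    obtain x where x: "x \<in> S" using ne by blast
    then have "I x \<noteq> {}" using S tI[of x] t_cover[of x] by (auto simp: hubs_def degree_incident I_def)
    then show ?thesis using R_I x by blast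
  qed
  moreover have "hubs ?L \<subseteq> R"
  proof
    fix e assume e: "e \<in> hubs ?L"
    then show "e \<in> R" using hub_in_line_hub[OF fin e] hubS by (auto simp: R_def hubs_def)
  qed
  ultimately have "skeleton k ?L A R"
    unfolding skeleton_def using AE A(2) odd0 cover_R R_cover conn_R domL by auto
  then show ?thesis using \<open>hubs ?L \<subseteq> R\<close> by blast
qed

section \<open>Walks\<close>

lemma walk_singleton: "walk G [x] [] \<longleftrightarrow> x \<in> verts G"
  by (simp add: walk_def)

lemma walk_Cons:
  "walk G (x # vs) (e # es) \<longleftrightarrow>
     x \<in> verts G \<and> e \<in> edges G \<and> vs \<noteq> [] \<and> ends G e = {x, hd vs} \<and> walk G vs es"
proof -
  have "(\<forall>i<Suc (length es). ends G ((e # es) ! i) = {(x # vs) ! i, (x # vs) ! Suc i}) \<longleftrightarrow>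
      ends G e = {x, vs ! 0} \<and> (\<forall>i<length es. ends G (es ! i) = {vs ! i, vs ! Suc i})"
    by (subst All_less_Suc2) simp
  then show ?thesis by (cases vs) (auto simp: walk_def)
qed

lemma walk_snoc:
  assumes "walk G vs es" "e \<in> edges G" "y \<in> verts G" "ends G e = {last vs, y}"
  shows "walk G (vs @ [y]) (es @ [e])"
proof -
  have "vs \<noteq> []" "length vs = Suc (length es)" using assms(1) by (auto simp: walk_def)
  then show ?thesis using assms by (auto simp: walk_def nth_append last_conv_nth less_Suc_eq)
qed

lemma walk_length: "walk G vs es \<Longrightarrow> length vs = Suc (length es)"
  by (simp add: walk_def)

lemma walk_successively: "walk G vs es \<Longrightarrow> successively (\<lambda>x y. (x, y) \<in> adj G) vs"
  unfolding successively_conv_nth walk_def links_def by (auto intro!: bexI)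

lemma walk_adj_rtrancl: "walk G vs es \<Longrightarrow> (hd vs, last vs) \<in> (adj G)\<^sup>*"
proof (induction es arbitrary: vs)
  case Nil
  then show ?case by (cases vs) (auto simp: walk_def)
next
  case (Cons e es)
  then obtain x us where vs: "vs = x # us" by (cases vs) (auto simp: walk_def)
  then have w: "us \<noteq> []" "ends G e = {x, hd us}" "e \<in> edges G" "walk G us es"
    using Cons.prems by (auto simp: walk_Cons)
  then have "(x, hd us) \<in> adj G" by (auto simp: links_def)
  then show ?case using Cons.IH[OF w(4)] w(1) vs by auto
qed

lemma obtain_walk:
  assumes "(u, v) \<in> (adj G)\<^sup>*" "u \<in> verts G" "fin_graph G"
  obtains vs es where "walk G vs es" "hd vs = u" "last vs = v"
proof -
  have "\<exists>vs es. walk G vs es \<and> hd vs = u \<and> last vs = v"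
    using assms(1)
  proof (induction rule: rtrancl_induct)
    case base
    then show ?case using assms(2) by (intro exI[of _ "[u]"] exI[of _ "[]"]) (simp add: walk_singleton)
  next
    case (step y z)
    then obtain vs es where w: "walk G vs es" "hd vs = u" "last vs = y" by blast
    obtain e where e: "e \<in> edges G" "ends G e = {y, z}" using step(2) by (auto simp: links_def)
    then have "z \<in> verts G" using ends_subset[OF assms(3)] by blast
    then have "walk G (vs @ [z]) (es @ [e])" using walk_snoc[OF w(1) e(1)] e w by simp
    moreover have "hd (vs @ [z]) = u" using w walk_length[OF w(1)] by (cases vs) auto
    ultimately show ?case by (intro exI[of _ "vs @ [z]"] exI[of _ "es @ [e]"]) simp
  qed
  then show thesis using that by blast
qed

lemma connected_graph_iff:
  assumes "fin_graph G"
  shows "connected_graph G \<longleftrightarrow> verts G \<noteq> {} \<and> (\<forall>u\<in>verts G. \<forall>v\<in>verts G. (u, v) \<in> (adj G)\<^sup>*)"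
  unfolding connected_graph_def using obtain_walk[OF _ _ assms] walk_adj_rtrancl by metis

lemma path_distinct_edges: "path G vs es \<Longrightarrow> distinct es"
proof (induction es arbitrary: vs)
  case (Cons e es)
  then obtain x us where vs: "vs = x # us" by (cases vs) (auto simp: path_def walk_def)
  then have w: "ends G e = {x, hd us}" "walk G us es" "x \<notin> set us" "distinct us"
    using Cons.prems by (auto simp: path_def walk_Cons)
  have "e \<notin> set es"
  proof
    assume "e \<in> set es"
    then obtain i where i: "i < length es" "es ! i = e" by (auto simp: in_set_conv_nth)
    then have "ends G e \<subseteq> set us" using w(2) by (auto simp: walk_def)
    then show False using w by auto
  qed
  then show ?case using Cons.IH[of us] w by (simp add: path_def)
qed simp

text \<open>Prepending an edge moves the odd end from \<open>hd us\<close> to the new first vertex.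
  Distinctness of the edges ensures that every step toggles a new one.\<close>

lemma odd_set_walk:
  assumes fin: "fin_graph G"
  shows "walk G vs es \<Longrightarrow> distinct es \<Longrightarrow>
    odd_set G (set es) = (if hd vs = last vs then {} else {hd vs, last vs})"
proof (induction es arbitrary: vs)
  case Nil
  then show ?case by (cases vs) (auto simp: walk_def odd_set_def incident_def)
next
  case (Cons e es)
  then obtain x us where vs: "vs = x # us" by (cases vs) (auto simp: walk_def)
  then have w: "us \<noteq> []" "ends G e = {x, hd us}" "e \<in> edges G" "walk G us es"
    using Cons.prems by (auto simp: walk_Cons)
  have neq: "x \<noteq> hd us" using obtain_ends[OF fin w(3)] w(2) by fastforce
  have "odd_set G (set (e # es)) = sym_diff (odd_set G (set es)) {x, hd us}"
    using odd_set_insert[OF fin _ w(3), of "set es"] Cons.prems w by (auto simp: walk_def)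
  also have "odd_set G (set es) = (if hd us = last us then {} else {hd us, last us})"
    using Cons.IH[OF w(4)] Cons.prems(2) by simp
  also have "sym_diff \<dots> {x, hd us} = (if x = last us then {} else {x, last us})"
    using neq by auto
  finally show ?case using w(1) vs by simp
qed

text \<open>Two consecutive edges of the path meet at such a vertex, and a third would make it a
  hub. So a path can be left from its inside only at hubs.\<close>

lemma path_interior:
  assumes fin: "fin_graph G" and p: "path G vs es" and i: "0 < i" "i < length es" and "vs ! i \<notin> hubs G"
  shows "degree G (vs ! i) = 2" "incident G (edges G) (vs ! i) \<subseteq> set es"
proof -
  let ?x = "vs ! i" and ?e = "es ! (i - 1)" and ?f = "es ! i"
  have w: "walk G vs es" using p by (simp add: path_def)
  have e: "?x \<in> ends G ?e" "?e \<in> edges G" "?x \<in> ends G ?f" "?f \<in> edges G"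
    using w i by (auto simp: walk_def)
  have neq: "?e \<noteq> ?f" using path_distinct_edges[OF p] i by (simp add: nth_eq_iff_index_eq)
  have "incident G (edges G) ?x = {?e, ?f}"
    using hubI3[OF fin e(2,4) _ neq, of _ ?x] e assms(5) by (auto simp: incident_def)
  then show "degree G ?x = 2" "incident G (edges G) ?x \<subseteq> set es"
    using neq i by (auto simp: degree_incident)
qed

lemma set_butlast_tl: "walk G vs es \<Longrightarrow> set (butlast (tl vs)) = {vs ! i | i. 0 < i \<and> i < length es}"
proof -
  assume w: "walk G vs es"
  have "set (butlast (tl vs)) = {butlast (tl vs) ! j | j. j < length es - 1}"
    using walk_length[OF w] by (auto simp: set_conv_nth)
  also have "\<dots> = {vs ! Suc j | j. j < length es - 1}"
  proof -
    have "butlast (tl vs) ! j = vs ! Suc j" if "j < length es - 1" for j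
      using walk_length[OF w] that by (simp add: nth_butlast nth_tl)
    then show ?thesis by force
  qed
  also have "\<dots> = {vs ! i | i. 0 < i \<and> i < length es}"
  proof (intro equalityI subsetI)
    fix x assume "x \<in> {vs ! i | i. 0 < i \<and> i < length es}"
    then obtain i where "x = vs ! i" "0 < i" "i < length es" by blast
    then show "x \<in> {vs ! Suc j | j. j < length es - 1}" by (intro CollectI exI[of _ "i - 1"]) auto
  qed (use less_diff_conv in auto)
  finally show ?thesis .
qed

section \<open>Bounds on distances of vertices and subgraphs\<close>

lemma Inf_enat_le_iff: "Inf A \<le> enat m \<longleftrightarrow> (\<exists>a\<in>A. a \<le> enat m)"
proof
  assume le: "Inf A \<le> enat m"
  then have "A \<noteq> {}" by (auto simp: Inf_enat_def)
  then have "Inf A \<in> A" unfolding Inf_enat_def by (auto intro: LeastI)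
  then show "\<exists>a\<in>A. a \<le> enat m" using le by blast
next
  assume "\<exists>a\<in>A. a \<le> enat m"
  then show "Inf A \<le> enat m" by (meson Inf_lower order_trans)
qed

text \<open>The infimum is attained, so a bound on it yields an actual walk. The vertex
  \<open>u\<close> must lie in the graph because \<open>near\<close> is reflexive everywhere,
  whereas walks stay inside \<open>verts G\<close>.\<close>

lemma vdist_le_iff:
  assumes fin: "fin_graph G" and u: "u \<in> verts G"
  shows "vdist G u v \<le> enat m \<longleftrightarrow> (u, v) \<in> near G m"
proof -
  have "vdist G u v \<le> enat m \<longleftrightarrow> (\<exists>vs es. walk G vs es \<and> hd vs = u \<and> last vs = v \<and> length es \<le> m)"
    unfolding vdist_def Inf_enat_le_iff enat_ord_simps(1)[symmetric] by blast
  also have "\<dots> \<longleftrightarrow> (u, v) \<in> near G m"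
  proof
    assume "\<exists>vs es. walk G vs es \<and> hd vs = u \<and> last vs = v \<and> length es \<le> m"
    then obtain vs es where w: "walk G vs es" "hd vs = u" "last vs = v" "length es \<le> m" by blast
    have "vs \<noteq> []" using walk_length[OF w(1)] by auto
    then have "(hd vs, last vs) \<in> near G (length vs - 1)"
      using near_successively[OF walk_successively[OF w(1)]] walk_length[OF w(1)] by auto
    then show "(u, v) \<in> near G m" using near_mono[OF w(4)] w walk_length[OF w(1)] by auto
  next
    assume "(u, v) \<in> near G m"
    then show "\<exists>vs es. walk G vs es \<and> hd vs = u \<and> last vs = v \<and> length es \<le> m"
    proof (induction m arbitrary: v)
      case 0
      then show ?case using u by (intro exI[of _ "[u]"] exI[of _ "[]"]) (simp add: walk_singleton near_def)
    next
      case (Suc m)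
      then obtain z where z: "(u, z) \<in> near G m" "z = v \<or> (z, v) \<in> adj G" by (auto simp: near_def)
      obtain vs es where w: "walk G vs es" "hd vs = u" "last vs = z" "length es \<le> m" using Suc.IH[OF z(1)] by blast
      show ?case
      proof (cases "z = v")
        case True
        then show ?thesis using w by (intro exI[of _ vs] exI[of _ es]) auto
      next
        case False
        then obtain e where e: "e \<in> edges G" "ends G e = {z, v}" using z by (auto simp: links_def)
        then have "v \<in> verts G" using ends_subset[OF fin] by blast
        then have "walk G (vs @ [v]) (es @ [e])" using walk_snoc[OF w(1) e(1)] e w by simp
        moreover have "hd (vs @ [v]) = u" using w walk_length[OF w(1)] by (cases vs) auto
        ultimately show ?thesis using w(4) by (intro exI[of _ "vs @ [v]"] exI[of _ "es @ [e]"]) simp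
      qed
    qed
  qed
  finally show ?thesis .
qed

lemma sub_dist_le_iff:
  assumes "fin_graph G" "verts A \<subseteq> verts G"
  shows "sub_dist G A B \<le> enat m \<longleftrightarrow> near G m \<inter> verts A \<times> verts B \<noteq> {}"
proof -
  have "sub_dist G A B \<le> enat m \<longleftrightarrow> (\<exists>u\<in>verts A. \<exists>v\<in>verts B. vdist G u v \<le> enat m)"
    unfolding sub_dist_def Inf_enat_le_iff by auto
  also have "\<dots> \<longleftrightarrow> (\<exists>u\<in>verts A. \<exists>v\<in>verts B. (u, v) \<in> near G m)"
    using vdist_le_iff[OF assms(1)] assms(2) by blast
  finally show ?thesis by blast
qed

section \<open>Components\<close>

lemma links_verts: "fin_graph G \<Longrightarrow> A \<subseteq> edges G \<Longrightarrow> links G A \<subseteq> verts G \<times> verts G"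
  using links_cover cover_subset_verts by blast

definition component_of :: "('v, 'e) multigraph \<Rightarrow> 'v \<Rightarrow> ('v, 'e) multigraph" where
  "component_of H v = \<lparr>verts = {w. (v, w) \<in> (adj H)\<^sup>*},
     edges = {e \<in> edges H. ends H e \<subseteq> {w. (v, w) \<in> (adj H)\<^sup>*}}, ends = ends H\<rparr>"

lemma adj_subgraph: "subgraph C H \<Longrightarrow> adj C \<subseteq> adj H"
  by (auto simp: subgraph_def links_def)

lemma component_of_in_components:
  assumes fin: "fin_graph H" and v: "v \<in> verts H"
  shows "component_of H v \<in> components H"
proof -
  let ?C = "component_of H v"
  have sym: "sym ((adj H)\<^sup>*)" by (intro sym_rtrancl sym_links)
  have reach: "w \<in> verts H" if "(v, w) \<in> (adj H)\<^sup>*" for w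
    using that v by (rule rtrancl_closed) (use links_verts[OF fin] in blast)
  have sub: "subgraph ?C H"
    using fin reach unfolding subgraph_def fin_graph_def component_of_def by (auto intro: finite_subset)
  then have finC: "fin_graph ?C" by (simp add: subgraph_def)
  have vw: "(v, w) \<in> (adj ?C)\<^sup>*" if "(v, w) \<in> (adj H)\<^sup>*" for w
    using that
  proof (induction rule: rtrancl_induct)
    case (step y z)
    have "(y, z) \<in> adj ?C"
    proof -
      obtain e where e: "e \<in> edges H" "ends H e = {y, z}" using step(2) by (auto simp: links_def)
      have "(v, z) \<in> (adj H)\<^sup>*" using step by simp
      then have "e \<in> edges ?C" using e step(1) by (simp add: component_of_def)
      then show ?thesis using e by (auto simp: links_def component_of_def)
    qed
    then show ?case using step by auto
  qed simp
  have symC: "sym ((adj ?C)\<^sup>*)" by (intro sym_rtrancl sym_links)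
  have "connected_graph ?C"
    unfolding connected_graph_iff[OF finC]
  proof (intro conjI ballI)
    have "v \<in> verts ?C" by (simp add: component_of_def)
    then show "verts ?C \<noteq> {}" by blast
    fix x y assume "x \<in> verts ?C" "y \<in> verts ?C"
    then have "(v, x) \<in> (adj ?C)\<^sup>*" "(v, y) \<in> (adj ?C)\<^sup>*" using vw by (auto simp: component_of_def)
    then show "(x, y) \<in> (adj ?C)\<^sup>*" using symC by (meson rtrancl_trans symD)
  qed
  moreover have "D = ?C" if D: "subgraph D H" "connected_graph D" "subgraph ?C D" for D
  proof -
    have finD: "fin_graph D" using D by (simp add: subgraph_def)
    have "v \<in> verts D" using D(3) by (auto simp: subgraph_def component_of_def)
    then have "(v, w) \<in> (adj D)\<^sup>*" if "w \<in> verts D" for w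
      using D(2) that unfolding connected_graph_iff[OF finD] by blast
    then have reachD: "verts D \<subseteq> {w. (v, w) \<in> (adj H)\<^sup>*}" using rtrancl_mono[OF adj_subgraph[OF D(1)]] by blast
    then have "verts D = verts ?C" using D(3) by (auto simp: subgraph_def component_of_def)
    moreover have "edges D = edges ?C"
    proof
      show "edges ?C \<subseteq> edges D" using D(3) by (simp add: subgraph_def)
      show "edges D \<subseteq> edges ?C"
      proof
        fix e assume e: "e \<in> edges D"
        then have "e \<in> edges H" "ends H e = ends D e" using D(1) by (auto simp: subgraph_def)
        then show "e \<in> edges ?C" using ends_subset[OF finD e] reachD by (simp add: component_of_def)
      qed
    qed
    moreover have "ends D = ends ?C" using D(1) by (simp add: subgraph_def component_of_def)
    ultimately show ?thesis by simp
  qed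
  ultimately show ?thesis using sub by (simp add: components_def)
qed

lemma components_connected:
  assumes "C \<in> components H"
  shows "verts C \<noteq> {}" "verts C \<subseteq> verts H" "\<And>x y. x \<in> verts C \<Longrightarrow> y \<in> verts C \<Longrightarrow> (x, y) \<in> (adj H)\<^sup>*"
proof -
  have C: "subgraph C H" "connected_graph C" "fin_graph C" using assms by (auto simp: components_def subgraph_def)
  show "verts C \<noteq> {}" using C(2) by (simp add: connected_graph_def)
  show "verts C \<subseteq> verts H" using C(1) by (simp add: subgraph_def)
  show "(x, y) \<in> (adj H)\<^sup>*" if "x \<in> verts C" "y \<in> verts C" for x y
    using C(2) that rtrancl_mono[OF adj_subgraph[OF C(1)]] unfolding connected_graph_iff[OF C(3)] by blast
qed

lemma union_of_components:
  assumes "fin_graph H"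
  shows "verts (union_of H (components H)) = verts H"
proof
  show "verts (union_of H (components H)) \<subseteq> verts H"
    by (auto simp: union_of_def dest!: components_connected(2))
  show "verts H \<subseteq> verts (union_of H (components H))"
  proof
    fix v assume "v \<in> verts H"
    then have "component_of H v \<in> components H" by (rule component_of_in_components[OF assms])
    moreover have "v \<in> verts (component_of H v)" by (simp add: component_of_def)
    ultimately show "v \<in> verts (union_of H (components H))" by (auto simp: union_of_def)
  qed
qed

text \<open>A cut argument. If the components reachable from \<open>x\<close> formed a proper
  collection \<open>K\<close>, a short jump across the cut would enlarge it. Conversely, a route
  between the two sides of a cut crosses it in some hop, and for positive \<open>m\<close> every
  hop, links included, covers distance at most \<open>m\<close>.\<close>

lemma sub_dist_components_iff:
  assumes fin: "fin_graph G" and H: "subgraph H G" and m: "0 < m"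
  shows "(\<forall>\<C>. \<C> \<noteq> {} \<and> \<C> \<subset> components H \<longrightarrow>
      sub_dist G (union_of H \<C>) (union_of H (components H - \<C>)) \<le> enat m) \<longleftrightarrow>
    verts H \<times> verts H \<subseteq> (hops m G (edges H) (verts H))\<^sup>*" (is "?L \<longleftrightarrow> ?R")
proof -
  let ?h = "hops m G (edges H) (verts H)"
  have finH: "fin_graph H" using H by (simp add: subgraph_def)
  have HV: "verts H \<subseteq> verts G" using H by (simp add: subgraph_def)
  have "links H (edges H) = links G (edges H)" using H by (simp add: subgraph_def links_def)
  then have adjH: "adj H \<subseteq> ?h" using links_verts[OF finH, of "edges H"] by (auto simp: hops_def)
  have iff: "sub_dist G (union_of H \<C>) (union_of H (components H - \<C>)) \<le> enat m \<longleftrightarrow>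
      near G m \<inter> (\<Union>C\<in>\<C>. verts C) \<times> (\<Union>C\<in>components H - \<C>. verts C) \<noteq> {}" if "\<C> \<subset> components H" for \<C>
  proof -
    have "verts C \<subseteq> verts G" if "C \<in> \<C>" for C
      using components_connected(2)[of C H] \<open>\<C> \<subset> components H\<close> that HV by blast
    then have "verts (union_of H \<C>) \<subseteq> verts G" by (auto simp: union_of_def)
    from sub_dist_le_iff[OF fin this] show ?thesis by (simp add: union_of_def)
  qed
  have verts_eq: "verts H = (\<Union>C\<in>components H. verts C)"
    using union_of_components[OF finH] by (simp add: union_of_def)
  show ?thesis
  proof
    assume L: ?L
    show ?R
    proof (rule subrelI)
      fix x y assume "(x, y) \<in> verts H \<times> verts H"
      then have xy: "x \<in> verts H" "y \<in> verts H" by auto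
      define K where "K = {C \<in> components H. \<exists>w\<in>verts C. (x, w) \<in> ?h\<^sup>*}"
      have all: "(x, w) \<in> ?h\<^sup>*" if CK: "C \<in> K" and w: "w \<in> verts C" for C w
      proof -
        obtain u where u: "C \<in> components H" "u \<in> verts C" "(x, u) \<in> ?h\<^sup>*" using CK by (auto simp: K_def)
        then have "(u, w) \<in> ?h\<^sup>*" using components_connected(3)[OF u(1) u(2) w] rtrancl_mono[OF adjH] by blast
        then show ?thesis using u(3) by (meson rtrancl_trans)
      qed
      have "K \<noteq> {}" using xy(1) verts_eq by (auto simp: K_def)
      have "K = components H"
      proof (rule ccontr)
        assume "K \<noteq> components H"
        then have "K \<subset> components H" by (auto simp: K_def)
        then obtain u w C D where uw: "(u, w) \<in> near G m" "C \<in> K" "u \<in> verts C" "D \<in> components H - K" "w \<in> verts D"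
        proof -
          have "near G m \<inter> (\<Union>C\<in>K. verts C) \<times> (\<Union>C\<in>components H - K. verts C) \<noteq> {}"
            using L \<open>K \<noteq> {}\<close> iff[OF \<open>K \<subset> components H\<close>] \<open>K \<subset> components H\<close> by simp
          then show ?thesis using that by blast
        qed
        then have "u \<in> verts H" "w \<in> verts H" using verts_eq by (auto simp: K_def)
        then have "(u, w) \<in> ?h" using uw(1) by (simp add: hops_def)
        then have "(x, w) \<in> ?h\<^sup>*" using all[OF uw(2,3)] by simp
        then show False using uw(4,5) by (auto simp: K_def)
      qed
      then show "(x, y) \<in> ?h\<^sup>*" using all xy(2) verts_eq by blast
    qed
  next
    assume R: ?R
    show ?L
    proof (intro allI impI)
      fix \<C> assume C: "\<C> \<noteq> {} \<and> \<C> \<subset> components H"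
      then obtain C D where CD: "C \<in> \<C>" "D \<in> components H" "D \<notin> \<C>" by blast
      then obtain x y where xy: "x \<in> verts C" "y \<in> verts D" using components_connected(1) C by blast
      let ?U = "\<Union>C\<in>\<C>. verts C" and ?V = "\<Union>C\<in>components H - \<C>. verts C"
      have "near G m \<inter> ?U \<times> ?V \<noteq> {}"
      proof
        assume none: "near G m \<inter> ?U \<times> ?V = {}"
        have "x \<in> verts H" "y \<in> verts H" using xy CD C components_connected(2) by blast+
        then have "(x, y) \<in> ?h\<^sup>*" using R by blast
        then have "y \<in> ?U"
        proof (rule rtrancl_closed)
          show "x \<in> ?U" using xy CD by blast
          fix u v assume u: "u \<in> ?U" "(u, v) \<in> ?h"
          show "v \<in> ?U"
          proof (rule ccontr)
            assume v: "v \<notin> ?U"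
            have "v \<in> verts H" using u(2) by (simp add: hops_def)
            then have "v \<in> ?V" using v verts_eq by blast
            then have "(u, v) \<notin> near G m" using none u(1) by blast
            moreover have "(u, v) \<in> near G m" using u(2) hops_near[OF m, of "edges H" G] H
              by (auto simp: subgraph_def)
            ultimately show False by contradiction
          qed
        qed
        then show False using none xy CD near_refl[of y G m] by blast
      qed
      then show "sub_dist G (union_of H \<C>) (union_of H (components H - \<C>)) \<le> enat m"
        using iff C by blast
    qed
  qed
qed

section \<open>Skeletons and EUP\<close>

lemma deg_verts_hubs:
  assumes "fin_graph G"
  shows "(\<Union>i\<in>{3..max_degree G}. deg_verts i G) = hubs G"
proof -
  have "degree G v \<le> max_degree G" if "v \<in> verts G" for v
    unfolding max_degree_def using assms that by (intro Max_ge) (auto simp: fin_graph_def)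
  then show ?thesis by (auto simp: deg_verts_def hubs_def)
qed

text \<open>A member of \<open>EUP\<close> is determined by its edges: its isolated vertices must be
  hubs and all hubs must be present, so its vertex set is \<open>cover G A \<union> hubs G\<close>.
  What remains is a condition on edge sets, which is convenient for maximising.\<close>

definition eup_edges :: "nat \<Rightarrow> ('v, 'e) multigraph \<Rightarrow> 'e set \<Rightarrow> bool" where
  "eup_edges n G A \<longleftrightarrow> A \<subseteq> edges G \<and> card (odd_set G A) \<le> 2 \<and>
     (cover G A \<union> hubs G) \<times> (cover G A \<union> hubs G) \<subseteq> (near G (n - 1) \<inter> (cover G A \<union> hubs G) \<times> (cover G A \<union> hubs G))\<^sup>* \<and>
     (\<forall>b\<in>branches G. branch_edges b \<inter> A = {} \<longrightarrow> card (branch_edges b) \<le> n + 1) \<and>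
     (\<forall>b\<in>end_branches G. branch_edges b \<inter> A = {} \<longrightarrow> card (branch_edges b) \<le> n)"

lemma EUP_nonempty_iff:
  fixes G :: "('v, 'e) multigraph"
  assumes fin: "fin_graph G" and n: "2 \<le> n"
  shows "EUP n G \<noteq> {} \<longleftrightarrow> (\<exists>A. eup_edges n G A)"
proof -
  have main: "H \<in> EUP n G \<longleftrightarrow> eup_edges n G (edges H) \<and> verts H = cover G (edges H) \<union> hubs G"
    if H: "subgraph H G" for H :: "('v, 'e) multigraph"
  proof -
    have ends: "ends H = ends G" and EH: "edges H \<subseteq> edges G" and finH: "fin_graph H"
      using H by (auto simp: subgraph_def)
    have inc: "incident H (edges H) = incident G (edges H)"
      by (simp add: incident_def ends fun_eq_iff)
    have cov: "cover G (edges H) \<subseteq> verts H"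
      using cover_subset_verts[OF finH, of "edges H"] by (simp add: cover_def ends)
    have odd: "odd_verts H = odd_set G (edges H)"
      using odd_set_subset_cover[of G "edges H"] cov
      by (auto simp: odd_verts_def odd_set_def degree_incident inc)
    have "card (incident G (edges H) v) = 0 \<longleftrightarrow> v \<notin> cover G (edges H)" for v
      using finite_incident[OF finite_subset_edges[OF fin EH], of G v] by (auto simp: incident_def cover_def)
    then have iso: "deg_verts 0 H = verts H - cover G (edges H)"
      by (auto simp: deg_verts_def degree_incident inc)
    have hub: "deg_verts 0 H \<subseteq> hubs G \<and> hubs G \<subseteq> verts H \<longleftrightarrow> verts H = cover G (edges H) \<union> hubs G"
      unfolding iso using cov by auto
    have hops: "hops (n - 1) G (edges H) (verts H) = near G (n - 1) \<inter> verts H \<times> verts H"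
      using hops_near[OF _ EH, of "n - 1"] n by simp
    show ?thesis
      using H EH n hub sub_dist_components_iff[OF fin H, of "n - 1"]
      unfolding EUP_def eup_edges_def mem_Collect_eq deg_verts_hubs[OF fin] odd hops
      by auto
  qed
  show ?thesis
  proof
    assume "EUP n G \<noteq> {}"
    then obtain H where "H \<in> EUP n G" by blast
    moreover then have "subgraph H G" by (simp add: EUP_def)
    ultimately show "\<exists>A. eup_edges n G A" using main by blast
  next
    assume "\<exists>A. eup_edges n G A"
    then obtain A where A: "eup_edges n G A" by blast
    let ?H = "\<lparr>verts = cover G A \<union> hubs G, edges = A, ends = ends G\<rparr>"
    have AE: "A \<subseteq> edges G" using A by (simp add: eup_edges_def)
    have V: "cover G A \<union> hubs G \<subseteq> verts G" using cover_subset_verts[OF fin AE] by (auto simp: hubs_def)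
    have "subgraph ?H G"
      unfolding subgraph_def fin_graph_def using AE V fin finite_subset_edges[OF fin AE]
      by (auto simp: fin_graph_def cover_def intro: finite_subset)
    then have "?H \<in> EUP n G" using main[of ?H] A by simp
    then show "EUP n G \<noteq> {}" by blast
  qed
qed

section \<open>From a maximal edge set to a skeleton\<close>

lemma rtrancl_extend:
  assumes "R \<times> R \<subseteq> (r \<inter> R \<times> R)\<^sup>*" "R \<subseteq> S" "sym r"
    and "\<And>x. x \<in> S \<Longrightarrow> \<exists>y\<in>R. (x, y) \<in> (r \<inter> S \<times> S)\<^sup>*"
  shows "S \<times> S \<subseteq> (r \<inter> S \<times> S)\<^sup>*"
proof (rule subrelI)
  fix x y assume "(x, y) \<in> S \<times> S"
  then obtain u v where uv: "u \<in> R" "v \<in> R" "(x, u) \<in> (r \<inter> S \<times> S)\<^sup>*" "(y, v) \<in> (r \<inter> S \<times> S)\<^sup>*"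
    using assms(4) by (metis SigmaE2)
  have "r \<inter> R \<times> R \<subseteq> r \<inter> S \<times> S" using assms(2) by blast
  then have "(u, v) \<in> (r \<inter> S \<times> S)\<^sup>*" using assms(1) uv rtrancl_mono by blast
  moreover have "sym ((r \<inter> S \<times> S)\<^sup>*)" using assms(3) by (intro sym_rtrancl) (auto simp: sym_def)
  then have "(v, y) \<in> (r \<inter> S \<times> S)\<^sup>*" using uv(4) by (rule symD)
  ultimately show "(x, y) \<in> (r \<inter> S \<times> S)\<^sup>*" using uv(3) by (meson rtrancl_trans)
qed

lemma walk_reaches:
  assumes "walk G vs es" "x \<in> set vs"
  shows "(x, hd vs) \<in> (links G (set es))\<^sup>*"
  using assms
proof (induction es arbitrary: vs)
  case Nil
  then show ?case by (cases vs) (auto simp: walk_def)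
next
  case (Cons e es)
  then obtain y us where vs: "vs = y # us" by (cases vs) (auto simp: walk_def)
  then have w: "us \<noteq> []" "ends G e = {y, hd us}" "e \<in> edges G" "walk G us es"
    using Cons.prems by (auto simp: walk_Cons)
  show ?case
  proof (cases "x = y")
    case False
    then have "(x, hd us) \<in> (links G (set es))\<^sup>*" using Cons.IH[OF w(4)] Cons.prems vs by simp
    moreover have "links G (set es) \<subseteq> links G (set (e # es))" by (intro links_mono) auto
    ultimately have "(x, hd us) \<in> (links G (set (e # es)))\<^sup>*" using rtrancl_mono by blast
    moreover have "(hd us, y) \<in> links G (set (e # es))"
      using w vs by (auto simp: links_def insert_commute)
    ultimately have "(x, y) \<in> (links G (set (e # es)))\<^sup>*" by (rule rtrancl_into_rtrancl)
    then show ?thesis using vs by simp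
  qed (simp add: vs)
qed

lemma chain_obtain_path:
  assumes "chain G xs" "xs \<noteq> []" "set xs \<subseteq> verts G"
  shows "\<exists>es. path G xs es"
proof -
  have "successively (\<lambda>x y. (x, y) \<in> adj G) xs \<Longrightarrow> xs \<noteq> [] \<Longrightarrow> set xs \<subseteq> verts G \<Longrightarrow> \<exists>es. walk G xs es"
  proof (induction xs)
    case (Cons x xs)
    show ?case
    proof (cases "xs = []")
      case True
      then show ?thesis using Cons.prems by (intro exI[of _ "[]"]) (simp add: walk_singleton)
    next
      case False
      then obtain es where es: "walk G xs es" using Cons by (auto simp: successively_Cons)
      have "(x, hd xs) \<in> adj G" using Cons.prems False by (auto simp: successively_Cons)
      then obtain e where "e \<in> edges G" "ends G e = {x, hd xs}" by (auto simp: links_def)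
      then have "walk G (x # xs) (e # es)" using es False Cons.prems by (simp add: walk_Cons)
      then show ?thesis by blast
    qed
  qed simp
  then show ?thesis using assms unfolding chain_def path_def by blast
qed

lemma chain_rev: "chain G (rev xs) \<longleftrightarrow> chain G xs"
proof -
  have "(y, x) \<in> adj G \<longleftrightarrow> (x, y) \<in> adj G" for x y using sym_links by (metis symD)
  then show ?thesis by (simp add: chain_def)
qed

lemma cover_walk:
  assumes "walk G vs es"
  shows "cover G (set es) \<subseteq> set vs"
proof
  fix x assume "x \<in> cover G (set es)"
  then obtain i where "i < length es" "x \<in> ends G (es ! i)" by (auto simp: cover_def in_set_conv_nth)
  then show "x \<in> set vs" using assms by (auto simp: walk_def)
qed

lemma walk_cover:
  assumes "walk G vs es" "es \<noteq> []"
  shows "set vs \<subseteq> cover G (set es)"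
proof
  fix x assume "x \<in> set vs"
  then obtain i where i: "i < Suc (length es)" "vs ! i = x" using assms(1) by (auto simp: in_set_conv_nth walk_def)
  show "x \<in> cover G (set es)"
  proof (cases "i < length es")
    case True
    then show ?thesis using assms i by (auto simp: cover_def walk_def intro!: bexI[of _ "es ! i"])
  next
    case False
    then have "i = length es" "0 < length es" using i assms(2) by auto
    then have "i = Suc (i - 1)" "i - 1 < length es" by auto
    then show ?thesis using assms i by (auto simp: cover_def walk_def intro!: bexI[of _ "es ! (i - 1)"])
  qed
qed

text \<open>An edge set satisfying the \<open>EUP\<close> conditions may meet a branch in a proper part of it.  An edge set
  of maximal size does not: a branch that is met can be completed edge by edge without creating
  more odd vertices, and a closed branch (which is not a branch in the sense of \<open>branches\<close>) can be
  added as a whole.\<close>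

lemma skeleton_of_eup_edges:
  assumes fin: "fin_graph G"
    and conn: "\<And>x y. x \<in> verts G \<Longrightarrow> y \<in> verts G \<Longrightarrow> (x, y) \<in> (adj G)\<^sup>*"
    and ne: "edges G \<noteq> {}" and n: "2 \<le> n" and A0: "eup_edges n G A0"
  shows "\<exists>A. skeleton n G A (cover G A \<union> hubs G)"
proof -
  have "\<forall>A. eup_edges n G A \<longrightarrow> card A < Suc (card (edges G))"
    using card_mono[OF finite_edges[OF fin]] by (simp add: eup_edges_def less_Suc_eq_le)
  then obtain A where A: "eup_edges n G A" and max: "\<And>A'. eup_edges n G A' \<Longrightarrow> card A' \<le> card A"
    using Lattices_Big.ex_has_greatest_nat[of "eup_edges n G" A0 card "Suc (card (edges G))", OF A0] by blast
  define R where "R = cover G A \<union> hubs G"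
  have AE: "A \<subseteq> edges G" and odd2: "card (odd_set G A) \<le> 2"
    and RR: "R \<times> R \<subseteq> (near G (n - 1) \<inter> R \<times> R)\<^sup>*"
    and br: "\<And>b. b \<in> branches G \<Longrightarrow> branch_edges b \<inter> A = {} \<Longrightarrow> card (branch_edges b) \<le> n + 1"
    and ebr: "\<And>b. b \<in> end_branches G \<Longrightarrow> branch_edges b \<inter> A = {} \<Longrightarrow> card (branch_edges b) \<le> n"
    using A unfolding eup_edges_def R_def by blast+
  have RV: "R \<subseteq> verts G" using cover_subset_verts[OF fin AE] by (auto simp: R_def hubs_def)
  \<comment> \<open>Enlarging the edge set only relaxes the two branch conditions, so a larger set
    with few odd vertices whose new vertices stay connected to \<open>R\<close> would contradict
    maximality.\<close>
  have grow: False if A': "A \<subset> A'" "A' \<subseteq> edges G" "card (odd_set G A') \<le> 2"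
    and S: "\<And>x. x \<in> cover G A' \<union> hubs G \<Longrightarrow>
      \<exists>y\<in>R. (x, y) \<in> (near G (n - 1) \<inter> (cover G A' \<union> hubs G) \<times> (cover G A' \<union> hubs G))\<^sup>*" for A'
  proof -
    have "R \<subseteq> cover G A' \<union> hubs G" using A'(1) by (auto simp: R_def cover_def)
    from rtrancl_extend[OF RR this sym_near S]
    have "eup_edges n G A'" using A' br ebr unfolding eup_edges_def by blast
    then have "card A' \<le> card A" by (rule max)
    then show False using psubset_card_mono[OF finite_subset_edges[OF fin A'(2)] A'(1)] by simp
  qed
  have near1: "adj G \<subseteq> near G (n - 1)" using n by (intro near_adj) simp
  \<comment> \<open>Without hubs the empty edge set may satisfy all conditions; but then a single
    edge satisfies them too, against maximality.\<close>
  have Rne: "R \<noteq> {}"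
  proof
    assume "R = {}"
    have "A = {}"
    proof (rule ccontr)
      assume "A \<noteq> {}"
      then obtain e where e: "e \<in> A" by blast
      then obtain u v where "ends G e = {u, v}" using obtain_ends[OF fin subsetD[OF AE e]] by metis
      then show False using e \<open>R = {}\<close> by (auto simp: R_def cover_def)
    qed
    obtain e where e: "e \<in> edges G" using ne by blast
    obtain u v where uv: "ends G e = {u, v}" "u \<noteq> v" using obtain_ends[OF fin e] .
    have cov: "cover G {e} \<union> hubs G = {u, v}" using \<open>R = {}\<close> uv by (auto simp: R_def cover_def)
    have uv_near: "(u, v) \<in> near G (n - 1)" "(v, u) \<in> near G (n - 1)"
      using near1 e uv by (auto simp: links_def insert_commute)
    have "{u, v} \<times> {u, v} \<subseteq> (near G (n - 1) \<inter> {u, v} \<times> {u, v})\<^sup>*" using uv_near by auto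
    then have "eup_edges n G {e}"
      using e odd_set_edge[OF fin e] uv br ebr \<open>A = {}\<close> unfolding eup_edges_def cov by auto
    then have "card {e} \<le> card A" by (rule max)
    then show False using \<open>A = {}\<close> by simp
  qed
  \<comment> \<open>If only one edge at \<open>q\<close> lies in \<open>A\<close>, then
    \<open>q\<close> is odd. Adding the other edge \<open>f\<close> makes \<open>q\<close> even and
    changes the parity only at \<open>z\<close> besides, so the number of odd vertices does not
    increase.\<close>
  have closedA: "incident G (edges G) q \<subseteq> A" if q: "q \<in> cover G A" "q \<notin> hubs G" for q
  proof (rule ccontr)
    assume "\<not> ?thesis"
    then obtain f where f: "f \<in> edges G" "q \<in> ends G f" "f \<notin> A" by (auto simp: incident_def)
    obtain e where e: "e \<in> A" "q \<in> ends G e" using q by (auto simp: cover_def)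
    obtain z where z: "ends G f = {q, z}" "q \<noteq> z" using obtain_other_end[OF fin f(1,2)] .
    have "incident G A q = {e}"
      using hubI3[OF fin _ _ f(1), of e _ q] e f q(2) AE by (auto simp: incident_def)
    then have qo: "q \<in> odd_set G A" by (simp add: odd_set_def)
    have finO: "finite (odd_set G A)" by (rule finite_odd_set[OF fin AE])
    have "odd_set G (insert f A) \<subseteq> insert z (odd_set G A - {q})"
      using odd_set_insert[OF fin AE f(1,3)] z qo by auto
    then have "card (odd_set G (insert f A)) \<le> card (insert z (odd_set G A - {q}))"
      using finO by (intro card_mono) auto
    also have "\<dots> \<le> Suc (card (odd_set G A - {q}))" by (rule card_insert_le_m1) (use finO in \<open>auto simp: card_gt_0_iff\<close>)
    also have "\<dots> = card (odd_set G A)" using qo finO by (metis card.remove)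
    finally have "card (odd_set G (insert f A)) \<le> 2" using odd2 by simp
    then show False
    proof (rule grow[rotated 2])
      show "A \<subset> insert f A" "insert f A \<subseteq> edges G" using f AE by auto
      fix x assume x: "x \<in> cover G (insert f A) \<union> hubs G"
      show "\<exists>y\<in>R. (x, y) \<in> (near G (n - 1) \<inter> (cover G (insert f A) \<union> hubs G) \<times> (cover G (insert f A) \<union> hubs G))\<^sup>*"
      proof (cases "x \<in> R")
        case False
        then have "x = z" using x z q by (auto simp: R_def cover_def)
        then have "(x, q) \<in> near G (n - 1)" using near1 f z by (auto simp: links_def insert_commute)
        then have "(x, q) \<in> near G (n - 1) \<inter> (cover G (insert f A) \<union> hubs G) \<times> (cover G (insert f A) \<union> hubs G)"
          using x f by (auto simp: cover_def)
        moreover have "q \<in> R" using q by (simp add: R_def)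
        ultimately show ?thesis by blast
      qed blast
    qed
  qed
  have dom: "set xs \<inter> R \<noteq> {}" if xs: "chain G xs" "length xs = Suc n" for xs
  proof
    assume avoid: "set xs \<inter> R = {}"
    \<comment> \<open>A longest path avoiding \<open>R\<close> ends in leaves or next to hubs; it extends to a branch, to a closed
      branch, or it is a whole component.\<close>
    define P where "P ys \<longleftrightarrow> chain G ys \<and> set ys \<inter> R = {} \<and> set ys \<subseteq> verts G" for ys
    have "set xs \<subseteq> verts G"
    proof
      fix x assume "x \<in> set xs"
      then obtain i where i: "i < Suc n" "xs ! i = x" using xs(2) by (auto simp: in_set_conv_nth)
      have step: "(xs ! i, xs ! Suc i) \<in> adj G" if "i < n" for i
        using xs that by (auto simp: chain_def intro: successively_nth)
      have "x \<in> cover G (edges G)"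
      proof (cases "i < n")
        case True
        then show ?thesis using step[of i] i(2) links_cover[of G "edges G"] by blast
      next
        case False
        then have "Suc (i - 1) = i" "i - 1 < n" using i(1) n by auto
        then show ?thesis using step[of "i - 1"] i(2) links_cover[of G "edges G"] by auto
      qed
      then show "x \<in> verts G" using cover_subset_verts[OF fin] by blast
    qed
    then have "P xs" using xs avoid by (simp add: P_def)
    moreover have "\<forall>ys. P ys \<longrightarrow> length ys \<le> card (verts G)"
    proof (intro allI impI)
      fix ys assume "P ys"
      then have "distinct ys" "set ys \<subseteq> verts G" by (auto simp: P_def chain_def)
      moreover have "finite (verts G)" using fin by (simp add: fin_graph_def)
      ultimately have "card (set ys) = length ys" "card (set ys) \<le> card (verts G)"
        by (auto intro: distinct_card card_mono)
      then show "length ys \<le> card (verts G)" by simp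
    qed
    ultimately obtain ys where ys: "P ys" and ymax: "\<And>zs. P zs \<Longrightarrow> length zs \<le> length ys"
      using Lattices_Big.ex_has_greatest_nat[of P xs length "Suc (card (verts G))"]
      by (auto simp: less_Suc_eq_le)
    define N where "N = length ys"
    have N: "Suc n \<le> N" using ymax[OF \<open>P xs\<close>] xs(2) by (simp add: N_def)
    have revP: "P (rev zs) \<longleftrightarrow> P zs" for zs by (simp add: P_def chain_rev)
    have nohub: "x \<notin> hubs G" "x \<notin> cover G A" if "P zs" "x \<in> set zs" for x zs
      using that by (auto simp: P_def R_def)
    \<comment> \<open>By maximal length \<open>w\<close> lies in \<open>R\<close>. If it were no
      hub, \<open>closedA\<close> would put the joining edge into \<open>A\<close>, and the path
      would meet \<open>R\<close>.\<close>
    have outer_hub: "w \<in> hubs G" if zs: "P zs" "length zs = N" "(hd zs, w) \<in> adj G" "w \<notin> set zs" for zs w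
    proof -
      have "zs \<noteq> []" using zs(2) N by auto
      have "w \<in> R"
      proof (rule ccontr)
        assume "w \<notin> R"
        moreover have "(w, hd zs) \<in> adj G" using zs(3) sym_links by (metis symD)
        moreover have "w \<in> verts G" using zs(3) links_verts[OF fin] by blast
        ultimately have "P (w # zs)"
          using zs \<open>zs \<noteq> []\<close> unfolding P_def chain_def by (auto simp: successively_Cons)
        then show False using ymax zs(2) by (fastforce simp: N_def)
      qed
      show ?thesis
      proof (rule ccontr)
        assume w: "w \<notin> hubs G"
        then have "incident G (edges G) w \<subseteq> A" using closedA \<open>w \<in> R\<close> by (simp add: R_def)
        moreover obtain f where f: "f \<in> edges G" "ends G f = {hd zs, w}" using zs(3) by (auto simp: links_def)
        ultimately have "hd zs \<in> cover G A" by (auto simp: incident_def cover_def)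
        then show False using nohub(2)[OF zs(1)] \<open>zs \<noteq> []\<close> by simp
      qed
    qed
    have extend: "\<exists>f es. path G (w # zs) (f # es) \<and> path G zs es \<and> length es = N - 1"
      if zs: "P zs" "length zs = N" "(hd zs, w) \<in> adj G" "w \<notin> set zs" for zs w
    proof -
      have "zs \<noteq> []" using zs(2) N by auto
      then obtain es where es: "path G zs es" using chain_obtain_path[of G zs] zs(1) by (auto simp: P_def)
      obtain f where f: "f \<in> edges G" "ends G f = {w, hd zs}" using zs(3) by (auto simp: links_def insert_commute)
      have "w \<in> verts G" using ends_subset[OF fin f(1)] f(2) by blast
      then have "path G (w # zs) (f # es)" using es f zs(4) \<open>zs \<noteq> []\<close> by (simp add: path_def walk_Cons)
      then show ?thesis using es walk_length[of G zs es] zs(2) by (auto simp: path_def)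
    qed
    have W: "w \<in> W_verts G" if "w \<in> hubs G" for w using that by (auto simp: W_verts_def hubs_def deg_verts_def)
    \<comment> \<open>The path runs from a hub into a dead end, which turns out to be a leaf. This
      gives an end branch with \<open>N \<ge> n + 1\<close> edges, all outside \<open>A\<close>,
      against the bound \<open>n\<close>.\<close>
    have one_sided: False
      if zs: "P zs" "length zs = N" "(hd zs, w) \<in> adj G" "w \<notin> set zs"
        and no: "\<And>u. (last zs, u) \<in> adj G \<Longrightarrow> u \<in> set zs" for zs w
    proof -
      obtain f es where p: "path G (w # zs) (f # es)" "path G zs es" "length es = N - 1"
        using extend[OF zs] by blast
      have wk: "walk G (w # zs) (f # es)" using p by (simp add: path_def)
      have dist: "distinct (w # zs)" using p by (simp add: path_def)
      have len: "length (f # es) = N" using p N by simp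
      have zne: "zs \<noteq> []" using zs(2) N by auto
      have last: "last zs = (w # zs) ! N" using zs(2) zne N by (simp add: last_conv_nth nth_Cons')
      have ends_nth: "ends G ((f # es) ! j) = {(w # zs) ! j, (w # zs) ! Suc j}" if "j < N" for j
        using wk len that unfolding walk_def by blast
      have nth_eq: "(w # zs) ! i = (w # zs) ! j \<longleftrightarrow> i = j" if "i \<le> N" "j \<le> N" for i j
        using dist zs(2) that by (subst nth_eq_iff_index_eq) auto
      \<comment> \<open>An edge at the last vertex leads to a vertex inside the path, all of whose
        edges belong to the path; so it is the last edge.\<close>
      have inc_last: "incident G (edges G) (last zs) = {(f # es) ! (N - 1)}"
      proof
        show "{(f # es) ! (N - 1)} \<subseteq> incident G (edges G) (last zs)"
        proof -
          have "(f # es) ! (N - 1) \<in> set (f # es)" using len N by (intro nth_mem) simp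
          moreover have "set (f # es) \<subseteq> edges G" using wk by (simp add: walk_def)
          moreover have "last zs \<in> ends G ((f # es) ! (N - 1))" using ends_nth[of "N - 1"] N last by simp
          ultimately show ?thesis by (auto simp: incident_def)
        qed
        show "incident G (edges G) (last zs) \<subseteq> {(f # es) ! (N - 1)}"
        proof
          fix g assume "g \<in> incident G (edges G) (last zs)"
          then have g: "g \<in> edges G" "last zs \<in> ends G g" by (auto simp: incident_def)
          obtain u where u: "ends G g = {last zs, u}" "last zs \<noteq> u" using obtain_other_end[OF fin g] .
          then have "(last zs, u) \<in> adj G" using g by (auto simp: links_def)
          then have uz: "u \<in> set zs" by (rule no)
          then obtain i where i: "i < N" "u = (w # zs) ! Suc i" using zs(2) by (auto simp: in_set_conv_nth)
          have "Suc i \<noteq> N" using i u last by auto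
          then have "incident G (edges G) u \<subseteq> set (f # es)"
            using path_interior(2)[OF fin p(1), of "Suc i"] i len nohub(1)[OF zs(1) uz] by simp
          then have "g \<in> set (f # es)" using g u by (auto simp: incident_def)
          then obtain j where j: "j < N" "(f # es) ! j = g" using len by (metis in_set_conv_nth)
          then have "(w # zs) ! N \<in> {(w # zs) ! j, (w # zs) ! Suc j}" using ends_nth[of j] g last by simp
          then have "N = j \<or> N = Suc j" using nth_eq[of N j] nth_eq[of N "Suc j"] j by auto
          then show "g \<in> {(f # es) ! (N - 1)}" using j by auto
        qed
      qed
      have lV: "last zs \<in> verts G" using zs(1) zne by (auto simp: P_def)
      then have leaf: "last zs \<in> deg_verts 1 G" using inc_last by (simp add: deg_verts_def degree_incident)
      have "(w # zs, f # es) \<in> branches G"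
        unfolding branches_def
      proof (intro CollectI case_prodI conjI ballI)
        show "hd (w # zs) \<in> W_verts G" using W[OF outer_hub[OF zs]] by simp
        show "last (w # zs) \<in> W_verts G" using leaf zne by (auto simp: W_verts_def deg_verts_def)
        fix v assume "v \<in> set (butlast (tl (w # zs)))"
        then obtain i where i: "v = (w # zs) ! i" "0 < i" "i < length (f # es)"
          using set_butlast_tl[OF wk] by blast
        then have "v \<in> set zs" using zs(2) len by (auto simp: nth_Cons')
        then show "degree G v = 2" using path_interior(1)[OF fin p(1) i(2,3)] i(1) nohub(1)[OF zs(1)] by simp
      qed (use p in auto)
      then have "(w # zs, f # es) \<in> end_branches G"
        using leaf last_in_set[OF zne] by (auto simp: end_branches_def branch_verts_def)
      moreover have "branch_edges (w # zs, f # es) \<inter> A = {}"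
      proof -
        have "e \<notin> A" if e: "e \<in> set (f # es)" for e
        proof
          assume "e \<in> A"
          obtain j where j: "j < N" "(f # es) ! j = e"
            using e len by (metis in_set_conv_nth)
          then have "zs ! j \<in> ends G e" "zs ! j \<in> set zs" using ends_nth[of j] zs(2) by auto
          then show False using \<open>e \<in> A\<close> nohub(2)[OF zs(1)] by (auto simp: cover_def)
        qed
        then show ?thesis by (auto simp: branch_edges_def)
      qed
      ultimately have "card (branch_edges (w # zs, f # es)) \<le> n" by (rule ebr)
      moreover have "card (branch_edges (w # zs, f # es)) = N"
        using distinct_card[OF path_distinct_edges[OF p(1)]] len by (simp add: branch_edges_def)
      ultimately show False using N by simp
    qed
    have yne: "ys \<noteq> []" using N by (auto simp: N_def)
    show False
    proof (cases "\<exists>w. (hd ys, w) \<in> adj G \<and> w \<notin> set ys")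
      case True
      then obtain w where w: "(hd ys, w) \<in> adj G" "w \<notin> set ys" by blast
      show False
      proof (cases "\<exists>w. (last ys, w) \<in> adj G \<and> w \<notin> set ys")
        case False
        then show False using one_sided[OF ys N_def[symmetric] w] by blast
      next
        case True
        then obtain w' where w': "(last ys, w') \<in> adj G" "w' \<notin> set ys" by blast
        obtain f es where p: "path G (w # ys) (f # es)" "path G ys es" "length es = N - 1"
          using extend[OF ys N_def[symmetric] w] by blast
        obtain f' where f': "f' \<in> edges G" "ends G f' = {last ys, w'}" using w' by (auto simp: links_def)
        have hub: "w \<in> hubs G" "w' \<in> hubs G"
          using outer_hub[OF ys N_def[symmetric] w] outer_hub[of "rev ys" w'] ys w' revP yne
          by (auto simp: N_def hd_rev)
        \<comment> \<open>With hubs at both sides there are \<open>N + 1 \<ge> n + 2\<close> edges.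
          If the hubs differ, this is a branch exceeding the bound \<open>n + 1\<close>. If they
          agree, it is a closed trail; it adds no odd vertex, so joining it to \<open>A\<close>
          contradicts maximality.\<close>
        let ?vs = "w # ys @ [w']" and ?es = "f # es @ [f']"
        have "walk G ((w # ys) @ [w']) ((f # es) @ [f'])"
          using walk_snoc[of G "w # ys" "f # es" f' w'] p(1) f' hub(2) yne by (auto simp: path_def hubs_def)
        then have wk: "walk G ?vs ?es" by simp
        have len: "length ?es = Suc N" using p(3) N by simp
        have ends_nth: "ends G (?es ! j) = {?vs ! j, ?vs ! Suc j}" if "j < Suc N" for j
          using wk that unfolding walk_def len by blast
        have vs_nth: "?vs ! i \<in> set ys" if "0 < i" "i \<le> N" for i
          using that by (auto simp: nth_Cons' nth_append N_def)
        have hit: "ends G e \<inter> set ys \<noteq> {}" if e: "e \<in> set ?es" for e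
        proof -
          obtain j where j: "j < Suc N" "?es ! j = e" using e len by (metis in_set_conv_nth)
          then show ?thesis using ends_nth[of j] vs_nth[of j] vs_nth[of "Suc j"] N by (cases j) (auto simp del: nth_Cons_Suc nth_Cons_0)
        qed
        have unhit: "set ?es \<inter> A = {}"
        proof -
          have "e \<notin> A" if "e \<in> set ?es" for e
            using hit[OF that] nohub(2)[OF ys] by (auto simp: cover_def)
          then show ?thesis by blast
        qed
        have dist: "distinct ?es"
        proof -
          have "ends G e \<subseteq> insert w (set ys)" if "e \<in> set (f # es)" for e
            using cover_walk[of G "w # ys" "f # es"] p(1) that by (auto simp: path_def cover_def)
          moreover have f_ends: "ends G f = {w, hd ys}" using p(1) by (auto simp: path_def walk_Cons)
          moreover have "ends G e \<subseteq> set ys" if "e \<in> set es" for e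
            using cover_walk[of G ys es] p(2) that by (auto simp: path_def cover_def)
          then have "f' \<notin> set es" using f'(2) w'(2) by blast
          moreover have "f' \<noteq> f"
          proof
            assume "f' = f"
            then have "{last ys, w'} = {w, hd ys}" using f_ends f' by simp
            then have "last ys = hd ys" using w w' yne by (metis doubleton_eq_iff last_in_set)
            moreover have "ys ! (N - 1) \<noteq> ys ! 0"
              using ys N n by (subst nth_eq_iff_index_eq) (auto simp: P_def chain_def N_def)
            ultimately show False using yne by (simp add: last_conv_nth hd_conv_nth N_def)
          qed
          ultimately show ?thesis using path_distinct_edges[OF p(1)] by auto
        qed
        show False
        proof (cases "w = w'")
          case False
          then have p': "path G ?vs ?es" using wk p(1) w' by (auto simp: path_def)
          have "(?vs, ?es) \<in> branches G"
            unfolding branches_def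
          proof (intro CollectI case_prodI conjI ballI)
            show "hd ?vs \<in> W_verts G" "last ?vs \<in> W_verts G" using W hub by auto
            fix v assume "v \<in> set (butlast (tl ?vs))"
            then obtain i where i: "v = ?vs ! i" "0 < i" "i < length ?es"
              using set_butlast_tl[OF wk] by blast
            then have "v \<in> set ys" using vs_nth[of i] len by simp
            then show "degree G v = 2" using path_interior(1)[OF fin p' i(2,3)] i(1) nohub(1)[OF ys] by simp
          qed (use p' in auto)
          moreover have "branch_edges (?vs, ?es) \<inter> A = {}" using unhit by (simp add: branch_edges_def)
          ultimately have "card (branch_edges (?vs, ?es)) \<le> n + 1" by (rule br)
          moreover have "card (branch_edges (?vs, ?es)) = Suc N"
            using distinct_card[OF dist] len by (simp add: branch_edges_def)
          ultimately show False using N by simp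
        next
          case True
          have esE: "set ?es \<subseteq> edges G" using wk by (simp add: walk_def)
          have "A \<union> set ?es = sym_diff A (set ?es)" using unhit by blast
          then have "odd_set G (A \<union> set ?es) = sym_diff (odd_set G A) (odd_set G (set ?es))"
            using odd_set_sym_diff[OF finite_subset_edges[OF fin AE] finite_set, of G ?es] by simp
          also have "odd_set G (set ?es) = {}" using odd_set_walk[OF fin wk dist] True by simp
          finally have "card (odd_set G (A \<union> set ?es)) \<le> 2" using odd2 by simp
          then show False
          proof (rule grow[rotated 2])
            have "f \<notin> A" using unhit by auto
            then show "A \<subset> A \<union> set ?es" by auto
            show "A \<union> set ?es \<subseteq> edges G" using AE esE by blast
            let ?S = "cover G (A \<union> set ?es) \<union> hubs G"
            fix x assume x: "x \<in> ?S"
            show "\<exists>y\<in>R. (x, y) \<in> (near G (n - 1) \<inter> ?S \<times> ?S)\<^sup>*"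
            proof (cases "x \<in> R")
              case False
              then have "x \<in> cover G (set ?es)" using x by (auto simp: R_def cover_def)
              then have "x \<in> set ?vs" using cover_walk[OF wk] by blast
              then have "(x, hd ?vs) \<in> (links G (set ?es))\<^sup>*" by (rule walk_reaches[OF wk])
              moreover have "links G (set ?es) \<subseteq> near G (n - 1) \<inter> ?S \<times> ?S"
                using near1 links_mono[OF esE, of G] links_cover[of G "set ?es"] by (fastforce simp: cover_def)
              ultimately have "(x, hd ?vs) \<in> (near G (n - 1) \<inter> ?S \<times> ?S)\<^sup>*"
                by (rule subsetD[OF rtrancl_mono, rotated])
              moreover have "hd ?vs \<in> R" using hub by (simp add: R_def)
              ultimately show ?thesis by blast
            qed blast
          qed
        qed
      qed
    next
      case no_hd: False
      show False
      proof (cases "\<exists>w. (last ys, w) \<in> adj G \<and> w \<notin> set ys")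
        case True
        then show False using one_sided[of "rev ys"] ys revP no_hd yne
          by (auto simp: hd_rev last_rev N_def)
      next
        \<comment> \<open>No edge leaves the path at all, so connectedness puts a vertex of
          \<open>R\<close> on it.\<close>
        case no_last: False
        obtain es where p: "path G ys es" using chain_obtain_path[of G ys] ys yne by (auto simp: P_def)
        then have wk: "walk G ys es" by (simp add: path_def)
        obtain r where r: "r \<in> R" using Rne by blast
        have "(hd ys, r) \<in> (adj G)\<^sup>*" using conn ys hd_in_set[OF yne] r RV unfolding P_def by blast
        then have "r \<in> set ys"
        proof (rule rtrancl_closed)
          show "hd ys \<in> set ys" using yne by simp
          fix u v assume u: "u \<in> set ys" "(u, v) \<in> adj G"
          then obtain i where i: "i < Suc (length es)" "u = ys ! i"
            using walk_length[OF wk] by (auto simp: in_set_conv_nth)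
          show "v \<in> set ys"
          proof (cases "0 < i \<and> i < length es")
            case True
            then have "incident G (edges G) u \<subseteq> set es"
              using path_interior(2)[OF fin p, of i] i(2) nohub(1)[OF ys u(1)] by simp
            moreover obtain g where g: "g \<in> edges G" "ends G g = {u, v}" using u(2) by (auto simp: links_def)
            ultimately show ?thesis using cover_walk[OF wk] by (auto simp: incident_def cover_def)
          next
            case False
            then have "u = hd ys \<or> u = last ys"
              using i walk_length[OF wk] yne by (auto simp: hd_conv_nth last_conv_nth less_Suc_eq)
            then show ?thesis using no_hd no_last u(2) by blast
          qed
        qed
        then show False using r ys by (auto simp: P_def)
      qed
    qed
  qed
  have "skeleton n G A R"
    unfolding skeleton_def
    using AE odd2 Rne RR dom hops_near[OF _ AE, of "n - 1" R] n by (auto simp: R_def)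
  then show ?thesis unfolding R_def by blast
qed

text \<open>The constants in the branch conditions count vertices that cannot lie in
  \<open>R\<close>. A branch outside \<open>A\<close> with \<open>n + 2\<close> edges has
  \<open>n + 1\<close> inner vertices; on an end branch the leaf counts as well, so
  \<open>n + 1\<close> edges suffice. Either way a path with \<open>n\<close> edges would avoid
  \<open>R\<close>.\<close>

lemma eup_edges_of_skeleton:
  assumes fin: "fin_graph G" and n: "2 \<le> n" and sk: "skeleton n G A R" and hub: "hubs G \<subseteq> R"
  shows "eup_edges n G A"
proof -
  have R: "R = cover G A \<union> hubs G" and AE: "A \<subseteq> edges G" and odd: "card (odd_set G A) \<le> 2"
    and dom: "\<And>xs. chain G xs \<Longrightarrow> length xs = Suc n \<Longrightarrow> set xs \<inter> R \<noteq> {}"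
    and RR: "R \<times> R \<subseteq> (hops (n - 1) G A R)\<^sup>*"
    using sk hub by (auto simp: skeleton_def)
  have meet: "\<exists>i. i \<in> {d..d + n} \<and> vs ! i \<in> R"
    if "path G vs es" "d + n \<le> length es" for vs es d
  proof -
    let ?xs = "take (Suc n) (drop d vs)"
    have w: "walk G vs es" "distinct vs" using that by (auto simp: path_def)
    have "successively (\<lambda>x y. (x, y) \<in> adj G) (drop d vs)"
      using walk_successively[OF w(1)] by (metis append_take_drop_id successively_append_iff)
    then have "successively (\<lambda>x y. (x, y) \<in> adj G) ?xs"
      by (metis append_take_drop_id successively_append_iff)
    then have "chain G ?xs" using w by (simp add: chain_def)
    moreover have len: "length ?xs = Suc n" using walk_length[OF w(1)] that by simp
    ultimately obtain x where x: "x \<in> set ?xs" "x \<in> R" using dom by blast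
    then obtain j where "j < Suc n" "x = ?xs ! j" using len by (metis in_set_conv_nth)
    then have "x = vs ! (d + j)" using walk_length[OF w(1)] that by simp
    then show ?thesis using x(2) \<open>j < Suc n\<close> by (intro exI[of _ "d + j"]) auto
  qed
  have unhit: "vs ! i \<notin> R"
    if b: "(vs, es) \<in> branches G" "set es \<inter> A = {}" and i: "i \<le> length es" "0 < i \<and> i < length es \<or> degree G (vs ! i) = 1"
    for vs es i
  proof
    assume iR: "vs ! i \<in> R"
    have p: "path G vs es" "es \<noteq> []" using b by (auto simp: branches_def)
    then have w: "walk G vs es" by (simp add: path_def)
    have deg: "degree G (vs ! i) \<le> 2"
      using i(2)
    proof
      assume "0 < i \<and> i < length es"
      then have "vs ! i \<in> set (butlast (tl vs))" using set_butlast_tl[OF w] by blast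
      then show ?thesis using b by (auto simp: branches_def)
    qed simp
    then have nh: "vs ! i \<notin> hubs G" by (simp add: hubs_def)
    have "incident G (edges G) (vs ! i) \<subseteq> set es"
      using i(2)
    proof
      assume "0 < i \<and> i < length es"
      then show ?thesis using path_interior(2)[OF fin p(1) _ _ nh] by blast
    next
      assume "degree G (vs ! i) = 1"
      then obtain g where g: "incident G (edges G) (vs ! i) = {g}"
        by (auto simp: degree_incident card_1_singleton_iff)
      have "vs ! i \<in> set vs" using i(1) walk_length[OF w] by simp
      then obtain e where "e \<in> set es" "vs ! i \<in> ends G e" using walk_cover[OF w p(2)] by (auto simp: cover_def)
      moreover then have "e \<in> incident G (edges G) (vs ! i)" using w by (auto simp: incident_def walk_def)
      ultimately show ?thesis using g by auto
    qed
    moreover have "vs ! i \<in> cover G A" using iR nh R by blast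
    ultimately show False using b(2) AE by (auto simp: cover_def incident_def)
  qed
  show ?thesis
    unfolding eup_edges_def
  proof (intro conjI ballI impI)
    show "(cover G A \<union> hubs G) \<times> (cover G A \<union> hubs G)
      \<subseteq> (near G (n - 1) \<inter> (cover G A \<union> hubs G) \<times> (cover G A \<union> hubs G))\<^sup>*"
      using RR hops_near[OF _ AE, of "n - 1" R] n unfolding R by auto
    fix b assume b: "b \<in> branches G" "branch_edges b \<inter> A = {}"
    obtain vs es where eq: "b = (vs, es)" by fastforce
    show "card (branch_edges b) \<le> n + 1"
    proof (rule ccontr)
      assume "\<not> ?thesis"
      then have "Suc n < card (set es)" by (simp add: eq branch_edges_def)
      then have len: "Suc n < length es" using card_length[of es] by simp
      have "path G vs es" using b(1) eq by (auto simp: branches_def)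
      from meet[OF this, of 1] len obtain i where "i \<in> {1..1 + n}" "vs ! i \<in> R" by auto
      then show False using unhit[of vs es i] b eq len by (auto simp: branch_edges_def)
    qed
  next
    fix b assume b: "b \<in> end_branches G" "branch_edges b \<inter> A = {}"
    obtain vs es where eq: "b = (vs, es)" by fastforce
    have br: "(vs, es) \<in> branches G" using b eq by (simp add: end_branches_def)
    then have p: "path G vs es" by (auto simp: branches_def)
    then have w: "walk G vs es" by (simp add: path_def)
    obtain l where l: "l \<in> set vs" "degree G l = 1" using b eq by (auto simp: end_branches_def branch_verts_def deg_verts_def)
    then obtain i0 where i0: "i0 < Suc (length es)" "l = vs ! i0" using walk_length[OF w] by (auto simp: in_set_conv_nth)
    have ends: "i0 = 0 \<or> i0 = length es"
    proof (rule ccontr)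
      assume "\<not> ?thesis"
      then have "l \<in> set (butlast (tl vs))" using i0 set_butlast_tl[OF w] by auto
      then show False using br l by (auto simp: branches_def)
    qed
    show "card (branch_edges b) \<le> n"
    proof (rule ccontr)
      assume "\<not> ?thesis"
      then have "n < card (set es)" by (simp add: eq branch_edges_def)
      then have len: "n < length es" using card_length[of es] by simp
      \<comment> \<open>The window of \<open>n + 1\<close> vertices starts at the leaf if the leaf
        comes first; otherwise it starts at position 1 and ends no later than the leaf.\<close>
      obtain d where d: "d \<le> 1" "\<And>i. i \<in> {d..d + n} \<Longrightarrow> 0 < i \<and> i < length es \<or> i = i0"
        using ends len by (cases "i0 = 0") (auto intro: that[of 0] that[of 1])
      have "d + n \<le> length es" using d len by simp
      from meet[OF p this] obtain i where i: "i \<in> {d..d + n}" "vs ! i \<in> R" by blast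
      then show False using unhit[OF br, of i] d i0 l b(2) eq \<open>d + n \<le> length es\<close> by (auto simp: branch_edges_def)
    qed
  qed (use AE odd in auto)
qed

section \<open>Euler trails\<close>

lemma walk_take: "walk G vs es \<Longrightarrow> i \<le> length es \<Longrightarrow> walk G (take (Suc i) vs) (take i es)"
  unfolding walk_def by (auto dest: in_set_takeD)

lemma walk_drop: "walk G vs es \<Longrightarrow> i \<le> length es \<Longrightarrow> walk G (drop i vs) (drop i es)"
  unfolding walk_def by (auto dest: in_set_dropD)

lemma walk_append:
  assumes "walk G us es" "walk G vs fs" "last us = hd vs"
  shows "walk G (us @ tl vs) (es @ fs)"
  using assms
proof (induction es arbitrary: us)
  case Nil
  then obtain u where "us = [u]" by (cases us) (auto simp: walk_def)
  moreover have "vs \<noteq> []" using walk_length[OF Nil.prems(2)] by auto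
  ultimately show ?case using Nil by simp
next
  case (Cons e es)
  then obtain u ws where us: "us = u # ws" by (cases us) (auto simp: walk_def)
  then have w: "ws \<noteq> []" "walk G ws es" "u \<in> verts G" "e \<in> edges G" "ends G e = {u, hd ws}"
    using Cons.prems by (auto simp: walk_Cons)
  then have "walk G (ws @ tl vs) (es @ fs)" using Cons us by simp
  then show ?case using w us by (simp add: walk_Cons)
qed

lemma walk_ends:
  assumes "walk G vs es"
  shows "hd vs = vs ! 0" "last vs = vs ! length es" "vs \<noteq> []"
proof -
  show ne: "vs \<noteq> []" using walk_length[OF assms] by auto
  show "hd vs = vs ! 0" "last vs = vs ! length es"
    using ne walk_length[OF assms] by (simp_all add: hd_conv_nth last_conv_nth)
qed

lemma walk_prepend:
  assumes "walk G vs es" "e \<in> edges G" "x \<in> verts G" "ends G e = {x, hd vs}"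
  shows "walk G (x # vs) (e # es)"
  using assms walk_ends(3)[OF assms(1)] by (simp add: walk_Cons)

lemma euler_trail:
  assumes fin: "fin_graph G" and AE: "A \<subseteq> edges G" and ne: "A \<noteq> {}"
    and conn: "cover G A \<times> cover G A \<subseteq> (links G A)\<^sup>*" and odd2: "card (odd_set G A) \<le> 2"
  shows "\<exists>vs es. walk G vs es \<and> distinct es \<and> set es = A"
proof -
  have finA: "finite A" by (rule finite_subset_edges[OF fin AE])
  have bound: "length es < Suc (card A)" if "distinct es" "set es \<subseteq> A" for es
    using card_mono[OF finA that(2)] distinct_card[OF that(1)] by simp
  define P where "P es \<longleftrightarrow> (\<exists>vs. walk G vs es) \<and> distinct es \<and> set es \<subseteq> A" for es
  obtain e0 where e0: "e0 \<in> A" using ne by blast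
  then have e0E: "e0 \<in> edges G" using AE by blast
  obtain u0 v0 where uv0: "ends G e0 = {u0, v0}" using obtain_ends[OF fin e0E] by metis
  then have "walk G [u0, v0] [e0]"
    using e0E ends_subset[OF fin e0E] by (simp add: walk_Cons walk_singleton)
  then have P0: "P [e0]" using e0 by (auto simp: P_def)
  obtain es where es: "P es" and max: "\<And>fs. P fs \<Longrightarrow> length fs \<le> length es"
    using Lattices_Big.ex_has_greatest_nat[of P "[e0]" length "Suc (card A)"] P0 bound by (auto simp: P_def)
  obtain vs where w: "walk G vs es" "distinct es" "set es \<subseteq> A" using es by (auto simp: P_def)
  have esne: "es \<noteq> []" using max[OF P0] by auto
  have in_verts: "y \<in> verts G" if "f \<in> A" "y \<in> ends G f" for f y using that AE ends_subset[OF fin] by blast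
  \<comment> \<open>Stated for every trail of the maximal length, since it is applied both to the
    chosen trail and to its rotation.\<close>
  have no_last: "f \<in> set gs" if g: "walk G us gs" "distinct gs" "set gs \<subseteq> A" "length gs = length es"
    and f: "f \<in> A" "last us \<in> ends G f" for us gs f
  proof (rule ccontr)
    assume "f \<notin> set gs"
    have fE: "f \<in> edges G" using f AE by blast
    obtain y where y: "ends G f = {last us, y}" using obtain_other_end[OF fin fE f(2)] by metis
    then have "walk G (us @ [y]) (gs @ [f])" using walk_snoc[OF g(1) fE in_verts[OF f(1)]] by simp
    then have "P (gs @ [f])" using g f \<open>f \<notin> set gs\<close> by (auto simp: P_def)
    then show False using max g(4) by fastforce
  qed
  have no_hd: "f \<in> set es" if f: "f \<in> A" "hd vs \<in> ends G f" for f
  proof (rule ccontr)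
    assume "f \<notin> set es"
    have fE: "f \<in> edges G" using f AE by blast
    obtain y where y: "ends G f = {hd vs, y}" using obtain_other_end[OF fin fE f(2)] by metis
    then have "walk G (y # vs) (f # es)"
      using walk_prepend[OF w(1) fE in_verts[OF f(1)], of y] by (simp add: insert_commute)
    then have "P (f # es)" using w f \<open>f \<notin> set es\<close> by (auto simp: P_def)
    then show False using max by fastforce
  qed
  show ?thesis
  proof (rule ccontr)
    assume no: "\<not> ?thesis"
    then obtain g where g: "g \<in> A" "g \<notin> set es" using w by blast
    have "\<exists>f\<in>A - set es. ends G f \<inter> set vs \<noteq> {}"
    proof (rule ccontr)
      assume none: "\<not> ?thesis"
      obtain z z' where z: "ends G g = {z, z'}" using obtain_ends[OF fin subsetD[OF AE g(1)]] by metis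
      have "hd vs \<in> cover G (set es)" using walk_cover[OF w(1) esne] walk_ends(3)[OF w(1)] by auto
      then have "hd vs \<in> cover G A" "z \<in> cover G A" using w(3) g z by (auto simp: cover_def)
      then have "(hd vs, z) \<in> (links G A)\<^sup>*" using conn by blast
      then have "z \<in> set vs"
      proof (rule rtrancl_closed)
        show "hd vs \<in> set vs" using walk_ends(3)[OF w(1)] by simp
        fix p q assume p: "p \<in> set vs" "(p, q) \<in> links G A"
        then obtain h where h: "h \<in> A" "ends G h = {p, q}" by (auto simp: links_def)
        then have "h \<in> set es" using none p by auto
        then show "q \<in> set vs" using cover_walk[OF w(1)] h by (auto simp: cover_def)
      qed
      then show False using none g z by auto
    qed
    then obtain f x where f: "f \<in> A" "f \<notin> set es" "x \<in> ends G f" "x \<in> set vs" by blast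
    obtain i where i: "i \<le> length es" "vs ! i = x"
      using f(4) walk_length[OF w(1)] by (auto simp: in_set_conv_nth less_Suc_eq_le)
    note take = walk_take[OF w(1) i(1)] and drop = walk_drop[OF w(1) i(1)]
    have len: "length vs = Suc (length es)" by (rule walk_length[OF w(1)])
    have take_ends: "hd (take (Suc i) vs) = hd vs" "last (take (Suc i) vs) = x"
      using walk_ends[OF take] walk_ends[OF w(1)] i len by (simp_all add: min_def)
    have drop_ends: "hd (drop i vs) = x" "last (drop i vs) = last vs"
      using walk_ends[OF drop] walk_ends[OF w(1)] i len by (simp_all add: hd_drop_conv_nth)
    show False
    proof (cases "hd vs = last vs")
      case True
      then have rot: "walk G (drop i vs @ tl (take (Suc i) vs)) (drop i es @ take i es)"
        using walk_append[OF drop take] take_ends drop_ends by simp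
      have "last (drop i vs @ tl (take (Suc i) vs)) = x"
      proof (cases "tl (take (Suc i) vs) = []")
        case True
        then have "take (Suc i) vs = [hd (take (Suc i) vs)]" using walk_ends(3)[OF take] by (metis list.collapse)
        then have "hd vs = x" using take_ends by (metis last.simps)
        then show ?thesis using True \<open>hd vs = last vs\<close> drop_ends by simp
      next
        case False
        then show ?thesis using take_ends by (simp add: last_tl)
      qed
      moreover have set_rot: "set (drop i es @ take i es) = set es" by (metis append_take_drop_id set_append sup_commute)
      moreover have "distinct (drop i es @ take i es)"
        using w(2) by (metis append_take_drop_id distinct_append inf_commute)
      moreover have "length (drop i es @ take i es) = length es" using i by simp
      ultimately have "f \<in> set es" using no_last[OF rot, of f] w(3) f(1,3) by (simp only: refl)
      then show False using f(2) by contradiction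
    next
      case False
      have finE: "finite (set es)" by simp
      have odd_es: "odd_set G (set es) = {hd vs, last vs}" using odd_set_walk[OF fin w(1,2)] False by simp
      \<comment> \<open>All edges of \<open>A\<close> at the two ends are used by maximality, so
        both ends are odd in \<open>A\<close>; as there are at most two odd vertices, they are the
        only ones.\<close>
      have "incident G A y = incident G (set es) y" if "y \<in> {hd vs, last vs}" for y
        using that w(3) no_hd no_last[OF w(1-3) refl] by (auto simp: incident_def)
      then have sub: "{hd vs, last vs} \<subseteq> odd_set G A" using odd_es by (auto simp: odd_set_def)
      have odd_A: "odd_set G A = {hd vs, last vs}"
        using card_seteq[OF finite_odd_set[OF fin AE] sub] odd2 False by simp
      have "A - set es = sym_diff A (set es)" using w(3) by blast
      then have odd_B: "odd_set G (A - set es) = {}"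
        using odd_set_sym_diff[OF finA finE, of G] odd_es odd_A by simp
      define Q where "Q gs \<longleftrightarrow> (\<exists>us. walk G us gs \<and> hd us = x) \<and> distinct gs \<and> set gs \<subseteq> A - set es" for gs
      have fE: "f \<in> edges G" using f AE by blast
      obtain y where y: "ends G f = {x, y}" using obtain_other_end[OF fin fE f(3)] by metis
      then have "walk G [x, y] [f]" using fE ends_subset[OF fin fE] by (simp add: walk_Cons walk_singleton)
      then have Q0: "Q [f]" using f unfolding Q_def by (intro conjI exI[of _ "[x, y]"]) auto
      have "\<forall>gs. Q gs \<longrightarrow> length gs < Suc (card A)" using bound unfolding Q_def by blast
      then obtain gs where gs: "Q gs" and gmax: "\<And>hs. Q hs \<Longrightarrow> length hs \<le> length gs"
        using Lattices_Big.ex_has_greatest_nat[of Q "[f]" length "Suc (card A)", OF Q0] by blast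
      obtain us where us: "walk G us gs" "hd us = x" "distinct gs" "set gs \<subseteq> A - set es" using gs by (auto simp: Q_def)
      have gsne: "gs \<noteq> []" using gmax[OF Q0] by auto
      have closed: "last us = x"
      proof (rule ccontr)
        assume "last us \<noteq> x"
        then have "last us \<in> odd_set G (set gs)" using odd_set_walk[OF fin us(1,3)] us(2) by auto
        moreover have "last us \<notin> odd_set G (A - set es)" using odd_B by simp
        ultimately have "incident G (set gs) (last us) \<noteq> incident G (A - set es) (last us)" by (auto simp: odd_set_def)
        then obtain h where h: "h \<in> A" "h \<notin> set es" "h \<notin> set gs" "last us \<in> ends G h"
          using us(4) by (auto simp: incident_def)
        have hE: "h \<in> edges G" using h AE by blast
        obtain y where y: "ends G h = {last us, y}" using obtain_other_end[OF fin hE h(4)] by metis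
        then have "walk G (us @ [y]) (gs @ [h])" using walk_snoc[OF us(1) hE in_verts[OF h(1)]] by simp
        moreover have "hd (us @ [y]) = x" using us(2) walk_ends(3)[OF us(1)] by simp
        ultimately have "Q (gs @ [h])"
          using us h unfolding Q_def by (intro conjI exI[of _ "us @ [y]"]) auto
        then show False using gmax by fastforce
      qed
      have "walk G (us @ tl (drop i vs)) (gs @ drop i es)"
        by (rule walk_append[OF us(1) drop]) (simp add: closed drop_ends)
      then have "walk G (take (Suc i) vs @ tl (us @ tl (drop i vs))) (take i es @ gs @ drop i es)"
        by (rule walk_append[OF take]) (use take_ends us walk_ends(3)[OF us(1)] in simp)
      moreover have "distinct (take i es @ gs @ drop i es)"
      proof -
        have "set (take i es) \<inter> set (drop i es) = {}" "distinct (take i es)" "distinct (drop i es)"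
          using w(2) by (simp_all add: set_take_disj_set_drop_if_distinct)
        moreover have "set (take i es) \<union> set (drop i es) = set es" by (metis append_take_drop_id set_append)
        ultimately show ?thesis using us(3,4) by auto
      qed
      moreover have "set (take i es @ gs @ drop i es) \<subseteq> A"
        using us(4) w(3) by (auto dest: in_set_takeD in_set_dropD)
      ultimately have "P (take i es @ gs @ drop i es)" by (auto simp: P_def)
      then have "length (take i es @ gs @ drop i es) \<le> length es" by (rule max)
      then show False using gsne i by simp
    qed
  qed
qed

section \<open>Traceable line graphs\<close>

lemma star_successively:
  assumes "distinct ls" "\<And>e. e \<in> set ls \<Longrightarrow> e \<in> edges G \<and> u \<in> ends G e"
  shows "successively (\<lambda>e f. (e, f) \<in> adj (line_graph G)) ls"
  unfolding successively_conv_nth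
proof (intro allI impI)
  fix i assume i: "Suc i < length ls"
  then have "ls ! i \<noteq> ls ! Suc i" using assms(1) by (simp add: nth_eq_iff_index_eq)
  then show "(ls ! i, ls ! Suc i) \<in> adj (line_graph G)"
    using assms(2)[of "ls ! i"] assms(2)[of "ls ! Suc i"] i by (auto simp: adj_line_graph)
qed

text \<open>\<open>S\<close> holds the edges off the trail that are still to be listed. Those at the
  current vertex \<open>u\<close> are inserted before the trail edge leaving \<open>u\<close>; they
  share \<open>u\<close> with it and with the edge by which the trail arrived. The claim on
  \<open>hd ls\<close> is what joins consecutive blocks.\<close>

lemma line_chain_of_trail:
  fixes G :: "(('v, 'e) cell, ('v, 'e) cell) multigraph"
  assumes fin: "fin_graph G"
  shows "walk G vs es \<Longrightarrow> distinct es \<Longrightarrow> S \<subseteq> edges G \<Longrightarrow> S \<inter> set es = {} \<Longrightarrow>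
    (\<And>e. e \<in> S \<Longrightarrow> ends G e \<inter> set vs \<noteq> {}) \<Longrightarrow>
    \<exists>ls. chain (line_graph G) ls \<and> set ls = set es \<union> S \<and> (ls \<noteq> [] \<longrightarrow> hd vs \<in> ends G (hd ls))"
proof (induction es arbitrary: vs S)
  case Nil
  then obtain u where vs: "vs = [u]" by (cases vs) (auto simp: walk_def)
  obtain ls where ls: "set ls = S" "distinct ls"
    using finite_distinct_list[OF finite_subset_edges[OF fin Nil.prems(3)]] by blast
  have u: "u \<in> ends G e" if "e \<in> S" for e using Nil.prems(5)[OF that] vs by auto
  have "chain (line_graph G) ls"
    using ls star_successively[OF ls(2), of G u] u Nil.prems(3) by (auto simp: chain_def)
  moreover have "ls \<noteq> [] \<longrightarrow> hd vs \<in> ends G (hd ls)" using u vs ls hd_in_set[of ls] by auto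
  ultimately show ?case using ls by auto
next
  case (Cons e es)
  then obtain u us where vs: "vs = u # us" by (cases vs) (auto simp: walk_def)
  then have w: "us \<noteq> []" "walk G us es" "u \<in> verts G" "e \<in> edges G" "ends G e = {u, hd us}"
    using Cons.prems by (auto simp: walk_Cons)
  define S1 where "S1 = {s \<in> S. u \<in> ends G s}"
  have "\<exists>ls. chain (line_graph G) ls \<and> set ls = set es \<union> (S - S1) \<and> (ls \<noteq> [] \<longrightarrow> hd us \<in> ends G (hd ls))"
  proof (rule Cons.IH[OF w(2)])
    fix s assume "s \<in> S - S1"
    then show "ends G s \<inter> set us \<noteq> {}" using Cons.prems(5)[of s] vs by (auto simp: S1_def)
  qed (use Cons.prems in auto)
  then obtain ls where ls: "chain (line_graph G) ls" "set ls = set es \<union> (S - S1)" "ls \<noteq> [] \<longrightarrow> hd us \<in> ends G (hd ls)"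
    by blast
  have "finite S1" using finite_subset_edges[OF fin Cons.prems(3)] by (simp add: S1_def)
  then obtain ks where ks: "set ks = S1" "distinct ks" using finite_distinct_list by blast
  have eS: "e \<notin> S" "e \<notin> set es" using Cons.prems by auto
  have "successively (\<lambda>e f. (e, f) \<in> adj (line_graph G)) (ks @ [e])"
  proof (rule star_successively)
    show "distinct (ks @ [e])" using ks eS by (auto simp: S1_def)
    show "f \<in> edges G \<and> u \<in> ends G f" if "f \<in> set (ks @ [e])" for f
      using that ks w Cons.prems(3) by (auto simp: S1_def)
  qed
  moreover have "(e, hd ls) \<in> adj (line_graph G)" if "ls \<noteq> []"
  proof -
    have h: "hd ls \<in> set es \<union> (S - S1)" using ls(2) that hd_in_set by blast
    then have "hd ls \<in> edges G" "hd ls \<noteq> e" using Cons.prems eS by (auto simp: walk_def)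
    then show ?thesis using w ls(3) that by (auto simp: adj_line_graph)
  qed
  ultimately have "successively (\<lambda>e f. (e, f) \<in> adj (line_graph G)) ((ks @ [e]) @ ls)"
    using ls(1) unfolding successively_append_iff[of _ "ks @ [e]" ls] by (auto simp: chain_def)
  moreover have "distinct ((ks @ [e]) @ ls)"
    using ks ls eS Cons.prems(4) by (auto simp: S1_def chain_def)
  moreover have "set ((ks @ [e]) @ ls) = set (e # es) \<union> S" using ks ls(2) by (auto simp: S1_def)
  moreover have "hd vs \<in> ends G (hd ((ks @ [e]) @ ls))"
  proof (cases ks)
    case Nil
    then show ?thesis using w vs by simp
  next
    case (Cons k ks')
    then have "k \<in> S1" using ks by auto
    then show ?thesis using Cons vs by (simp add: S1_def)
  qed
  ultimately show ?case unfolding chain_def by blast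
qed

text \<open>The trail visits common ends of consecutive edges of the list and traverses an edge only
  when the common ends on its two sides differ. The starting end \<open>x\<close> is left arbitrary
  for the induction.\<close>

lemma trail_of_line_chain:
  assumes fin: "fin_graph G"
  shows "successively (\<lambda>e f. (e, f) \<in> adj (line_graph G)) ls \<Longrightarrow> distinct ls \<Longrightarrow> ls \<noteq> [] \<Longrightarrow>
    set ls \<subseteq> edges G \<Longrightarrow> x \<in> ends G (hd ls) \<Longrightarrow>
    \<exists>vs es. walk G vs es \<and> hd vs = x \<and> distinct es \<and> set es \<subseteq> set ls \<and> (\<forall>e\<in>set ls. ends G e \<inter> set vs \<noteq> {})"
proof (induction ls arbitrary: x)
  case (Cons e ls)
  have eE: "e \<in> edges G" and xe: "x \<in> ends G e" using Cons.prems by auto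
  then have xV: "x \<in> verts G" using ends_subset[OF fin] by blast
  show ?case
  proof (cases "ls = []")
    case True
    then show ?thesis using xV xe by (intro exI[of _ "[x]"] exI[of _ "[]"]) (auto simp: walk_singleton)
  next
    case False
    then have "(e, hd ls) \<in> adj (line_graph G)" and succ: "successively (\<lambda>e f. (e, f) \<in> adj (line_graph G)) ls"
      using Cons.prems by (auto simp: successively_Cons)
    then obtain z where z: "z \<in> ends G e" "z \<in> ends G (hd ls)" by (auto simp: adj_line_graph)
    obtain vs es where w: "walk G vs es" "hd vs = z" "distinct es" "set es \<subseteq> set ls" "\<forall>e\<in>set ls. ends G e \<inter> set vs \<noteq> {}"
      using Cons.IH[OF succ _ False _ z(2)] Cons.prems by auto
    have zvs: "z \<in> set vs" using w(2) walk_length[OF w(1)] by (cases vs) auto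
    show ?thesis
    proof (cases "z = x")
      case True
      then show ?thesis using w z(1) zvs by (intro exI[of _ vs] exI[of _ es]) auto
    next
      case False
      then have "ends G e = {x, z}" using obtain_other_end[OF fin eE xe] z(1) by auto
      then have "walk G (x # vs) (e # es)" using walk_prepend[OF w(1) eE xV] w(2) by simp
      then show ?thesis using w xe Cons.prems(2) by (intro exI[of _ "x # vs"] exI[of _ "e # es"]) auto
    qed
  qed
qed simp

text \<open>At distance 0 only links of \<open>A\<close> connect, and a path with one edge is an
  edge. So \<open>R\<close> is the vertex set of a connected dominating edge set, or a single
  dominating hub when \<open>A\<close> is empty.\<close>

lemma skeleton_1_iff:
  "skeleton 1 G A R \<longleftrightarrow> A \<subseteq> edges G \<and> card (odd_set G A) \<le> 2 \<and>
     cover G A \<subseteq> R \<and> R \<subseteq> cover G A \<union> hubs G \<and> R \<noteq> {} \<and> R \<times> R \<subseteq> (links G A)\<^sup>* \<and>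
     (\<forall>e\<in>edges G. ends G e \<inter> R \<noteq> {})" if "fin_graph G"
proof -
  have "(hops 0 G A R)\<^sup>* = (links G A)\<^sup>*" if "cover G A \<subseteq> R"
  proof -
    have "links G A \<subseteq> hops 0 G A R" "hops 0 G A R \<subseteq> (links G A)\<^sup>*"
      using links_cover[of G A] that by (auto simp: hops_def near_def)
    then show ?thesis by (metis rtrancl_subset)
  qed
  moreover have "(\<forall>xs. chain G xs \<and> length xs = 2 \<longrightarrow> set xs \<inter> R \<noteq> {}) \<longleftrightarrow> (\<forall>e\<in>edges G. ends G e \<inter> R \<noteq> {})"
  proof
    assume L: "\<forall>xs. chain G xs \<and> length xs = 2 \<longrightarrow> set xs \<inter> R \<noteq> {}"
    show "\<forall>e\<in>edges G. ends G e \<inter> R \<noteq> {}"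
    proof
      fix e assume e: "e \<in> edges G"
      obtain x y where xy: "ends G e = {x, y}" "x \<noteq> y" using obtain_ends[OF \<open>fin_graph G\<close> e] .
      then have "chain G [x, y]" using e by (auto simp: chain_def links_def)
      then show "ends G e \<inter> R \<noteq> {}" using L[rule_format, of "[x, y]"] xy by auto
    qed
  next
    assume L: "\<forall>e\<in>edges G. ends G e \<inter> R \<noteq> {}"
    show "\<forall>xs. chain G xs \<and> length xs = 2 \<longrightarrow> set xs \<inter> R \<noteq> {}"
    proof (intro allI impI)
      fix xs assume xs: "chain G xs \<and> length xs = 2"
      then obtain x y where xy: "xs = [x, y]" by (auto simp: length_Suc_conv numeral_2_eq_2)
      then obtain e where "e \<in> edges G" "ends G e = {x, y}" using xs by (auto simp: chain_def links_def)
      then show "set xs \<inter> R \<noteq> {}" using L xy by force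
    qed
  qed
  ultimately show ?thesis unfolding skeleton_def by (auto simp: numeral_2_eq_2)
qed

lemma traceable_iff_chain:
  assumes "fin_graph G"
  shows "traceable G \<longleftrightarrow> (\<exists>xs. chain G xs \<and> xs \<noteq> [] \<and> set xs = verts G)"
proof
  assume "traceable G"
  then obtain vs es where p: "walk G vs es" "distinct vs" "set vs = verts G" by (auto simp: traceable_def path_def)
  then show "\<exists>xs. chain G xs \<and> xs \<noteq> [] \<and> set xs = verts G"
    using walk_successively[OF p(1)] walk_ends(3)[OF p(1)] by (auto simp: chain_def)
next
  assume "\<exists>xs. chain G xs \<and> xs \<noteq> [] \<and> set xs = verts G"
  then show "traceable G" using chain_obtain_path unfolding traceable_def by blast
qed

lemma traceable_line_graph_iff:
  fixes G :: "(('v, 'e) cell, ('v, 'e) cell) multigraph"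
  assumes fin: "fin_graph G" and ne: "edges G \<noteq> {}"
  shows "traceable (line_graph G) \<longleftrightarrow> (\<exists>A R. skeleton 1 G A R)"
proof
  assume "traceable (line_graph G)"
  then obtain ls where ls: "chain (line_graph G) ls" "ls \<noteq> []" "set ls = edges G"
    unfolding traceable_iff_chain[OF fin_graph_line_graph[OF fin]] by auto
  obtain x where x: "x \<in> ends G (hd ls)" using obtain_ends[OF fin, of "hd ls"] hd_in_set[OF ls(2)] ls(3) by blast
  obtain vs es where w: "walk G vs es" "distinct es" "\<forall>e\<in>edges G. ends G e \<inter> set vs \<noteq> {}"
    using trail_of_line_chain[OF fin, of ls x] ls x by (auto simp: chain_def)
  \<comment> \<open>A trail without edges is prolonged by one edge: its single vertex may fail to be
    a hub, and then it could not serve as \<open>R\<close>.\<close>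
  have "\<exists>vs es. walk G vs es \<and> es \<noteq> [] \<and> distinct es \<and> (\<forall>e\<in>edges G. ends G e \<inter> set vs \<noteq> {})"
  proof (cases "es = []")
    case True
    then obtain u where u: "vs = [u]" using w(1) by (cases vs) (auto simp: walk_def)
    obtain e where e: "e \<in> edges G" using ne by blast
    then have "u \<in> ends G e" using w(3) u by auto
    then obtain y where "ends G e = {u, y}" using obtain_other_end[OF fin e] by metis
    then have "walk G [u, y] [e]" using e ends_subset[OF fin e] by (simp add: walk_Cons walk_singleton)
    then show ?thesis using w(3) u by (intro exI[of _ "[u, y]"] exI[of _ "[e]"]) auto
  qed (use w in blast)
  then obtain vs es where w: "walk G vs es" "es \<noteq> []" "distinct es" "\<forall>e\<in>edges G. ends G e \<inter> set vs \<noteq> {}"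
    by blast
  have cov: "cover G (set es) = set vs" using walk_cover[OF w(1,2)] cover_walk[OF w(1)] by blast
  have s: "sym ((links G (set es))\<^sup>*)" by (intro sym_rtrancl sym_links)
  have "set vs \<times> set vs \<subseteq> (links G (set es))\<^sup>*"
  proof (intro subrelI)
    fix x y assume "(x, y) \<in> set vs \<times> set vs"
    then have "(x, hd vs) \<in> (links G (set es))\<^sup>*" "(y, hd vs) \<in> (links G (set es))\<^sup>*"
      using walk_reaches[OF w(1)] by auto
    then show "(x, y) \<in> (links G (set es))\<^sup>*" using symD[OF s] by (meson rtrancl_trans)
  qed
  moreover have "card (odd_set G (set es)) \<le> 2" using odd_set_walk[OF fin w(1,3)] by simp
  ultimately have "skeleton 1 G (set es) (set vs)"
    unfolding skeleton_1_iff[OF fin] cov using w walk_ends(3)[OF w(1)] by (auto simp: walk_def)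
  then show "\<exists>A R. skeleton 1 G A R" by blast
next
  assume "\<exists>A R. skeleton 1 G A R"
  then obtain A R where A: "A \<subseteq> edges G" "card (odd_set G A) \<le> 2" "cover G A \<subseteq> R" "R \<noteq> {}"
    "R \<times> R \<subseteq> (links G A)\<^sup>*" "\<forall>e\<in>edges G. ends G e \<inter> R \<noteq> {}" "R \<subseteq> cover G A \<union> hubs G"
    unfolding skeleton_1_iff[OF fin] by blast
  have "\<exists>vs es. walk G vs es \<and> distinct es \<and> set es = A \<and> R \<subseteq> set vs"
  proof (cases "A = {}")
    case True
    obtain r where r: "r \<in> R" using A(4) by blast
    have "links G {} = {}" by (simp add: links_def)
    then have "R \<times> R \<subseteq> Id" using A(5) True by simp
    then have "R = {r}" using r by auto
    moreover have "r \<in> verts G" using A(7) r True by (auto simp: cover_def hubs_def)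
    ultimately show ?thesis using True by (intro exI[of _ "[r]"] exI[of _ "[]"]) (simp add: walk_singleton)
  next
    case False
    have "cover G A \<times> cover G A \<subseteq> (links G A)\<^sup>*" using A(3,5) by blast
    then obtain vs es where w: "walk G vs es" "distinct es" "set es = A"
      using euler_trail[OF fin A(1) False _ A(2)] by blast
    have esne: "es \<noteq> []" using False w by auto
    have cov: "cover G A \<subseteq> set vs" using cover_walk[OF w(1)] w(3) by simp
    have "x \<in> set vs" if x: "x \<in> R" for x
    proof -
      have h: "hd vs \<in> set vs" using walk_ends(3)[OF w(1)] by simp
      then have "hd vs \<in> R" using walk_cover[OF w(1) esne] A(3) w(3) by blast
      then have "(hd vs, x) \<in> (links G A)\<^sup>*" using A(5) x by blast
      then show ?thesis using h by (rule rtrancl_closed) (use links_cover[of G A] cov in blast)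
    qed
    then show ?thesis using w by blast
  qed
  then obtain vs es where w: "walk G vs es" "distinct es" "set es = A" "R \<subseteq> set vs" by blast
  have "\<exists>ls. chain (line_graph G) ls \<and> set ls = set es \<union> (edges G - A) \<and> (ls \<noteq> [] \<longrightarrow> hd vs \<in> ends G (hd ls))"
    by (rule line_chain_of_trail[OF fin w(1,2)]) (use A(6) w(3,4) in auto)
  then obtain ls where "chain (line_graph G) ls" "set ls = edges G" using w(3) A(1) by auto
  then show "traceable (line_graph G)"
    unfolding traceable_iff_chain[OF fin_graph_line_graph[OF fin]] using ne by auto
qed

section \<open>Passing to cells\<close>

lemma embed_simps [simp]:
  "verts (embed G) = Vert ` verts G" "edges (embed G) = Edge ` edges G" "ends (embed G) (Edge e) = Vert ` ends G e"
  by (simp_all add: embed_def)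

lemma Vert_image_eq: "Vert ` X = {Vert x, Vert y} \<longleftrightarrow> X = {x, y}"
  using inj_image_eq_iff[of Vert X "{x, y}"] by (simp add: inj_on_def)

lemma links_embed:
  fixes G :: "('v, 'e) multigraph"
  shows "links (embed G) (Edge ` A) = map_prod Vert Vert ` links G A"
proof (intro equalityI subrelI)
  fix p q :: "('v, 'e) cell"
  assume "(p, q) \<in> links (embed G) (Edge ` A)"
  then obtain e where e: "e \<in> A" "Vert ` ends G e = {p, q}" by (auto simp: links_def)
  then obtain x y where "p = Vert x" "q = Vert y" by (metis imageE insertI1 insert_commute)
  then show "(p, q) \<in> map_prod Vert Vert ` links G A"
    using e Vert_image_eq by (fastforce simp: links_def)
next
  fix p q :: "('v, 'e) cell"
  assume "(p, q) \<in> map_prod Vert Vert ` links G A"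
  then show "(p, q) \<in> links (embed G) (Edge ` A)" by (auto simp: links_def)
qed

lemma near_embed: "(Vert x, q) \<in> near (embed G) m \<longleftrightarrow> (\<exists>y. q = Vert y \<and> (x, y) \<in> near G m)"
proof (induction m arbitrary: q)
  case 0
  then show ?case by (auto simp: near_def)
next
  case (Suc m)
  have step: "(Vert y, q) \<in> (adj (embed G))\<^sup>= \<longleftrightarrow> (\<exists>z. q = Vert z \<and> (y, z) \<in> (adj G)\<^sup>=)" for y q
    by (auto simp: links_embed)
  show ?case
  proof
    assume "(Vert x, q) \<in> near (embed G) (Suc m)"
    then obtain p where p: "(Vert x, p) \<in> near (embed G) m" "(p, q) \<in> (adj (embed G))\<^sup>=" by (auto simp: near_def)
    then obtain y where "p = Vert y" "(x, y) \<in> near G m" using Suc.IH by blast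
    moreover then obtain z where "q = Vert z" "(y, z) \<in> (adj G)\<^sup>=" using p(2) step by blast
    ultimately show "\<exists>y. q = Vert y \<and> (x, y) \<in> near G (Suc m)" by (auto simp: near_def)
  next
    assume "\<exists>y. q = Vert y \<and> (x, y) \<in> near G (Suc m)"
    then obtain y z where z: "q = Vert z" "(x, y) \<in> near G m" "(y, z) \<in> (adj G)\<^sup>=" by (auto simp: near_def)
    then have "(Vert x, Vert y) \<in> near (embed G) m" "(Vert y, q) \<in> (adj (embed G))\<^sup>=" using Suc.IH step by blast+
    then show "(Vert x, q) \<in> near (embed G) (Suc m)" by (auto simp: near_def)
  qed
qed

lemma hops_embed: "hops m (embed G) (Edge ` A) (Vert ` R) = map_prod Vert Vert ` hops m G A R"
proof -
  have "near (embed G) m \<inter> (Vert ` R) \<times> (Vert ` R) = map_prod Vert Vert ` (near G m \<inter> R \<times> R)"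
    by (auto simp: near_embed)
  moreover have "links (embed G) (Edge ` A) \<inter> (Vert ` R) \<times> (Vert ` R) = map_prod Vert Vert ` (links G A \<inter> R \<times> R)"
    unfolding links_embed by auto
  ultimately show ?thesis unfolding hops_def by (simp add: Int_Un_distrib2 image_Un)
qed

lemma rtrancl_embed: "(Vert x, Vert y) \<in> (map_prod Vert Vert ` r)\<^sup>* \<longleftrightarrow> (x, y) \<in> r\<^sup>*"
proof
  have "(Vert x, q) \<in> (map_prod Vert Vert ` r)\<^sup>* \<Longrightarrow> \<exists>z. q = Vert z \<and> (x, z) \<in> r\<^sup>*" for q
    by (induction rule: rtrancl_induct) (auto intro: rtrancl_into_rtrancl)
  then show "(Vert x, Vert y) \<in> (map_prod Vert Vert ` r)\<^sup>* \<Longrightarrow> (x, y) \<in> r\<^sup>*" by blast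
  show "(x, y) \<in> r\<^sup>* \<Longrightarrow> (Vert x, Vert y) \<in> (map_prod Vert Vert ` r)\<^sup>*"
  proof (induction rule: rtrancl_induct)
    case (step y z)
    then have "(Vert y, Vert z) \<in> map_prod Vert Vert ` r" by force
    with step.IH show ?case by (rule rtrancl_into_rtrancl)
  qed simp
qed

lemma rtrancl_embed_subset_iff:
  "(Vert ` R) \<times> (Vert ` R) \<subseteq> (map_prod Vert Vert ` r)\<^sup>* \<longleftrightarrow> R \<times> R \<subseteq> r\<^sup>*"
  (is "?S \<times> ?S \<subseteq> ?r \<longleftrightarrow> _")
proof
  assume L: "?S \<times> ?S \<subseteq> ?r"
  show "R \<times> R \<subseteq> r\<^sup>*"
  proof (rule subrelI)
    fix x y assume "(x, y) \<in> R \<times> R"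
    then have "(Vert x, Vert y) \<in> ?r" by (intro subsetD[OF L]) auto
    then show "(x, y) \<in> r\<^sup>*" by (simp only: rtrancl_embed)
  qed
next
  assume "R \<times> R \<subseteq> r\<^sup>*"
  then show "?S \<times> ?S \<subseteq> ?r"
    by (auto simp: rtrancl_embed)
qed

lemma card_Vert_image: "card (Vert ` X) = card X"
  by (intro card_image) (simp add: inj_on_def)

lemma incident_embed: "incident (embed G) (Edge ` A) (Vert v) = Edge ` incident G A v"
  by (auto simp: incident_def)

lemma card_incident_embed: "card (incident (embed G) (Edge ` A) (Vert v)) = card (incident G A v)"
  unfolding incident_embed by (intro card_image) (simp add: inj_on_def)

lemma odd_set_embed: "odd_set (embed G) (Edge ` A) = Vert ` odd_set G A"
proof (intro equalityI subsetI)
  fix p assume p: "p \<in> odd_set (embed G) (Edge ` A)"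
  then have "p \<in> cover (embed G) (Edge ` A)" by (rule subsetD[OF odd_set_subset_cover])
  then obtain v where "p = Vert v" by (auto simp: cover_def)
  then show "p \<in> Vert ` odd_set G A" using p by (auto simp: odd_set_def card_incident_embed)
qed (auto simp: odd_set_def card_incident_embed)

lemma cover_embed: "cover (embed G) (Edge ` A) = Vert ` cover G A"
  by (auto simp: cover_def)

lemma hubs_embed: "hubs (embed G) = Vert ` hubs G"
  using card_incident_embed[of G "edges G"] by (auto simp: hubs_def degree_incident)

lemma chain_embed: "chain (embed G) (map Vert xs) \<longleftrightarrow> chain G xs"
proof -
  have "(Vert x, Vert y) \<in> adj (embed G) \<longleftrightarrow> (x, y) \<in> adj G" for x y by (auto simp: links_embed)
  then show ?thesis by (simp add: chain_def distinct_map inj_on_def successively_map)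
qed

text \<open>Chains of \<open>embed G\<close> range over all cells, but for \<open>k \<ge> 1\<close>
  each entry has a neighbour in the chain and is therefore of the form
  \<open>Vert x\<close>.\<close>

lemma skeleton_embed:
  assumes "1 \<le> k"
  shows "skeleton k (embed G) (Edge ` A) (Vert ` R) \<longleftrightarrow> skeleton k G A R"
proof -
  have inj: "inj Vert" "inj Edge" by (simp_all add: inj_on_def)
  have "(\<forall>ys. chain (embed G) ys \<and> length ys = Suc k \<longrightarrow> set ys \<inter> Vert ` R \<noteq> {}) \<longleftrightarrow>
      (\<forall>xs. chain G xs \<and> length xs = Suc k \<longrightarrow> set xs \<inter> R \<noteq> {})"
  proof (intro iffI allI impI)
    fix xs assume L: "\<forall>ys. chain (embed G) ys \<and> length ys = Suc k \<longrightarrow> set ys \<inter> Vert ` R \<noteq> {}" and xs: "chain G xs \<and> length xs = Suc k"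
    from L[rule_format, of "map Vert xs"] xs show "set xs \<inter> R \<noteq> {}" by (auto simp: chain_embed)
  next
    fix ys assume R: "\<forall>xs. chain G xs \<and> length xs = Suc k \<longrightarrow> set xs \<inter> R \<noteq> {}" and ys: "chain (embed G) ys \<and> length ys = Suc k"
    have step: "(ys ! i, ys ! Suc i) \<in> adj (embed G)" if "i < k" for i
      using ys that by (auto simp: chain_def intro: successively_nth)
    have "\<forall>y\<in>set ys. y \<in> range Vert"
    proof
      fix y assume "y \<in> set ys"
      then obtain i where i: "i \<le> k" "y = ys ! i" using ys by (auto simp: in_set_conv_nth less_Suc_eq_le)
      show "y \<in> range Vert"
      proof (cases "i < k")
        case True
        then show ?thesis using step[of i] i by (auto simp: links_embed)
      next
        case False
        then have "Suc (i - 1) = i" "i - 1 < k" using i assms by auto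
        then show ?thesis using step[of "i - 1"] i by (auto simp: links_embed)
      qed
    qed
    then obtain xs where xs: "ys = map Vert xs" by (metis ex_map_conv rangeE)
    then have "set xs \<inter> R \<noteq> {}" using R ys chain_embed[of G xs] by auto
    then show "set ys \<inter> Vert ` R \<noteq> {}" using xs by auto
  qed
  then show ?thesis
    unfolding skeleton_def card_Vert_image hops_embed odd_set_embed cover_embed hubs_embed embed_simps image_Un[symmetric]
      rtrancl_embed_subset_iff
    by (simp add: inj_image_subset_iff inj)
qed

lemma skeleton_embed_ex_iff:
  fixes G :: "('v, 'e) multigraph"
  assumes fin: "fin_graph G" and "1 \<le> k"
  shows "(\<exists>A R. skeleton k (embed G) A R \<and> hubs (embed G) \<subseteq> R) \<longleftrightarrow> (\<exists>A R. skeleton k G A R \<and> hubs G \<subseteq> R)"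
proof
  assume "\<exists>A R. skeleton k (embed G) A R \<and> hubs (embed G) \<subseteq> R"
  then obtain A R where sk: "skeleton k (embed G) A R" "hubs (embed G) \<subseteq> R" by blast
  have "A \<subseteq> Edge ` edges G" using sk by (simp add: skeleton_def)
  moreover have "R \<subseteq> Vert ` verts G" using skeleton_verts[OF fin_graph_embed[OF fin] sk(1)] by simp
  ultimately obtain B S where "A = Edge ` B" "R = Vert ` S" by (meson subset_imageE)
  then show "\<exists>A R. skeleton k G A R \<and> hubs G \<subseteq> R"
    using sk skeleton_embed[OF assms(2), of G B S] by (auto simp: hubs_embed inj_image_subset_iff inj_on_def)
next
  assume "\<exists>A R. skeleton k G A R \<and> hubs G \<subseteq> R"
  then show "\<exists>A R. skeleton k (embed G) A R \<and> hubs (embed G) \<subseteq> R"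
    using skeleton_embed[OF assms(2), of G] hubs_embed by (metis image_mono)
qed

section \<open>Iteration\<close>

text \<open>Connectedness without a demand for vertices, because line graphs far enough up may be
  empty.\<close>

definition linked :: "('v, 'e) multigraph \<Rightarrow> bool" where
  "linked G \<longleftrightarrow> (\<forall>x\<in>verts G. \<forall>y\<in>verts G. (x, y) \<in> (adj G)\<^sup>*)"

lemma linked_embed: "linked G \<Longrightarrow> linked (embed G)"
  unfolding linked_def by (auto simp: links_embed rtrancl_embed)

lemma linked_line_graph:
  fixes G :: "(('v, 'e) cell, ('v, 'e) cell) multigraph"
  assumes fin: "fin_graph G" and conn: "linked G"
  shows "linked (line_graph G)"
  unfolding linked_def
proof (intro ballI)
  fix e f assume "e \<in> verts (line_graph G)" "f \<in> verts (line_graph G)"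
  then have e: "e \<in> edges G" and f: "f \<in> edges G" by auto
  obtain x x' where x: "ends G e = {x, x'}" using obtain_ends[OF fin e] by metis
  obtain y y' where y: "ends G f = {y, y'}" using obtain_ends[OF fin f] by metis
  have share: "(g, h) \<in> (adj (line_graph G))\<^sup>*" if "g \<in> edges G" "h \<in> edges G" "z \<in> ends G g" "z \<in> ends G h" for g h z
    using that by (cases "g = h") (auto simp: adj_line_graph intro!: r_into_rtrancl)
  show "(e, f) \<in> (adj (line_graph G))\<^sup>*"
  proof (cases "x = y")
    case True
    then show ?thesis using share[OF e f, of x] x y by simp
  next
    case False
    have "(x, y) \<in> (adj G)\<^sup>*" using conn x y ends_subset[OF fin e] ends_subset[OF fin f] by (auto simp: linked_def)
    then have "(x, y) \<in> ((adj G)\<^sup>=)\<^sup>*" by simp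
    then obtain m where "(x, y) \<in> near G m" unfolding near_def by (metis rtrancl_imp_relpow)
    then obtain g h where gh: "g \<in> edges G" "h \<in> edges G" "x \<in> ends G g" "y \<in> ends G h" "(g, h) \<in> near (line_graph G) (m - 1)"
      using near_line_graph[OF _ False fin] by blast
    then have "(g, h) \<in> (adj (line_graph G))\<^sup>*"
      unfolding near_def by (metis relpow_imp_rtrancl rtrancl_reflcl)
    moreover have "(e, g) \<in> (adj (line_graph G))\<^sup>*" using share[OF e gh(1), of x] x gh by simp
    moreover have "(h, f) \<in> (adj (line_graph G))\<^sup>*" using share[OF gh(2) f, of y] y gh by simp
    ultimately show ?thesis by (meson rtrancl_trans)
  qed
qed

text \<open>Otherwise the two parallel edges would form a whole component, although there is a third
  edge.\<close>

lemma parallel_edges_hub: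
  assumes fin: "fin_graph G" and conn: "linked G" and "3 \<le> card (edges G)"
    and e: "e \<in> edges G" and f: "f \<in> edges G" and neq: "e \<noteq> f" and ends: "ends G e = ends G f"
  shows "ends G e \<inter> hubs G \<noteq> {}"
proof
  assume no: "ends G e \<inter> hubs G = {}"
  have only: "g = e \<or> g = f" if "g \<in> edges G" "w \<in> ends G g" "w \<in> ends G e" for g w
    using hubI3[OF fin e f that(1) neq, of w] that no ends by blast
  have "\<not> edges G \<subseteq> {e, f}"
  proof
    assume "edges G \<subseteq> {e, f}"
    then have "card (edges G) \<le> card {e, f}" by (intro card_mono) auto
    then show False using assms(3) neq by simp
  qed
  then obtain g where g: "g \<in> edges G" "g \<noteq> e" "g \<noteq> f" by blast
  obtain z z' where z: "ends G g = {z, z'}" using obtain_ends[OF fin g(1)] by metis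
  obtain x x' where x: "ends G e = {x, x'}" using obtain_ends[OF fin e] by metis
  have "(x, z) \<in> (adj G)\<^sup>*"
    using conn x z ends_subset[OF fin e] ends_subset[OF fin g(1)] by (auto simp: linked_def)
  then have "z \<in> ends G e"
  proof (rule rtrancl_closed)
    show "x \<in> ends G e" using x by simp
    fix p q assume p: "p \<in> ends G e" "(p, q) \<in> adj G"
    then obtain h where h: "h \<in> edges G" "ends G h = {p, q}" by (auto simp: links_def)
    then have "h = e \<or> h = f" using only p(1) by blast
    then show "q \<in> ends G e" using h ends by auto
  qed
  then show False using only[OF g(1)] z g by blast
qed

theorem theorem4:
  fixes G :: "('v, 'e) multigraph" and n :: nat
  assumes "fin_graph G"
    and "connected_graph G"
    and "card (edges G) \<ge> 3"
    and "n \<ge> 2"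
    and "edges (iterated_line_graph (n - 1) G) \<noteq> {}"
  shows "traceable (iterated_line_graph n G) \<longleftrightarrow> EUP n G \<noteq> {}"
proof -
  define X where "X j = iterated_line_graph j G" for j
  have X0: "X 0 = embed G" and XS: "X (Suc j) = line_graph (X j)" for j
    by (simp_all add: X_def iterated_line_graph_def)
  have finX: "fin_graph (X j)" for j
    using fin_graph_iterated_line_graph[OF assms(1)] by (simp add: X_def)
  have linkG: "linked G" using assms(2) unfolding connected_graph_iff[OF assms(1)] linked_def by blast
  have linkX: "linked (X j)" for j
    by (induction j) (simp_all add: X0 XS linked_embed[OF linkG] linked_line_graph[OF finX])
  have two: "2 \<le> card (edges (X j))" if "edges (X (Suc j)) \<noteq> {}" for j
  proof -
    obtain e f where "e \<in> edges (X j)" "f \<in> edges (X j)" "e \<noteq> f"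
      using \<open>edges (X (Suc j)) \<noteq> {}\<close> unfolding XS by (auto elim!: obtain_line_edge)
    then have "card {e, f} \<le> card (edges (X j))" using finite_edges[OF finX] by (intro card_mono) auto
    then show ?thesis using \<open>e \<noteq> f\<close> by simp
  qed
  \<comment> \<open>Downwards from the assumption on \<open>X (n - 1)\<close>: an edge of a line
    graph needs two edges one level below.\<close>
  have nonempty: "edges (X j) \<noteq> {}" if "j \<le> n - 1" for j
    using that
  proof (induction rule: inc_induct)
    case base
    then show ?case using assms(5) by (simp add: X_def)
  next
    case (step j)
    then show ?case using two[of j] by auto
  qed
  \<comment> \<open>At level 0 the bound of three edges enters; all later graphs are line graphs and
    have no parallel edges.\<close>
  have par: "ends (X j) e \<inter> hubs (X j) \<noteq> {}"
    if eX: "e \<in> edges (X j)" and "f \<in> edges (X j)" "e \<noteq> f" "ends (X j) e = ends (X j) f" for j e f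
  proof (cases j)
    case 0
    have "card (edges (embed G)) = card (edges G)" by (simp add: card_image inj_on_def)
    then show ?thesis using parallel_edges_hub[OF finX linkX, of j e f] assms(3) that 0 X0 by simp
  next
    case (Suc i)
    then obtain p q where pq: "e = Adj (Upair p q)" "p \<noteq> q"
      using eX unfolding Suc XS by (auto elim!: obtain_line_edge)
    then have "f = e"
      using line_edge_eqI[of f "X i" p q] that Suc XS by auto
    then show ?thesis using that by simp
  qed
  \<comment> \<open>Nothing is assumed about the hubs of \<open>X (Suc j)\<close>, yet the result
    contains all hubs of \<open>X j\<close>. As \<open>n \<ge> 2\<close>, at least one such descent
    separates \<open>X (n - 1)\<close> from \<open>X 0\<close>.\<close>
  have down: "\<exists>A R. skeleton (Suc k) (X j) A R \<and> hubs (X j) \<subseteq> R"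
    if "skeleton k (X (Suc j)) A R" "1 \<le> k" for k j A R
    using skeleton_descent[OF finX _ that(1)[unfolded XS] that(2)] linkX[of "Suc j"]
    unfolding linked_def XS by (metis Un_upper2 verts_line_graph)
  \<comment> \<open>The bound on \<open>j\<close> ensures that \<open>X (Suc j)\<close> has an edge,
    so that \<open>X j\<close> has the two edges required by \<open>skeleton_ascent\<close>.\<close>
  have up: "\<exists>A R. skeleton k (X (Suc j)) A R \<and> hubs (X (Suc j)) \<subseteq> R"
    if "skeleton (Suc k) (X j) A R" "hubs (X j) \<subseteq> R" "1 \<le> k" "Suc j \<le> n - 1" for k j A R
    unfolding XS
    using skeleton_ascent[OF finX _ two[OF nonempty[OF that(4)]] par that(1-3)] linkX[of j]
    by (auto simp: linked_def)
  have down_all: "\<exists>A R. skeleton (k + Suc j) (X 0) A R \<and> hubs (X 0) \<subseteq> R"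
    if "skeleton k (X (Suc j)) A R" "1 \<le> k" for k j A R
    using that
  proof (induction j arbitrary: k A R)
    case 0
    then show ?case using down by auto
  next
    case (Suc j)
    then obtain A' R' where "skeleton (Suc k) (X (Suc j)) A' R'" using down by blast
    then show ?case using Suc.IH[of "Suc k" A' R'] by simp
  qed
  have up_all: "\<exists>A R. skeleton k (X j) A R \<and> hubs (X j) \<subseteq> R"
    if "\<exists>A R. skeleton (k + j) (X 0) A R \<and> hubs (X 0) \<subseteq> R" "1 \<le> k" "j \<le> n - 1" for k j
    using that
  proof (induction j arbitrary: k)
    case (Suc j)
    have "\<exists>A R. skeleton (Suc k + j) (X 0) A R \<and> hubs (X 0) \<subseteq> R" using Suc.prems(1) by simp
    then obtain A R where "skeleton (Suc k) (X j) A R" "hubs (X j) \<subseteq> R"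
      using Suc.IH[of "Suc k"] Suc.prems(3) by auto
    then show ?case using up Suc.prems by blast
  qed simp
  have n: "n = Suc (n - 1)" "n - 1 = Suc (n - 2)" using assms(4) by auto
  have "traceable (X n) \<longleftrightarrow> (\<exists>A R. skeleton 1 (X (n - 1)) A R)"
    using traceable_line_graph_iff[OF finX nonempty[OF order_refl]] XS[of "n - 1"] n(1) by simp
  also have "\<dots> \<longleftrightarrow> (\<exists>A R. skeleton n (X 0) A R \<and> hubs (X 0) \<subseteq> R)"
  proof
    assume "\<exists>A R. skeleton 1 (X (n - 1)) A R"
    then obtain A R where "skeleton 1 (X (Suc (n - 2))) A R" using n(2) by auto
    moreover have "1 + Suc (n - 2) = n" using assms(4) by simp
    ultimately show "\<exists>A R. skeleton n (X 0) A R \<and> hubs (X 0) \<subseteq> R" using down_all[of 1 "n - 2" A R] by simp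
  next
    assume "\<exists>A R. skeleton n (X 0) A R \<and> hubs (X 0) \<subseteq> R"
    then show "\<exists>A R. skeleton 1 (X (n - 1)) A R" using up_all[of 1 "n - 1"] n(1) by auto
  qed
  also have "\<dots> \<longleftrightarrow> (\<exists>A R. skeleton n G A R \<and> hubs G \<subseteq> R)"
    unfolding X0 using skeleton_embed_ex_iff[OF assms(1), of n] assms(4) by simp
  also have "\<dots> \<longleftrightarrow> (\<exists>A. eup_edges n G A)"
  proof
    assume "\<exists>A R. skeleton n G A R \<and> hubs G \<subseteq> R"
    then show "\<exists>A. eup_edges n G A" using eup_edges_of_skeleton[OF assms(1,4)] by blast
  next
    assume "\<exists>A. eup_edges n G A"
    moreover have "edges G \<noteq> {}" using assms(3) by auto
    ultimately show "\<exists>A R. skeleton n G A R \<and> hubs G \<subseteq> R"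
      using skeleton_of_eup_edges[OF assms(1) _ _ assms(4)] linkG unfolding linked_def by blast
  qed
  also have "\<dots> \<longleftrightarrow> EUP n G \<noteq> {}"
    using EUP_nonempty_iff[OF assms(1,4)] by simp
  finally show ?thesis by (simp add: X_def)
qed

end
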